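(* Let $\mathcal V\subset\mathfrak{sl}(N,\mathbb C)$ be a hypersurface orbital variety with associated standard Young tableau $T$, and let $\mathcal V_R$ be the Richardson orbital variety with $\tau(\mathcal V_R)=\tau(\mathcal V)$, with associated tableau $T_R$ of shape $\lambda$ and chains $C_1,\dots,C_{\lambda_1}$. Assume that $T$ is obtained from $T_R$ by dropping the box containing $N$ down one row. Then $\sigma(\mathcal V)=\Pi$ if and only if both of the following hold: 1. $|C_1|=|C_{\lambda_1}|$; 2. setting $I:=|C_1|$, one has $\lambda_I=\lambda_{I+1}+2$ (in other words, $C_1$ and $C_{\lambda_1}$ are the only chains of $T_R$ of length $I$).
   Context: Let $\mathfrak n$ be the strictly upper-triangular $N\times N$ complex matrices, with simple roots $\Pi=\{\alpha_1,\dots,\alpha_{N-1}\}$ and positive roots $R^+=\{\alpha(i,j)=\alpha_i+\cdots+\alpha_j : 1\le i\le j\le N-1\}$. The root vector $X_{\alpha(i,j)}$ spans the matrix position $(i,j+1)$, and $x_{i,j+1}$ is the corresponding coordinate. Identify $S(\mathfrak n)$ with $\mathbb C[x_{ij}: 1\le i<j\le N]$. For $\omega\subseteq\Pi$, $R^+(\omega)$ is the set of positive roots that are sums of elements of $\omega$. Orbital varieties: for a partition $\lambda$ of $N$, $\mathcal O_\lambda$ is the set of nilpotent matrices with Jordan blocks of sizes $\lambda_1,\lambda_2,\dots$. An orbital variety is an irreducible component of $\mathcal O_\lambda\cap\mathfrak n$ for some $\lambda$. Orbital varieties contained in $\mathcal O_\lambda$ are in bijection with standard Young tableaux of shape $\lambda$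 (via the Robinson-Schensted correspondence). The tableau $T$ associated to $\mathcal V$ is the one in which, for each $k$, the boxes with entries $\le k$ form the Young diagram of the Jordan type of the upper-left $k\times k$ submatrix of a generic $x\in\mathcal V$. $\tau$-invariant: $\tau(\mathcal V)\subseteq\Pi$ is the set of simple roots $\alpha$ such that the subgroup generated by the root subgroups of $\pm\alpha$ stabilizes $\mathcal V$ under conjugation. Equivalently, $\alpha_i\in\tau(\mathcal V)$ iff $i$ lies in a strictly higher row than $i+1$ in $T$. For $\tau\subseteq\Pi$ let $\mathfrak m_\tau=\bigoplus_{\alpha\in R^+\setminus R^+(\tau)}\mathbb C X_\alpha$. The Richardson orbital variety with $\tau$-invariant $\tau$ is the unique orbital variety $\mathcal V_R$ with $\tau(\mathcal V_R)=\tau$ and $\overline{\mathcal V}_R=\mathfrak m_\tau$. A hypersurface orbital variety is an orbital variety $\mathcal V$ whose closure is a hypersurface (codimension one) in $\mathfrak m_{\tau(\mathcal V)}$. Non-linear generator: with $\tau=\tau(\mathcal V)$, the ideal of $\overline{\mathcal V}$ is generated by the coordinates $x_{st}$ with $\alpha(s,t-1)\in R^+(\tau)$ together with one irreducible homogeneous polynomial $f$ of degree $\ge2$ in the remaining coordinates, unique up to a nonzero scalar. $\sigma$-set: $\sigma(\mathcal V)$ is the smallest connected subset $\sigma$ of $\Pi$ (i.e. of the form $\{\alpha_a,\alpha_{a+1},\dots,\alpha_b\}$) such that $f\in S(\mathfrak n_\sigma)$, where $\mathfrak n_\sigma$ is the subalgebra of $\mathfrak n$ generated by the $X_\alpha$,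 $\alpha\in\sigma$. Chains of $T_R$: the orbits on $\{1,\dots,N\}$ of the group generated by the transpositions $(i\ i+1)$, $\alpha_i\in\tau(\mathcal V_R)$. They are intervals of consecutive integers, numbered $C_1,\dots,C_{\lambda_1}$ in increasing order. $|C|$ denotes the cardinality (length) of $C$. The number of chains of length $i$ equals the number of columns of length $i$ in $T_R$. Set $\lambda_m=0$ for $m$ larger than the number of rows. Dropping a box down one row: the entry is moved to the next row, every other entry stays in its row, and each row is left-justified and written in increasing order. *)

theory Defs
  imports
    "HOL-Analysis.Function_Topology"
    "HOL-Library.Poly_Mapping"
    "HOL-Library.Extended_Nat"
    "HOL-Computational_Algebra.Factorial_Ring"
    "HOL-Combinatorics.Transposition"
    "Jordan_Normal_Form.Jordan_Normal_Form"
begin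

section \<open>Roots and root vectors\<close>

text \<open>
  The simple root \<open>\<alpha>\<^sub>i\<close> is encoded by its index \<open>i \<in> {1..<N}\<close> and the positive root
  \<open>\<alpha>(i,j) = \<alpha>\<^sub>i + \<dots> + \<alpha>\<^sub>j\<close> by the pair \<open>(i,j)\<close>. Simple roots are linearly
  independent, so \<open>\<alpha>(i,j)\<close> is a sum of elements of \<open>\<omega>\<close> iff all its summands
  \<open>\<alpha>\<^sub>i, \<dots>, \<alpha>\<^sub>j\<close> lie in \<open>\<omega>\<close>.
\<close>

definition simple_roots :: "nat \<Rightarrow> nat set" where
  "simple_roots N = {1..<N}"

definition pos_roots :: "nat \<Rightarrow> (nat \<times> nat) set" where
  "pos_roots N = {(i, j). 1 \<le> i \<and> i \<le> j \<and> j < N}"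

definition pos_roots_of :: "nat \<Rightarrow> nat set \<Rightarrow> (nat \<times> nat) set" where
  "pos_roots_of N \<omega> = {(i, j) \<in> pos_roots N. {i..j} \<subseteq> \<omega>}"

text \<open>
  The root \<open>\<alpha>(i,j)\<close> occupies the matrix position \<open>(i,j+1)\<close> in the usual numbering from 1.
  Positions and coordinates \<open>x\<^sub>s\<^sub>t\<close> follow that numbering; only the access
  \<open>A $$ (_, _)\<close> to matrix entries starts at 0.
\<close>

definition positions :: "(nat \<times> nat) set \<Rightarrow> (nat \<times> nat) set" where
  "positions R = (\<lambda>(i, j). (i, Suc j)) ` R"

definition root_vec :: "nat \<Rightarrow> nat \<Rightarrow> nat \<Rightarrow> complex mat" where
  "root_vec N i j = mat N N (\<lambda>(r, c). if (Suc r, Suc c) = (i, Suc j) then 1 else 0)"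

definition span_of_roots :: "nat \<Rightarrow> (nat \<times> nat) set \<Rightarrow> complex mat set" where
  "span_of_roots N R =
    {A \<in> carrier_mat N N. \<forall>r<N. \<forall>c<N. A $$ (r, c) \<noteq> 0 \<longrightarrow> (Suc r, Suc c) \<in> positions R}"

definition nilradical :: "nat \<Rightarrow> complex mat set" where
  "nilradical N = span_of_roots N (pos_roots N)"

definition m_space :: "nat \<Rightarrow> nat set \<Rightarrow> complex mat set" where
  "m_space N \<tau> = span_of_roots N (pos_roots N - pos_roots_of N \<tau>)"

inductive_set subalgebra_gen :: "nat \<Rightarrow> nat set \<Rightarrow> complex mat set"
  for N :: nat and \<sigma> :: "nat set"
where
  gen: "i \<in> \<sigma> \<Longrightarrow> root_vec N i i \<in> subalgebra_gen N \<sigma>"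
| zero: "0\<^sub>m N N \<in> subalgebra_gen N \<sigma>"
| add: "\<lbrakk>A \<in> subalgebra_gen N \<sigma>; B \<in> subalgebra_gen N \<sigma>\<rbrakk> \<Longrightarrow> A + B \<in> subalgebra_gen N \<sigma>"
| smult: "A \<in> subalgebra_gen N \<sigma> \<Longrightarrow> c \<cdot>\<^sub>m A \<in> subalgebra_gen N \<sigma>"
| bracket: "\<lbrakk>A \<in> subalgebra_gen N \<sigma>; B \<in> subalgebra_gen N \<sigma>\<rbrakk>
    \<Longrightarrow> A * B - B * A \<in> subalgebra_gen N \<sigma>"


section \<open>Polynomials on strictly upper-triangular matrices and the Zariski topology\<close>

text \<open>
  Polynomials in variables indexed by matrix positions: finitely supported maps from monomials
  (finitely supported exponent functions) to coefficients. The type has infinitely many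
  variables; the polynomial rings in question are its subrings \<open>polys_in P\<close>.
\<close>

type_synonym cpoly = "((nat \<times> nat) \<Rightarrow>\<^sub>0 nat) \<Rightarrow>\<^sub>0 complex"

definition poly_vars :: "cpoly \<Rightarrow> (nat \<times> nat) set" where
  "poly_vars p = (\<Union>m\<in>Poly_Mapping.keys p. Poly_Mapping.keys m)"

definition polys_in :: "(nat \<times> nat) set \<Rightarrow> cpoly set" where
  "polys_in P = {p. poly_vars p \<subseteq> P}"

definition coordinate :: "nat \<times> nat \<Rightarrow> cpoly" where
  "coordinate st = Poly_Mapping.single (Poly_Mapping.single st 1) 1"

definition peval :: "cpoly \<Rightarrow> complex mat \<Rightarrow> complex" where
  "peval p A = (\<Sum>m\<in>Poly_Mapping.keys p. Poly_Mapping.lookup p m *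
     (\<Prod>(s, t)\<in>Poly_Mapping.keys m. A $$ (s - 1, t - 1) ^ Poly_Mapping.lookup m (s, t)))"

definition homogeneous_poly :: "nat \<Rightarrow> cpoly \<Rightarrow> bool" where
  "homogeneous_poly d p \<longleftrightarrow>
    (\<forall>m\<in>Poly_Mapping.keys p. (\<Sum>v\<in>Poly_Mapping.keys m. Poly_Mapping.lookup m v) = d)"

definition sym_alg :: "nat \<Rightarrow> cpoly set" where
  "sym_alg N = polys_in (positions (pos_roots N))"

text \<open>
  \<open>S(\<nn>\<^sub>\<sigma>)\<close> inside \<open>S(\<nn>)\<close>: \<open>\<nn>\<^sub>\<sigma>\<close> is spanned by the root vectors it contains, and
  \<open>x\<^sub>i\<^sub>,\<^sub>j\<^sub>+\<^sub>1\<close> corresponds to the root vector of \<open>\<alpha>(i,j)\<close>.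
\<close>

definition sym_alg_of :: "nat \<Rightarrow> nat set \<Rightarrow> cpoly set" where
  "sym_alg_of N \<sigma> =
    polys_in (positions {(i, j) \<in> pos_roots N. root_vec N i j \<in> subalgebra_gen N \<sigma>})"

definition ideal_gen :: "nat \<Rightarrow> cpoly set \<Rightarrow> cpoly set" where
  "ideal_gen N G =
    {\<Sum>g\<in>F. c g * g |F c. finite F \<and> F \<subseteq> G \<and> (\<forall>g\<in>F. c g \<in> sym_alg N)}"

definition vanishing_ideal :: "nat \<Rightarrow> complex mat set \<Rightarrow> cpoly set" where
  "vanishing_ideal N S = {p \<in> sym_alg N. \<forall>A\<in>S. peval p A = 0}"

text \<open>
  The Zariski topology on \<open>\<nn>\<close>. The non-vanishing loci of polynomials are closed under finite
  intersections, hence a base of it.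
\<close>

definition zariski :: "nat \<Rightarrow> complex mat topology" where
  "zariski N = topology_generated_by {{A \<in> nilradical N. peval p A \<noteq> 0} |p. p \<in> sym_alg N}"

definition irreducible_in :: "'a topology \<Rightarrow> 'a set \<Rightarrow> bool" where
  "irreducible_in X S \<longleftrightarrow> S \<subseteq> topspace X \<and> S \<noteq> {} \<and>
    (\<forall>A B. closedin X A \<and> closedin X B \<and> S \<subseteq> A \<union> B \<longrightarrow> S \<subseteq> A \<or> S \<subseteq> B)"

definition irreducible_component_in :: "'a topology \<Rightarrow> 'a set \<Rightarrow> 'a set \<Rightarrow> bool" where
  "irreducible_component_in X Y S \<longleftrightarrow> S \<subseteq> Y \<and> irreducible_in X S \<and>
    (\<forall>S'. S \<subseteq> S' \<and> S' \<subseteq> Y \<and> irreducible_in X S' \<longrightarrow> S' = S)"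

text \<open>Codimension of an irreducible closed subset \<open>Y\<close> in a closed subset \<open>Z\<close>.\<close>

definition codim_in :: "'a topology \<Rightarrow> 'a set \<Rightarrow> 'a set \<Rightarrow> enat" where
  "codim_in X Y Z = Sup {enat n |n. \<exists>C :: nat \<Rightarrow> 'a set. C 0 = Y \<and> (\<forall>i<n. C i \<subset> C (Suc i)) \<and>
     (\<forall>i\<le>n. closedin X (C i) \<and> irreducible_in X (C i) \<and> C i \<subseteq> Z)}"


section \<open>Orbital varieties\<close>

definition partition_of :: "nat \<Rightarrow> nat list \<Rightarrow> bool" where
  "partition_of N \<mu> \<longleftrightarrow> sorted_wrt (\<ge>) \<mu> \<and> 0 \<notin> set \<mu> \<and> sum_list \<mu> = N"

definition nilpotent_jordan_type :: "complex mat \<Rightarrow> nat list \<Rightarrow> bool" where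
  "nilpotent_jordan_type A \<mu> \<longleftrightarrow> jordan_nf A (map (\<lambda>l. (l, 0)) \<mu>)"

definition nilpotent_orbit :: "nat \<Rightarrow> nat list \<Rightarrow> complex mat set" where
  "nilpotent_orbit N \<mu> = {A \<in> carrier_mat N N. nilpotent_jordan_type A \<mu>}"

definition orbital_variety :: "nat \<Rightarrow> complex mat set \<Rightarrow> bool" where
  "orbital_variety N V \<longleftrightarrow> (\<exists>\<mu>. partition_of N \<mu> \<and>
    irreducible_component_in (zariski N) (nilpotent_orbit N \<mu> \<inter> nilradical N) V)"

text \<open>
  The subgroup generated by the root subgroups \<open>1 + c X\<^sub>\<beta>\<close>, \<open>\<beta> = \<plusminus>\<alpha>\<^sub>i\<close>. The generators are
  closed under inverses, so products of generators suffice.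
\<close>

inductive_set root_subgroup :: "nat \<Rightarrow> nat \<Rightarrow> complex mat set"
  for N i :: nat
where
  one: "1\<^sub>m N \<in> root_subgroup N i"
| pos: "g \<in> root_subgroup N i \<Longrightarrow> (1\<^sub>m N + c \<cdot>\<^sub>m root_vec N i i) * g \<in> root_subgroup N i"
| neg: "g \<in> root_subgroup N i \<Longrightarrow>
    (1\<^sub>m N + c \<cdot>\<^sub>m transpose_mat (root_vec N i i)) * g \<in> root_subgroup N i"

definition tau :: "nat \<Rightarrow> complex mat set \<Rightarrow> nat set" where
  "tau N V = {i \<in> simple_roots N. \<forall>g \<in> root_subgroup N i. \<forall>h \<in> carrier_mat N N.
     inverts_mat g h \<longrightarrow> (\<lambda>A. g * A * h) ` V = V}"

definition richardson :: "nat \<Rightarrow> nat set \<Rightarrow> complex mat set \<Rightarrow> bool" where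
  "richardson N \<tau> V \<longleftrightarrow>
    orbital_variety N V \<and> tau N V = \<tau> \<and> zariski N closure_of V = m_space N \<tau>"

definition hypersurface_orbital_variety :: "nat \<Rightarrow> complex mat set \<Rightarrow> bool" where
  "hypersurface_orbital_variety N V \<longleftrightarrow> orbital_variety N V \<and>
    codim_in (zariski N) (zariski N closure_of V) (m_space N (tau N V)) = 1"

text \<open>\<open>irreducible\<close> is the ring-theoretic notion; the units of \<open>cpoly\<close> are the nonzero constants.\<close>

definition nonlinear_generator :: "nat \<Rightarrow> complex mat set \<Rightarrow> cpoly \<Rightarrow> bool" where
  "nonlinear_generator N V f \<longleftrightarrow>
    f \<in> polys_in (positions (pos_roots N - pos_roots_of N (tau N V))) \<and>
    irreducible f \<and> (\<exists>d\<ge>2. homogeneous_poly d f) \<and>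
    vanishing_ideal N (zariski N closure_of V) =
      ideal_gen N (insert f (coordinate ` positions (pos_roots_of N (tau N V))))"

definition connected_roots :: "nat \<Rightarrow> nat set \<Rightarrow> bool" where
  "connected_roots N \<sigma> \<longleftrightarrow> (\<exists>a b. 1 \<le> a \<and> a \<le> b \<and> b < N \<and> \<sigma> = {a..b})"

text \<open>
  \<open>LEAST\<close> is with respect to inclusion. The nonlinear generator is unique up to a nonzero
  scalar, so the choice of \<open>f\<close> is immaterial.
\<close>

definition sigma :: "nat \<Rightarrow> complex mat set \<Rightarrow> nat set" where
  "sigma N V = (LEAST \<sigma>. connected_roots N \<sigma> \<and>
     (\<exists>f. nonlinear_generator N V f \<and> f \<in> sym_alg_of N \<sigma>))"


section \<open>Tableaux and chains\<close>

text \<open>A tableau is the list of its rows, from top to bottom.\<close>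

definition standard_tableau :: "nat \<Rightarrow> nat list list \<Rightarrow> bool" where
  "standard_tableau N T \<longleftrightarrow>
    partition_of N (map length T) \<and> set (concat T) = {1..N} \<and>
    (\<forall>r\<in>set T. sorted_wrt (<) r) \<and>
    (\<forall>i j. Suc i < length T \<and> j < length (T ! Suc i) \<longrightarrow> T ! i ! j < T ! Suc i ! j)"

text \<open>\<open>\<lambda>\<^sub>m\<close> and the set of entries of row \<open>m\<close>, for \<open>m \<ge> 1\<close>.\<close>

definition row_length :: "nat list list \<Rightarrow> nat \<Rightarrow> nat" where
  "row_length T m = (if 1 \<le> m \<and> m \<le> length T then length (T ! (m - 1)) else 0)"

definition row_set :: "nat list list \<Rightarrow> nat \<Rightarrow> nat set" where
  "row_set T m = (if 1 \<le> m \<and> m \<le> length T then set (T ! (m - 1)) else {})"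

definition restricted_shape :: "nat list list \<Rightarrow> nat \<Rightarrow> nat list" where
  "restricted_shape T k = filter (\<lambda>l. l \<noteq> 0) (map (\<lambda>r. length (filter (\<lambda>e. e \<le> k) r)) T)"

text \<open>
  \<open>V\<close> being irreducible, a property is generic on \<open>V\<close> iff it holds on some nonempty
  relatively open subset.
\<close>

definition associated_tableau :: "nat \<Rightarrow> complex mat set \<Rightarrow> nat list list \<Rightarrow> bool" where
  "associated_tableau N V T \<longleftrightarrow> standard_tableau N T \<and>
    (\<exists>U. openin (subtopology (zariski N) V) U \<and> U \<noteq> {} \<and>
      (\<forall>A\<in>U. \<forall>k\<in>{1..N}.
         nilpotent_jordan_type (mat k k (\<lambda>(i, j). A $$ (i, j))) (restricted_shape T k)))"

text \<open>
  \<open>T'\<close> arises from \<open>T\<close> by dropping \<open>e\<close> one row. The order within rows and the left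
  justification are built into standard tableaux, so rows are compared as sets.
\<close>

definition dropped_box :: "nat list list \<Rightarrow> nat \<Rightarrow> nat list list \<Rightarrow> bool" where
  "dropped_box T e T' \<longleftrightarrow> (\<exists>r\<ge>1. e \<in> row_set T r \<and>
     row_set T' r = row_set T r - {e} \<and>
     row_set T' (Suc r) = insert e (row_set T (Suc r)) \<and>
     (\<forall>m. m \<noteq> r \<and> m \<noteq> Suc r \<longrightarrow> row_set T' m = row_set T m))"

text \<open>Transpositions are involutions, so products of them form the group they generate.\<close>

inductive_set transposition_group :: "nat set \<Rightarrow> (nat \<Rightarrow> nat) set"
  for \<tau> :: "nat set"
where
  id: "id \<in> transposition_group \<tau>"
| comp: "\<lbrakk>p \<in> transposition_group \<tau>; i \<in> \<tau>\<rbrakk> \<Longrightarrow> transpose i (Suc i) \<circ> p \<in> transposition_group \<tau>"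

definition chain_orbits :: "nat \<Rightarrow> nat set \<Rightarrow> nat set set" where
  "chain_orbits N \<tau> = (\<lambda>x. (\<lambda>p. p x) ` transposition_group \<tau>) ` {1..N}"

text \<open>\<open>C\<^sub>k\<close>, for \<open>k\<close> from 1 to the number of chains.\<close>

definition chain :: "nat \<Rightarrow> nat set \<Rightarrow> nat \<Rightarrow> nat set" where
  "chain N \<tau> k = sorted_key_list_of_set Min (chain_orbits N \<tau>) ! (k - 1)"

end

theory Submission
  imports Defs "HOL-Library.Product_Lexorder"
    "HOL-Computational_Algebra.Fundamental_Theorem_Algebra"
begin

text \<open>
  Write \<open>b x\<close> for the number of the chain containing the index \<open>x\<close> and \<open>level x\<close> for the position of
  \<open>x\<close> in its chain, both counted from 0; row \<open>m\<close> of the Richardson tableau consists of the entries of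
  level \<open>m - 1\<close>. If \<open>A\<close> has nonzero entries only where \<open>b\<close> increases from the row to the column, then
  every minor of \<open>t + A\<close> of size \<open>k - q\<close> inside the upper left \<open>k \<times> k\<close> corner is divisible by \<open>t\<close> to
  the number of indices of level at least \<open>q\<close>; generically this is sharp, and these orders are
  equivalent to the Jordan types of the corners.

  Let \<open>I\<close> be the length of the last chain. Dropping \<open>N\<close> one row means that on \<open>V\<close> the minors of size
  \<open>N - I\<close> are divisible by one more power of \<open>t\<close>, whereas nothing changes for the smaller corners. As
  the new shape is a partition, there is an earlier chain of length \<open>I\<close>; let \<open>C\<close> be the last such.
  Take the minor of \<open>t + A\<close> whose rows run from the start of \<open>C\<close> to the start of the last chain
  and whose columns run from the end of \<open>C\<close> to the end of the last chain. Its lowest coefficient \<open>F\<close>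
  vanishes on \<open>V\<close>, since multiplying it by a minor for the indices up to \<open>C\<close> yields a lowest
  coefficient of a minor of size \<open>N - I\<close>. The monomials of \<open>F\<close> are systems of \<open>I\<close> disjoint paths from
  \<open>C\<close> to the last chain, and this description shows that \<open>F\<close> is irreducible. Codimension one therefore
  forces the closure of \<open>V\<close> to be the zero locus of \<open>F\<close>, and by the Nullstellensatz \<open>F\<close> is the
  generator. It involves the first row of \<open>C\<close> and the column \<open>N\<close>, so the \<open>\<sigma>\<close>-set runs from the first
  element of \<open>C\<close> to \<open>N - 1\<close>, and it is all of \<open>\<Pi>\<close> iff \<open>C\<close> is the first chain.

  \<open>F\<close> is linear only if \<open>I = 1\<close> and the two chains are adjacent; then \<open>V\<close> would be stable under the
  root subgroups of \<open>\<plusminus>\<alpha>\<^bsub>N-1\<^esub>\<close>, contradicting that \<open>N - 1\<close> and \<open>N\<close> lie in different chains.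
\<close>

text \<open>Codimension one says nothing about equations by itself; it becomes useful through a
  single irreducible polynomial vanishing on \<open>V\<close>, which is why the irreducibility of
  \<open>F\<close> carries the proof. It also dictates the choice of the last earlier chain of
  length \<open>I\<close>: a chain of that length strictly in between would be met by the
  \<open>I\<close> paths in all of its elements, and \<open>F\<close> would factor there.

  Orders of minors take the place of ranks of powers. They are invariant under similarity and
  additive under products, and the vanishing of the next coefficient is directly a polynomial
  equation. A Jordan matrix and the standard element of \<open>m_space\<close> are both partial
  permutation matrices joining indices of equal level; only the meanings of block number and
  position are exchanged. One computation therefore gives the sharp order for both.

  For a principal ideal the Nullstellensatz comes from eliminating one variable and then solving
  \<open>f = 0\<close> for it; the elimination rests on unique factorization.\<close>

type_synonym 'v mpoly = "('v \<Rightarrow>\<^sub>0 nat) \<Rightarrow>\<^sub>0 complex"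

abbreviation mon :: "('v \<Rightarrow>\<^sub>0 nat) \<Rightarrow> complex \<Rightarrow> 'v mpoly" where
  "mon \<equiv> Poly_Mapping.single"

section \<open>Ring homomorphisms given on monomials\<close>

definition lin_ext :: "(('v \<Rightarrow>\<^sub>0 nat) \<Rightarrow> complex \<Rightarrow> 'b) \<Rightarrow> 'v mpoly \<Rightarrow> 'b::comm_ring_1" where
  "lin_ext h p = (\<Sum>m\<in>Poly_Mapping.keys p. h m (Poly_Mapping.lookup p m))"

text \<open>Evaluation, the reading as a polynomial in one variable, and setting variables to zero
  are all given term by term. Additivity in the coefficient together with multiplicativity in
  monomial and coefficient jointly makes \<open>lin_ext h\<close> a ring homomorphism.\<close>

locale mono_hom =
  fixes h :: "('v \<Rightarrow>\<^sub>0 nat) \<Rightarrow> complex \<Rightarrow> 'b::comm_ring_1"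
  assumes h_add: "h m (c + d) = h m c + h m d"
    and h_mult: "h (m + m') (c * d) = h m c * h m' d"
    and h_one: "h 0 1 = 1"
begin

lemma h_zero [simp]: "h m 0 = 0"
  using h_add[of m 0 0] by simp

lemma lin_ext_mono [simp]: "lin_ext h (mon m c) = h m c"
  by (cases "c = 0") (auto simp: lin_ext_def)

lemma lin_ext_add: "lin_ext h (p + q) = lin_ext h p + lin_ext h q"
  unfolding lin_ext_def by (rule setsum_keys_plus_distrib) (auto simp: h_add)

end

lemma mpoly_sum_monos:
  fixes p :: "'v mpoly"
  shows "p = (\<Sum>m\<in>Poly_Mapping.keys p. mon m (Poly_Mapping.lookup p m))"
proof (rule poly_mapping_eqI)
  fix k
  have "Poly_Mapping.lookup (\<Sum>m\<in>Poly_Mapping.keys p. mon m (Poly_Mapping.lookup p m)) k =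
      (\<Sum>m\<in>Poly_Mapping.keys p. if m = k then Poly_Mapping.lookup p m else 0)"
    by (subst lookup_sum) (rule sum.cong, auto simp: lookup_single when_def)
  also have "\<dots> = Poly_Mapping.lookup p k"
    by (subst sum.delta) (auto simp: in_keys_iff)
  finally show "Poly_Mapping.lookup p k = Poly_Mapping.lookup (\<Sum>m\<in>Poly_Mapping.keys p. mon m (Poly_Mapping.lookup p m)) k" ..
qed

lemma mpoly_induct [case_names mon add]:
  fixes p :: "'v mpoly"
  assumes "\<And>m c. P (mon m c)" and "\<And>p q. P p \<Longrightarrow> P q \<Longrightarrow> P (p + q)"
  shows "P p"
proof -
  have "P (\<Sum>m\<in>A. mon m (f m))" if "finite A" for A and f :: "('v \<Rightarrow>\<^sub>0 nat) \<Rightarrow> complex"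
    using that
  proof induction
    case empty
    then show ?case using assms(1)[of 0 0] by simp
  qed (auto intro: assms)
  from this[of "Poly_Mapping.keys p" "Poly_Mapping.lookup p"] show ?thesis
    using mpoly_sum_monos[of p] by simp
qed

context mono_hom
begin

lemma lin_ext_mult: "lin_ext h (p * q) = lin_ext h p * lin_ext h q"
proof (induction p rule: mpoly_induct)
  case (mon m c)
  show ?case
    by (induction q rule: mpoly_induct)
      (auto simp: mult_single h_mult lin_ext_add distrib_left)
qed (auto simp: lin_ext_add distrib_right)

lemma lin_ext_0: "lin_ext h 0 = 0"
  by (simp add: lin_ext_def)

lemma lin_ext_1: "lin_ext h 1 = 1"
  using lin_ext_mono[of 0 1] by (simp add: h_one flip: single_one)

lemma comm_ring_hom_lin_ext: "comm_ring_hom (lin_ext h)"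
  by unfold_locales (auto simp: lin_ext_add lin_ext_mult lin_ext_0 lin_ext_1)

end

subsection \<open>Evaluation\<close>

definition mval :: "('v \<Rightarrow> complex) \<Rightarrow> ('v \<Rightarrow>\<^sub>0 nat) \<Rightarrow> complex" where
  "mval v m = (\<Prod>x\<in>Poly_Mapping.keys m. v x ^ Poly_Mapping.lookup m x)"

lemma mval_superset:
  assumes "finite A" "Poly_Mapping.keys m \<subseteq> A"
  shows "mval v m = (\<Prod>x\<in>A. v x ^ Poly_Mapping.lookup m x)"
  unfolding mval_def using assms
  by (intro prod.mono_neutral_left) (auto simp: in_keys_iff)

lemma keys_add_nat:
  fixes m m' :: "'v \<Rightarrow>\<^sub>0 nat"
  shows "Poly_Mapping.keys (m + m') = Poly_Mapping.keys m \<union> Poly_Mapping.keys m'"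
  by (auto simp: in_keys_iff lookup_add)

lemma mval_add: "mval v (m + m') = mval v m * mval v m'"
proof -
  let ?A = "Poly_Mapping.keys m \<union> Poly_Mapping.keys m'"
  show ?thesis
    by (simp add: mval_superset[of ?A] keys_add_nat lookup_add power_add prod.distrib)
qed

definition meval :: "('v \<Rightarrow> complex) \<Rightarrow> 'v mpoly \<Rightarrow> complex" where
  "meval v = lin_ext (\<lambda>m c. c * mval v m)"

interpretation meval: mono_hom "\<lambda>m c. c * mval v m" for v :: "'v \<Rightarrow> complex"
  by unfold_locales (simp_all add: mval_add algebra_simps, simp add: mval_def)

interpretation meval_hom: comm_ring_hom "meval v" for v
  unfolding meval_def by (rule meval.comm_ring_hom_lin_ext)

lemma meval_mono [simp]: "meval v (mon m c) = c * mval v m"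
  unfolding meval_def by simp

definition mvars :: "'v mpoly \<Rightarrow> 'v set" where
  "mvars p = (\<Union>m\<in>Poly_Mapping.keys p. Poly_Mapping.keys m)"

lemma finite_mvars [simp]: "finite (mvars p)"
  by (auto simp: mvars_def)

lemma mval_cong: "(\<And>x. x \<in> Poly_Mapping.keys m \<Longrightarrow> v x = w x) \<Longrightarrow> mval v m = mval w m"
  unfolding mval_def by (rule prod.cong) auto

lemma meval_cong:
  assumes "\<And>x. x \<in> mvars p \<Longrightarrow> v x = w x"
  shows "meval v p = meval w p"
  unfolding meval_def lin_ext_def
  by (rule sum.cong) (use assms in \<open>auto simp: mvars_def intro!: mval_cong\<close>)

lemma mvars_add: "mvars (p + q) \<subseteq> mvars p \<union> mvars q"
  unfolding mvars_def using Poly_Mapping.keys_add[of p q] by blast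

lemma mvars_uminus [simp]: "mvars (- p) = mvars p"
  by (simp add: mvars_def)

lemma mvars_diff: "mvars (p - q) \<subseteq> mvars p \<union> mvars q"
  using mvars_add[of p "- q"] by simp

lemma mvars_mult: "mvars (p * q) \<subseteq> mvars p \<union> mvars q"
  unfolding mvars_def using keys_mult[of p q] by (fastforce simp: keys_add_nat)

lemma mvars_mono: "mvars (mon m c) = (if c = 0 then {} else Poly_Mapping.keys m)"
  by (auto simp: mvars_def)

lemma mvars_0 [simp]: "mvars 0 = {}" and mvars_1 [simp]: "mvars 1 = {}"
  by (auto simp: mvars_def)

lemma mvars_power: "mvars (p ^ n) \<subseteq> mvars p"
proof (induction n)
  case (Suc n)
  then show ?case using mvars_mult[of p "p ^ n"] by auto
qed simp

lemma mvars_empty_iff: "mvars p = {} \<longleftrightarrow> (\<exists>c. p = mon 0 c)"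
proof
  assume "mvars p = {}"
  hence *: "Poly_Mapping.keys p \<subseteq> {0}"
    by (auto simp: mvars_def)
  have "p = mon 0 (Poly_Mapping.lookup p 0)"
  proof (rule poly_mapping_eqI)
    fix k
    show "Poly_Mapping.lookup p k = Poly_Mapping.lookup (mon 0 (Poly_Mapping.lookup p 0)) k"
      using * by (cases "k = 0") (auto simp: lookup_single when_def in_keys_iff)
  qed
  thus "\<exists>c. p = mon 0 c" ..
qed (auto simp: mvars_def split: if_splits)

subsection \<open>Polynomials as univariate polynomials in a distinguished variable\<close>

definition mono_drop :: "'v \<Rightarrow> ('v \<Rightarrow>\<^sub>0 nat) \<Rightarrow> ('v \<Rightarrow>\<^sub>0 nat)" where
  "mono_drop x m = m - Poly_Mapping.single x (Poly_Mapping.lookup m x)"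

lemma lookup_mono_drop: "Poly_Mapping.lookup (mono_drop x m) y = (if y = x then 0 else Poly_Mapping.lookup m y)"
  by (auto simp: mono_drop_def lookup_minus lookup_single when_def)

lemma keys_mono_drop: "Poly_Mapping.keys (mono_drop x m) = Poly_Mapping.keys m - {x}"
  by (auto simp: in_keys_iff lookup_mono_drop split: if_splits)

lemma mono_drop_add: "mono_drop x (m + m') = mono_drop x m + mono_drop x m'"
  by (rule poly_mapping_eqI) (auto simp: lookup_mono_drop lookup_add)

lemma mono_drop_decomp: "mono_drop x m + Poly_Mapping.single x (Poly_Mapping.lookup m x) = m"
  by (rule poly_mapping_eqI) (auto simp: lookup_mono_drop lookup_add lookup_single when_def)

definition var :: "'v \<Rightarrow> 'v mpoly" where
  "var x = mon (Poly_Mapping.single x 1) 1"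

text \<open>The coefficients are free of \<open>x\<close> but stay in the same ring, so induction on
  the variables needs no change of type. Substituting \<open>var x\<close> recovers the polynomial
  (\<open>poly_univ_in\<close>).\<close>

definition univ_in :: "'v::linorder \<Rightarrow> 'v mpoly \<Rightarrow> 'v mpoly poly" where
  "univ_in x = lin_ext (\<lambda>m c. monom (mon (mono_drop x m) c) (Poly_Mapping.lookup m x))"

interpretation univ_in: mono_hom
  "\<lambda>m c. monom (mon (mono_drop x m) c) (Poly_Mapping.lookup m x)" for x :: "'v::linorder"
proof
  show "monom (mon (mono_drop x 0) 1) (Poly_Mapping.lookup 0 x) = (1::'v mpoly poly)" for x :: 'v
    by (simp add: mono_drop_def monom_0)
qed (simp_all add: single_add add_monom mult_monom mono_drop_add lookup_add mult_single)

interpretation univ_in_hom: comm_ring_hom "univ_in x" for x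
  unfolding univ_in_def by (rule univ_in.comm_ring_hom_lin_ext)

lemma univ_in_mono: "univ_in x (mon m c) = monom (mon (mono_drop x m) c) (Poly_Mapping.lookup m x)"
  unfolding univ_in_def by simp

lemma var_power: "var x ^ n = mon (Poly_Mapping.single x n) 1"
  by (induction n) (auto simp: var_def mult_single simp flip: single_add)

lemma poly_univ_in: "poly (univ_in x p) (var x) = p"
  by (induction p rule: mpoly_induct)
    (auto simp: univ_in_mono poly_monom var_power mult_single mono_drop_decomp univ_in_hom.hom_add)

lemma univ_in_inj: "univ_in x p = univ_in x q \<Longrightarrow> p = q"
  by (metis poly_univ_in)

lemma univ_in_0_iff [simp]: "univ_in x p = 0 \<longleftrightarrow> p = 0"
  using univ_in_inj[of x p 0] by auto

lemma mvars_coeff_univ_in: "mvars (coeff (univ_in x p) i) \<subseteq> mvars p - {x}"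
proof -
  have "mvars (\<Sum>m\<in>A. coeff (monom (mon (mono_drop x m) (Poly_Mapping.lookup p m)) (Poly_Mapping.lookup m x)) i)
      \<subseteq> mvars p - {x}" if "finite A" "A \<subseteq> Poly_Mapping.keys p" for A
    using that
  proof (induction A)
    case (insert m A)
    have "mvars (coeff (monom (mon (mono_drop x m) (Poly_Mapping.lookup p m)) (Poly_Mapping.lookup m x)) i)
      \<subseteq> mvars p - {x}"
      using insert.prems by (auto simp: mvars_mono keys_mono_drop mvars_def)
    moreover have "mvars (\<Sum>m\<in>A. coeff (monom (mon (mono_drop x m) (Poly_Mapping.lookup p m)) (Poly_Mapping.lookup m x)) i)
      \<subseteq> mvars p - {x}"
      using insert by blast
    ultimately show ?case
      using insert.hyps mvars_add by (simp add: sum.insert del: coeff_monom) fast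
  qed auto
  from this[of "Poly_Mapping.keys p"] show ?thesis
    unfolding univ_in_def lin_ext_def by (simp add: coeff_sum)
qed

lemma univ_in_const: "x \<notin> mvars p \<Longrightarrow> univ_in x p = [:p:]"
proof -
  assume x: "x \<notin> mvars p"
  have "univ_in x p = (\<Sum>m\<in>Poly_Mapping.keys p. [:mon m (Poly_Mapping.lookup p m):])"
    unfolding univ_in_def lin_ext_def
  proof (rule sum.cong)
    fix m assume "m \<in> Poly_Mapping.keys p"
    with x have "Poly_Mapping.lookup m x = 0"
      by (auto simp: mvars_def in_keys_iff)
    thus "monom (mon (mono_drop x m) (Poly_Mapping.lookup p m)) (Poly_Mapping.lookup m x) =
        [:mon m (Poly_Mapping.lookup p m):]"
      by (simp add: mono_drop_def monom_0)
  qed simp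
  also have "\<dots> = [:\<Sum>m\<in>Poly_Mapping.keys p. mon m (Poly_Mapping.lookup p m):]"
    using finite_keys[of p] by (induction "Poly_Mapping.keys p" rule: finite_induct)
      (simp_all flip: monom_0 monom_sum)
  finally show ?thesis by (simp only: mpoly_sum_monos[of p, symmetric])
qed

definition deg_in :: "'v::linorder \<Rightarrow> 'v mpoly \<Rightarrow> nat" where
  "deg_in x p = degree (univ_in x p)"

lemma deg_in_mult: "p \<noteq> 0 \<Longrightarrow> q \<noteq> 0 \<Longrightarrow> deg_in x (p * q) = deg_in x p + deg_in x q"
  by (simp add: deg_in_def univ_in_hom.hom_mult degree_mult_eq)

lemma deg_in_eq_0_iff: "deg_in x p = 0 \<longleftrightarrow> x \<notin> mvars p"
proof
  assume "deg_in x p = 0"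
  then obtain c where c: "univ_in x p = [:c:]"
    unfolding deg_in_def by (metis degree_eq_zeroE)
  hence "p = c"
    using poly_univ_in[of x p] by simp
  moreover have "c = coeff (univ_in x p) 0"
    by (simp add: c)
  ultimately show "x \<notin> mvars p"
    using mvars_coeff_univ_in[of x p 0] by auto
qed (simp add: deg_in_def univ_in_const)

text \<open>The degrees in each single variable add, as there are no zero divisors; so no variable
  can disappear from a product.\<close>

lemma mvars_mult_eq:
  fixes p q :: "'v::linorder mpoly"
  assumes "p \<noteq> 0" "q \<noteq> 0"
  shows "mvars (p * q) = mvars p \<union> mvars q"
proof (rule Set.set_eqI)
  fix x
  show "x \<in> mvars (p * q) \<longleftrightarrow> x \<in> mvars p \<union> mvars q"
    using deg_in_mult[OF assms, of x] deg_in_eq_0_iff[of x] by (metis Un_iff add_is_0)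
qed

subsection \<open>Irreducible polynomials are prime\<close>

lemma mpoly_unit_iff: "p dvd 1 \<longleftrightarrow> p \<noteq> 0 \<and> mvars p = {}" for p :: "'v::linorder mpoly"
proof
  assume "p dvd 1"
  then obtain q where "1 = p * q" ..
  moreover from this have "p \<noteq> 0" "q \<noteq> 0" by auto
  ultimately show "p \<noteq> 0 \<and> mvars p = {}"
    using mvars_mult_eq[of p q] by (metis Un_empty mvars_1)
next
  assume "p \<noteq> 0 \<and> mvars p = {}"
  then obtain c where c: "p = mon 0 c" by (auto simp: mvars_empty_iff)
  with \<open>p \<noteq> 0 \<and> mvars p = {}\<close> have "c \<noteq> 0" by auto
  note c = c this
  hence "p * mon 0 (1 / c) = 1"
    by (simp add: mult_single)
  thus "p dvd 1" by (metis dvd_triv_left)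
qed

text \<open>The sum of the partial degrees, not the total degree. It is additive on products of
  nonzero polynomials and zero only for constants, hence drops whenever a nonunit factor is split
  off.\<close>

definition msize :: "'v::linorder mpoly \<Rightarrow> nat" where
  "msize p = (\<Sum>x\<in>mvars p. deg_in x p)"

lemma msize_superset: "finite A \<Longrightarrow> mvars p \<subseteq> A \<Longrightarrow> msize p = (\<Sum>x\<in>A. deg_in x p)"
  unfolding msize_def by (rule sum.mono_neutral_left) (auto simp: deg_in_eq_0_iff)

lemma msize_mult: "p \<noteq> 0 \<Longrightarrow> q \<noteq> 0 \<Longrightarrow> msize (p * q) = msize p + msize q"
  by (simp add: msize_superset[of "mvars p \<union> mvars q"] mvars_mult_eq deg_in_mult sum.distrib)

lemma msize_eq_0_iff: "msize p = 0 \<longleftrightarrow> mvars p = {}"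
  by (auto simp: msize_def deg_in_eq_0_iff)

lemma irreducible_factor_exists:
  fixes c :: "'v::linorder mpoly"
  assumes "c \<noteq> 0" "\<not> c dvd 1"
  shows "\<exists>\<pi>. irreducible \<pi> \<and> \<pi> dvd c"
  using assms
proof (induction "msize c" arbitrary: c rule: less_induct)
  case less
  show ?case
  proof (cases "irreducible c")
    case False
    with less.prems obtain a b where ab: "c = a * b" "\<not> a dvd 1" "\<not> b dvd 1"
      by (auto simp: irreducible_def)
    with less.prems have "a \<noteq> 0" "b \<noteq> 0" by auto
    with ab have "msize a < msize c"
      by (simp add: msize_mult msize_eq_0_iff mpoly_unit_iff) (use msize_eq_0_iff[of b] in \<open>auto simp: mpoly_unit_iff\<close>)
    with less.hyps[of a] ab \<open>a \<noteq> 0\<close> show ?thesis by auto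
  qed auto
qed

section \<open>Pseudo-division, and primality of irreducibles by adjoining one variable at a
  time\<close>

lemma mvars_factor:
  fixes p q :: "'v::linorder mpoly"
  assumes "p * q = r" "r \<noteq> 0"
  shows "mvars p \<subseteq> mvars r" "mvars q \<subseteq> mvars r"
  using assms mvars_mult_eq[of p q] by auto

lemma univ_in_var: "univ_in x (var x) = monom 1 1"
  by (simp add: var_def univ_in_mono mono_drop_def)

lemma mvars_var [simp]: "mvars (var x) = {x}"
  by (simp add: var_def mvars_mono)

abbreviation lc_in :: "'v::linorder \<Rightarrow> 'v mpoly \<Rightarrow> 'v mpoly" where
  "lc_in x p \<equiv> lead_coeff (univ_in x p)"

lemma mvars_lc_in: "mvars (lc_in x p) \<subseteq> mvars p - {x}"
  by (rule mvars_coeff_univ_in)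

text \<open>Division with remainder in \<open>x\<close> over a base ring that is not a field: each
  step multiplies \<open>f\<close> by the leading coefficient of \<open>r\<close>, and these factors
  accumulate in \<open>c\<close>. The variable sets are recorded so that \<open>c\<close> is known
  to lie in the base ring.\<close>

lemma pseudo_division:
  fixes f r :: "'v::linorder mpoly"
  assumes r: "r \<noteq> 0" "mvars r \<subseteq> insert x P" and x: "x \<notin> P" and f: "mvars f \<subseteq> insert x P"
  shows "\<exists>c q s. c \<noteq> 0 \<and> mvars c \<subseteq> P \<and> mvars q \<subseteq> insert x P \<and> c * f = q * r + s \<and>
    (s = 0 \<or> deg_in x s < deg_in x r)"
  using f
proof (induction "deg_in x f" arbitrary: f rule: less_induct)
  case less
  show ?case
  proof (cases "f = 0 \<or> deg_in x f < deg_in x r")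
    case True
    thus ?thesis by (intro exI[of _ 1] exI[of _ 0] exI[of _ f]) auto
  next
    case False
    hence f0: "f \<noteq> 0" and le: "deg_in x r \<le> deg_in x f" by auto
    define k where "k = deg_in x f - deg_in x r"
    define lr lf where "lr = lc_in x r" and "lf = lc_in x f"
    \<comment> \<open>The leading terms in \<open>x\<close> cancel, so the degree drops unless
      nothing is left.\<close>
    define f' where "f' = lr * f - lf * var x ^ k * r"
    have vr: "mvars lr \<subseteq> P" and vf: "mvars lf \<subseteq> P"
      using mvars_lc_in[of x r] mvars_lc_in[of x f] r less.prems by (auto simp: lr_def lf_def)
    have lr0: "lr \<noteq> 0" using r by (simp add: lr_def)
    have xlr: "x \<notin> mvars lr" "x \<notin> mvars lf" using vr vf x by auto
    have vk: "mvars (lf * var x ^ k) \<subseteq> insert x P"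
      using mvars_mult[of lf "var x ^ k"] mvars_power[of "var x" k] vf by auto
    have v': "mvars f' \<subseteq> insert x P"
      unfolding f'_def using mvars_diff[of "lr * f" "lf * var x ^ k * r"] mvars_mult[of lr f]
        mvars_mult[of "lf * var x ^ k" r] vk vr r less.prems by blast
    have U: "univ_in x f' = Polynomial.smult lr (univ_in x f) - Polynomial.smult lf (monom 1 k * univ_in x r)"
      by (simp add: f'_def univ_in_hom.hom_minus univ_in_hom.hom_mult univ_in_hom.hom_power
          univ_in_const xlr univ_in_var monom_power mult.assoc)
    have "coeff (univ_in x f') (deg_in x f) = 0"
      using le by (simp add: U coeff_monom_mult k_def lr_def lf_def deg_in_def)
    moreover have "degree (univ_in x f') \<le> deg_in x f"
      unfolding U by (rule degree_diff_le)
        (use le in \<open>auto simp: deg_in_def k_def intro!: order_trans[OF degree_smult_le] order_trans[OF degree_mult_le]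
          order_trans[OF add_right_mono[OF degree_monom_le]]\<close>)
    ultimately have "f' = 0 \<or> deg_in x f' < deg_in x f"
      using eq_zero_or_degree_less[of "univ_in x f'" "deg_in x f"] by (auto simp: deg_in_def)
    hence "\<exists>c q s. c \<noteq> 0 \<and> mvars c \<subseteq> P \<and> mvars q \<subseteq> insert x P \<and> c * f' = q * r + s \<and>
        (s = 0 \<or> deg_in x s < deg_in x r)"
    proof
      assume "f' = 0"
      thus ?thesis by (intro exI[of _ 1] exI[of _ 0]) auto
    qed (use less.hyps[of f'] v' in blast)
    then obtain c q s where *: "c \<noteq> 0" "mvars c \<subseteq> P" "mvars q \<subseteq> insert x P" "c * f' = q * r + s"
      "s = 0 \<or> deg_in x s < deg_in x r" by blast
    have "c * lr * f = (q + c * (lf * var x ^ k)) * r + s"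
      using *(4) by (simp add: f'_def algebra_simps)
    moreover have "mvars (c * lr) \<subseteq> P" using mvars_mult[of c lr] * vr by auto
    moreover have "mvars (q + c * (lf * var x ^ k)) \<subseteq> insert x P"
      using mvars_add[of q "c * (lf * var x ^ k)"] mvars_mult[of c "lf * var x ^ k"] * vk by blast
    ultimately show ?thesis using * lr0
      by (intro exI[of _ "c * lr"] exI[of _ "q + c * (lf * var x ^ k)"] exI[of _ s]) auto
  qed
qed

text \<open>Primality tested only against polynomials in the variables \<open>P\<close>, which
  allows induction over finite sets of variables.\<close>

definition euclid_on :: "'v set \<Rightarrow> 'v::linorder mpoly \<Rightarrow> bool" where
  "euclid_on P f \<longleftrightarrow> (\<forall>a b. mvars a \<subseteq> P \<longrightarrow> mvars b \<subseteq> P \<longrightarrow> f dvd a * b \<longrightarrow> f dvd a \<or> f dvd b)"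

lemma const_dvd_iff_univ_in:
  assumes "x \<notin> mvars \<pi>"
  shows "\<pi> dvd a \<longleftrightarrow> (\<forall>i. \<pi> dvd coeff (univ_in x a) i)"
proof -
  have "\<pi> dvd a \<longleftrightarrow> [:\<pi>:] dvd univ_in x a"
  proof
    assume "\<pi> dvd a"
    then obtain q where "a = \<pi> * q" ..
    thus "[:\<pi>:] dvd univ_in x a"
      by (metis assms dvd_triv_left univ_in_const univ_in_hom.hom_mult)
  next
    assume "[:\<pi>:] dvd univ_in x a"
    then obtain Q where "univ_in x a = [:\<pi>:] * Q" ..
    hence "a = \<pi> * poly Q (var x)"
      using poly_univ_in[of x a] by simp
    thus "\<pi> dvd a" by simp
  qed
  thus ?thesis by (simp add: const_poly_dvd_iff)
qed

text \<open>Gauss's lemma: if \<pi> divides neither factor, take in each the lowest coefficient that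
  it does not divide. In the coefficient of degree \<open>i + j\<close> of the product all other
  summands are divisible by \<pi>, so it would divide the product of these two.\<close>

lemma euclid_on_insert_const:
  fixes \<pi> :: "'v::linorder mpoly"
  assumes E: "euclid_on P \<pi>" and x: "x \<notin> P" and \<pi>: "mvars \<pi> \<subseteq> P"
  shows "euclid_on (insert x P) \<pi>"
  unfolding euclid_on_def
proof (intro allI impI)
  fix a b :: "'v mpoly"
  assume v: "mvars a \<subseteq> insert x P" "mvars b \<subseteq> insert x P" and dvd: "\<pi> dvd a * b"
  have x\<pi>: "x \<notin> mvars \<pi>" using x \<pi> by auto
  note iff = const_dvd_iff_univ_in[OF x\<pi>]
  show "\<pi> dvd a \<or> \<pi> dvd b"
  proof (rule ccontr)
    assume neg: "\<not> (\<pi> dvd a \<or> \<pi> dvd b)"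
    define i where "i = (LEAST i. \<not> \<pi> dvd coeff (univ_in x a) i)"
    define j where "j = (LEAST i. \<not> \<pi> dvd coeff (univ_in x b) i)"
    have i: "\<not> \<pi> dvd coeff (univ_in x a) i" "\<And>k. k < i \<Longrightarrow> \<pi> dvd coeff (univ_in x a) k"
      unfolding i_def using LeastI_ex[of "\<lambda>i. \<not> \<pi> dvd coeff (univ_in x a) i"] neg iff[of a] by (blast, metis not_less_Least)
    have j: "\<not> \<pi> dvd coeff (univ_in x b) j" "\<And>k. k < j \<Longrightarrow> \<pi> dvd coeff (univ_in x b) k"
      unfolding j_def using LeastI_ex[of "\<lambda>i. \<not> \<pi> dvd coeff (univ_in x b) i"] neg iff[of b] by (blast, metis not_less_Least)
    let ?t = "\<lambda>k. coeff (univ_in x a) k * coeff (univ_in x b) (i + j - k)"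
    have "\<pi> dvd (\<Sum>k\<le>i+j. ?t k)"
      using dvd iff[of "a * b"] by (simp add: univ_in_hom.hom_mult coeff_mult)
    also have "(\<Sum>k\<le>i+j. ?t k) = ?t i + (\<Sum>k\<in>{..i+j}-{i}. ?t k)"
      by (subst sum.remove[of _ i]) auto
    finally have "\<pi> dvd ?t i + (\<Sum>k\<in>{..i+j}-{i}. ?t k)" .
    moreover have "\<pi> dvd (\<Sum>k\<in>{..i+j}-{i}. ?t k)"
    proof (rule dvd_sum)
      fix k assume "k \<in> {..i+j}-{i}"
      hence "k < i \<or> i + j - k < j" by auto
      thus "\<pi> dvd ?t k" using i(2) j(2) by auto
    qed
    ultimately have "\<pi> dvd ?t i" by (simp add: dvd_add_left_iff)
    moreover have "mvars (coeff (univ_in x a) i) \<subseteq> P" "mvars (coeff (univ_in x b) j) \<subseteq> P"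
      using mvars_coeff_univ_in[of x a i] mvars_coeff_univ_in[of x b j] v by auto
    ultimately show False using E i(1) j(1) by (auto simp: euclid_on_def)
  qed
qed

definition irreducibles_prime_on :: "'v::linorder set \<Rightarrow> bool" where
  "irreducibles_prime_on P \<longleftrightarrow> (\<forall>f. irreducible f \<longrightarrow> mvars f \<subseteq> P \<longrightarrow> euclid_on P f)"

context
  fixes x :: "'v::linorder" and P :: "'v set"
  assumes x: "x \<notin> P" and prime: "irreducibles_prime_on P"
begin

lemma euclid_insert: "irreducible \<pi> \<Longrightarrow> mvars \<pi> \<subseteq> P \<Longrightarrow> euclid_on (insert x P) \<pi>"
  using prime x euclid_on_insert_const[of P \<pi> x] unfolding irreducibles_prime_on_def by blast

text \<open>The irreducible factors of \<open>c\<close> are stripped one at a time: each is prime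
  and divides \<open>f * h\<close> but not \<open>f\<close>, hence divides \<open>h\<close>.\<close>

lemma cancel_const:
  fixes f b h c :: "'v mpoly"
  assumes "f * h = c * b" "c \<noteq> 0" "mvars c \<subseteq> P" "mvars b \<subseteq> insert x P" "mvars f \<subseteq> insert x P"
    and nd: "\<And>\<pi>. irreducible \<pi> \<Longrightarrow> mvars \<pi> \<subseteq> P \<Longrightarrow> \<not> \<pi> dvd f"
  shows "f dvd b"
  using assms(1-4)
proof (induction "msize c" arbitrary: c h rule: less_induct)
  case less
  consider "b = 0" | "c dvd 1" | "b \<noteq> 0" "\<not> c dvd 1" by blast
  thus ?case
  proof cases
    case 2
    then obtain c' where c': "1 = c * c'" ..
    have "b = c * b * c'" using c' by (simp add: mult_ac)
    also have "\<dots> = f * (h * c')" using less.prems(1) by (simp add: mult_ac)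
    finally show ?thesis by simp
  next
    case 3
    obtain \<pi> c' where \<pi>: "irreducible \<pi>" "c = \<pi> * c'"
      using irreducible_factor_exists[OF less.prems(2) 3(2)] by (auto elim!: dvdE)
    have nz: "\<pi> \<noteq> 0" "c' \<noteq> 0" using less.prems \<pi> by auto
    have v\<pi>: "mvars \<pi> \<subseteq> P" "mvars c' \<subseteq> P"
      using mvars_factor[of \<pi> c' c] \<pi> less.prems by auto
    have "c * b \<noteq> 0" using less.prems 3 by auto
    hence "mvars h \<subseteq> mvars c \<union> mvars b"
      using mvars_factor(2)[OF less.prems(1)] mvars_mult_eq[of c b] less.prems 3 by auto
    hence vh: "mvars h \<subseteq> insert x P" using less.prems by auto
    have "\<pi> dvd f * h" using less.prems \<pi> by simp
    with euclid_insert[OF \<pi>(1) v\<pi>(1)] nd[OF \<pi>(1) v\<pi>(1)] vh assms(5) have "\<pi> dvd h"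
      by (auto simp: euclid_on_def)
    then obtain h' where "h = \<pi> * h'" ..
    hence "\<pi> * (f * h') = \<pi> * (c' * b)" using less.prems(1) \<pi> by (simp add: mult_ac)
    hence "f * h' = c' * b" using nz by simp
    moreover have "msize \<pi> \<noteq> 0"
      using \<pi> nz by (auto simp: msize_eq_0_iff irreducible_def mpoly_unit_iff)
    hence "msize c' < msize c" using nz by (simp add: \<pi> msize_mult)
    ultimately show ?thesis using less.hyps[of c' h'] nz v\<pi> less.prems by blast
  qed auto
qed

text \<open>Every irreducible factor of \<open>c\<close> is prime, so it can be cancelled from
  \<open>q\<close> or from \<open>r\<close>; those cancelled from \<open>r\<close> are collected in
  \<open>c1\<close>.\<close>

lemma split_const:
  fixes f q r c :: "'v mpoly"
  assumes "c * f = q * r" "c \<noteq> 0" "mvars c \<subseteq> P" "mvars q \<subseteq> insert x P" "mvars r \<subseteq> insert x P" "f \<noteq> 0"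
  shows "\<exists>q0 r0 c1. f = q0 * r0 \<and> r = c1 * r0 \<and> mvars c1 \<subseteq> P"
  using assms
proof (induction "msize c" arbitrary: c q r rule: less_induct)
  case less
  show ?case
  proof (cases "c dvd 1")
    case True
    then obtain c' where c': "1 = c * c'" ..
    have "f = (c * f) * c'" using c' by (simp add: mult_ac)
    also have "\<dots> = (q * c') * r" by (simp add: mult_ac less.prems)
    finally show ?thesis
      by (intro exI[of _ "q * c'"] exI[of _ r] exI[of _ 1]) auto
  next
    case False
    obtain \<pi> c' where \<pi>: "irreducible \<pi>" "c = \<pi> * c'"
      using irreducible_factor_exists[OF less.prems(2) False] by (auto elim!: dvdE)
    have nz: "\<pi> \<noteq> 0" "c' \<noteq> 0" using less.prems \<pi> by auto
    have nz': "q \<noteq> 0" "r \<noteq> 0" using less.prems by auto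
    have v\<pi>: "mvars \<pi> \<subseteq> P" "mvars c' \<subseteq> P"
      using mvars_factor[of \<pi> c' c] \<pi> less.prems by auto
    have "msize \<pi> \<noteq> 0"
      using \<pi> nz by (auto simp: msize_eq_0_iff irreducible_def mpoly_unit_iff)
    hence lt: "msize c' < msize c" using nz by (simp add: \<pi> msize_mult)
    have "\<pi> dvd q * r" unfolding less.prems(1)[symmetric] \<pi> by simp
    hence "\<pi> dvd q \<or> \<pi> dvd r"
      using euclid_insert[OF \<pi>(1) v\<pi>(1)] less.prems by (auto simp: euclid_on_def)
    thus ?thesis
    proof
      assume "\<pi> dvd q"
      then obtain q' where q': "q = \<pi> * q'" ..
      have "\<pi> * (c' * f) = \<pi> * (q' * r)" using less.prems(1) \<pi> q' by (simp add: mult_ac)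
      hence "c' * f = q' * r" using nz by simp
      moreover have "mvars q' \<subseteq> insert x P"
        using mvars_factor(2)[of \<pi> q' q] q' nz' less.prems by auto
      ultimately show ?thesis using less.hyps[OF lt] nz v\<pi> less.prems by blast
    next
      assume "\<pi> dvd r"
      then obtain r' where r': "r = \<pi> * r'" ..
      have "\<pi> * (c' * f) = \<pi> * (q * r')" using less.prems(1) \<pi> r' by (simp add: mult_ac)
      hence "c' * f = q * r'" using nz by simp
      moreover have "mvars r' \<subseteq> insert x P"
        using mvars_factor(2)[of \<pi> r' r] r' nz' less.prems by auto
      ultimately obtain q0 r0 c1 where *: "f = q0 * r0" "r' = c1 * r0" "mvars c1 \<subseteq> P"
        using less.hyps[OF lt] nz v\<pi> less.prems by blast
      hence "r = (\<pi> * c1) * r0" "mvars (\<pi> * c1) \<subseteq> P"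
        using r' v\<pi> mvars_mult[of \<pi> c1] by (auto simp: mult_ac)
      thus ?thesis using * by blast
    qed
  qed
qed

lemma no_const_divisor:
  fixes f :: "'v mpoly"
  assumes "irreducible f" "x \<in> mvars f" "irreducible \<pi>" "mvars \<pi> \<subseteq> P"
  shows "\<not> \<pi> dvd f"
proof
  assume "\<pi> dvd f"
  then obtain h where h: "f = \<pi> * h" ..
  with assms have "h dvd 1" by (auto simp: irreducible_def)
  with assms h have "mvars f = mvars \<pi>"
    using mvars_mult_eq[of \<pi> h] by (auto simp: mpoly_unit_iff irreducible_def)
  thus False using assms x by auto
qed

text \<open>This plays the part of the resultant. Among the nonzero combinations of \<open>f\<close>
  and \<open>a\<close>, one of least degree in \<open>x\<close> divides both up to factors free of
  \<open>x\<close>, by pseudo-division. Irreducibility of \<open>f\<close> leaves two cases: the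
  combination is free of \<open>x\<close>, or it is a multiple of \<open>f\<close>, and then
  \<open>f\<close> would divide \<open>a\<close>.\<close>

lemma eliminate_variable:
  fixes f a :: "'v mpoly"
  assumes f: "irreducible f" "mvars f \<subseteq> insert x P" "x \<in> mvars f"
    and a: "mvars a \<subseteq> insert x P" "\<not> f dvd a"
  shows "\<exists>u v r. r \<noteq> 0 \<and> mvars r \<subseteq> P \<and> r = u * f + v * a"
proof -
  define S where "S = {r. r \<noteq> 0 \<and> (\<exists>u v. mvars u \<subseteq> insert x P \<and> mvars v \<subseteq> insert x P \<and> r = u * f + v * a)}"
  have "f \<in> S"
    using f unfolding S_def
    by (intro CollectI conjI exI[of _ 1] exI[of _ 0]) (auto simp: irreducible_def)
  then obtain r where r: "r \<in> S" and min: "\<And>s. s \<in> S \<Longrightarrow> deg_in x r \<le> deg_in x s"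
    using ex_has_least_nat[of "\<lambda>r. r \<in> S" f "deg_in x"] by auto
  from r obtain u v where uv: "r \<noteq> 0" "mvars u \<subseteq> insert x P" "mvars v \<subseteq> insert x P" "r = u * f + v * a"
    by (auto simp: S_def)
  have vr: "mvars r \<subseteq> insert x P"
    using uv(2,3) f(2) a(1) mvars_add[of "u * f" "v * a"] mvars_mult[of u f] mvars_mult[of v a]
    unfolding uv(4) by blast
  have div: "\<exists>c q. c \<noteq> 0 \<and> mvars c \<subseteq> P \<and> mvars q \<subseteq> insert x P \<and> c * g = q * r"
    if g: "g = u' * f + v' * a" "mvars u' \<subseteq> insert x P" "mvars v' \<subseteq> insert x P" "mvars g \<subseteq> insert x P" for g u' v'
  proof -
    obtain c q s where *: "c \<noteq> 0" "mvars c \<subseteq> P" "mvars q \<subseteq> insert x P" "c * g = q * r + s"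
      "s = 0 \<or> deg_in x s < deg_in x r"
      using pseudo_division[OF uv(1) vr x g(4)] by blast
    have s: "s = (c * u' - q * u) * f + (c * v' - q * v) * a"
      using *(4) by (simp add: g(1) uv(4) algebra_simps)
    have "mvars (c * u' - q * u) \<subseteq> insert x P" "mvars (c * v' - q * v) \<subseteq> insert x P"
      using * g uv mvars_diff[of "c * u'" "q * u"] mvars_diff[of "c * v'" "q * v"]
        mvars_mult[of c u'] mvars_mult[of q u] mvars_mult[of c v'] mvars_mult[of q v] by blast+
    hence "s = 0"
      using s min[of s] *(5) unfolding S_def by fastforce
    thus ?thesis using * by auto
  qed
  obtain c q where c: "c \<noteq> 0" "mvars c \<subseteq> P" "mvars q \<subseteq> insert x P" "c * f = q * r"
    using div[of f 1 0] f by auto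
  obtain c' q' where c': "c' \<noteq> 0" "mvars c' \<subseteq> P" "mvars q' \<subseteq> insert x P" "c' * a = q' * r"
    using div[of a 0 1] a by auto
  have f0: "f \<noteq> 0" using f by auto
  \<comment> \<open>One of \<open>q0\<close> and \<open>r0\<close> is a unit. If it is
    \<open>q0\<close>, then \<open>r\<close> is a multiple of \<open>f\<close>, against the
    assumption on \<open>a\<close>; if it is \<open>r0\<close>, then \<open>r\<close> has no
    variables beyond those of \<open>c1\<close>.\<close>
  obtain q0 r0 c1 where 1: "f = q0 * r0" "r = c1 * r0" "mvars c1 \<subseteq> P"
    using split_const[OF c(4) c(1-3) vr f0] by blast
  have "mvars r \<subseteq> P"
  proof (cases "q0 dvd 1")
    case True
    then obtain e where "1 = q0 * e" ..
    hence "r0 = f * e" using 1 by (simp add: mult_ac)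
    hence "c' * a = f * (e * q' * c1)" using c'(4) 1 by (simp add: mult_ac)
    hence "f dvd a"
      using cancel_const[of f "e * q' * c1" c' a] c' a f no_const_divisor[OF f(1,3)] by auto
    with a show ?thesis by simp
  next
    case False
    hence "r0 dvd 1" using f 1 by (auto simp: irreducible_def)
    thus ?thesis using 1 mvars_mult[of c1 r0] by (auto simp: mpoly_unit_iff)
  qed
  thus ?thesis using uv by blast
qed

lemma irreducibles_prime_on_insert: "irreducibles_prime_on (insert x P)"
  unfolding irreducibles_prime_on_def
proof (intro allI impI)
  fix f :: "'v mpoly"
  assume f: "irreducible f" "mvars f \<subseteq> insert x P"
  show "euclid_on (insert x P) f"
  proof (cases "x \<in> mvars f")
    case False
    thus ?thesis using euclid_insert[OF f(1)] f by blast
  next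
    case True
    show ?thesis unfolding euclid_on_def
    proof (intro allI impI)
      fix a b :: "'v mpoly"
      assume ab: "mvars a \<subseteq> insert x P" "mvars b \<subseteq> insert x P" "f dvd a * b"
      show "f dvd a \<or> f dvd b"
      proof (cases "f dvd a")
        case False
        obtain u v r where r: "r \<noteq> 0" "mvars r \<subseteq> P" "r = u * f + v * a"
          using eliminate_variable[OF f True ab(1) False] by blast
        \<comment> \<open>Multiplying \<open>r = u * f + v * a\<close> by \<open>b\<close> makes
          \<open>f\<close> a divisor of \<open>r * b\<close>, and \<open>r\<close>, being free of
          \<open>x\<close>, can be cancelled.\<close>
        have "f dvd u * b * f + v * (a * b)" using ab by (intro dvd_add) auto
        also have "\<dots> = r * b" by (simp add: r algebra_simps)
        finally obtain h where "f * h = r * b" by (metis dvdE)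
        thus ?thesis using cancel_const[of f h r b] r ab f no_const_divisor[OF f(1) True] by blast
      qed simp
    qed
  qed
qed

end

lemma irreducibles_prime_on_finite: "finite P \<Longrightarrow> irreducibles_prime_on P"
proof (induction rule: finite_induct)
  case empty
  show ?case by (auto simp: irreducibles_prime_on_def irreducible_def mpoly_unit_iff)
qed (rule irreducibles_prime_on_insert)

lemma irreducible_dvd_mult:
  fixes f :: "'v::linorder mpoly"
  assumes "irreducible f" "f dvd a * b"
  shows "f dvd a \<or> f dvd b"
proof -
  let ?P = "mvars f \<union> mvars a \<union> mvars b"
  have "euclid_on ?P f"
    using irreducibles_prime_on_finite[of ?P] assms by (auto simp: irreducibles_prime_on_def)
  thus ?thesis using assms unfolding euclid_on_def by blast
qed

subsection \<open>The Nullstellensatz for hypersurfaces\<close>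

lemma meval_fun_upd:
  "meval (w(x := z)) p = poly (map_poly (meval w) (univ_in x p)) z"
proof (induction p rule: mpoly_induct)
  case (mon m c)
  let ?k = "Poly_Mapping.lookup m x"
  have "mval (w(x := z)) m = mval (w(x := z)) (mono_drop x m) * mval (w(x := z)) (Poly_Mapping.single x ?k)"
    by (simp add: mono_drop_decomp flip: mval_add)
  also have "mval (w(x := z)) (mono_drop x m) = mval w (mono_drop x m)"
    by (rule mval_cong) (auto simp: keys_mono_drop)
  also have "mval (w(x := z)) (Poly_Mapping.single x ?k) = z ^ ?k"
    by (cases "?k = 0") (auto simp: mval_def)
  finally show ?case
    by (simp add: univ_in_mono map_poly_monom poly_monom)
next
  case (add p q)
  then show ?case
    by (simp add: meval_hom.hom_add univ_in_hom.hom_add map_poly_add)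
qed

lemma exists_meval_nonzero:
  fixes p :: "'v::linorder mpoly"
  assumes "p \<noteq> 0"
  shows "\<exists>w. meval w p \<noteq> 0"
proof -
  have "\<exists>w. meval w p \<noteq> 0" if "finite P" "mvars p \<subseteq> P" "p \<noteq> 0" for P and p :: "'v mpoly"
    using that
  proof (induction P arbitrary: p rule: finite_induct)
    case empty
    then obtain c where c: "p = mon 0 c" by (auto simp: mvars_empty_iff)
    with empty have "c \<noteq> 0" by auto
    with c show ?case by (auto simp: mval_def)
  next
    case (insert x P)
    have "mvars (lc_in x p) \<subseteq> P"
      using mvars_lc_in[of x p] insert.prems by auto
    then obtain w where w: "meval w (lc_in x p) \<noteq> 0"
      using insert.IH[of "lc_in x p"] insert.prems by auto
    have "coeff (map_poly (meval w) (univ_in x p)) (degree (univ_in x p)) \<noteq> 0"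
      using w by (simp add: coeff_map_poly)
    hence "map_poly (meval w) (univ_in x p) \<noteq> 0"
      by (metis coeff_0)
    then obtain z where "poly (map_poly (meval w) (univ_in x p)) z \<noteq> 0"
      using poly_all_0_iff_0 by blast
    thus ?case by (auto simp flip: meval_fun_upd)
  qed
  from this[OF finite_mvars order_refl assms] show ?thesis .
qed

text \<open>If \<open>f\<close> did not divide \<open>g\<close>, elimination would give
  \<open>r = u * f + v * g\<close>, nonzero and free of \<open>x\<close>. Fix the other coordinates
  such that \<open>r\<close> and the leading coefficient of \<open>f\<close> in \<open>x\<close> do
  not vanish, and solve \<open>f = 0\<close> for \<open>x\<close>. There \<open>g\<close> vanishes
  too, hence also \<open>r\<close>, although its value does not depend on \<open>x\<close>.\<close>

lemma hypersurface_nullstellensatz: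
  fixes f g :: "'v::linorder mpoly"
  assumes f: "irreducible f" and zero: "\<And>w. meval w f = 0 \<Longrightarrow> meval w g = 0"
  shows "f dvd g"
proof (rule ccontr)
  assume ndvd: "\<not> f dvd g"
  obtain x where x: "x \<in> mvars f"
    using f by (auto simp: irreducible_def mpoly_unit_iff)
  define P where "P = (mvars f \<union> mvars g) - {x}"
  have P: "x \<notin> P" "mvars f \<subseteq> insert x P" "mvars g \<subseteq> insert x P" "finite P"
    by (auto simp: P_def)
  obtain u v r where r: "r \<noteq> 0" "mvars r \<subseteq> P" "r = u * f + v * g"
    using eliminate_variable[OF P(1) irreducibles_prime_on_finite[OF P(4)] f P(2) x P(3) ndvd] by blast
  have "r * lc_in x f \<noteq> 0" using r f by auto
  then obtain w where "meval w (r * lc_in x f) \<noteq> 0"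
    using exists_meval_nonzero by blast
  hence w: "meval w r \<noteq> 0" "meval w (lc_in x f) \<noteq> 0"
    by (auto simp: meval_hom.hom_mult)
  let ?p = "map_poly (meval w) (univ_in x f)"
  have "coeff ?p (degree (univ_in x f)) \<noteq> 0"
    using w by (simp add: coeff_map_poly)
  moreover have "degree (univ_in x f) \<noteq> 0"
    using x deg_in_eq_0_iff[of x f] by (simp add: deg_in_def)
  ultimately have "degree ?p \<noteq> 0"
    using le_degree by fastforce
  hence "\<not> constant (poly ?p)"
    by (simp add: constant_degree)
  then obtain z where "poly ?p z = 0"
    using fundamental_theorem_of_algebra by blast
  hence z: "meval (w(x := z)) f = 0"
    by (simp add: meval_fun_upd)
  have "meval (w(x := z)) r = 0"
    using z zero[OF z] by (simp add: r meval_hom.hom_add meval_hom.hom_mult)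
  moreover have "meval (w(x := z)) r = meval w r"
    by (rule meval_cong) (use r P in auto)
  ultimately show False using w by simp
qed

subsection \<open>Multiaffine polynomials\<close>

lemma mult_mon_expansion:
  fixes f h :: "'v mpoly"
  shows "f * h = (\<Sum>a\<in>Poly_Mapping.keys f. \<Sum>b\<in>Poly_Mapping.keys h.
    mon (a + b) (Poly_Mapping.lookup f a * Poly_Mapping.lookup h b))"
  by (subst mpoly_sum_monos[of f], subst mpoly_sum_monos[of h])
    (simp add: sum_product mult_single)

lemma lookup_eq_0_if_not_mvars: "m \<in> Poly_Mapping.keys p \<Longrightarrow> x \<notin> mvars p \<Longrightarrow> Poly_Mapping.lookup m x = 0"
  by (auto simp: mvars_def in_keys_iff)

text \<open>A monomial of the product determines its two parts by the variables they use, so nothing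
  cancels.\<close>

lemma keys_mult_disjoint:
  fixes f h :: "'v mpoly"
  assumes disj: "mvars f \<inter> mvars h = {}"
    and a: "a \<in> Poly_Mapping.keys f" and b: "b \<in> Poly_Mapping.keys h"
  shows "a + b \<in> Poly_Mapping.keys (f * h)"
proof -
  have uniq: "a' = a \<and> b' = b"
    if "a' + b' = a + b" "a' \<in> Poly_Mapping.keys f" "b' \<in> Poly_Mapping.keys h" for a' b'
  proof -
    have *: "Poly_Mapping.lookup a' x + Poly_Mapping.lookup b' x = Poly_Mapping.lookup a x + Poly_Mapping.lookup b x" for x
      using that(1) by (metis lookup_add)
    have z: "Poly_Mapping.lookup b' x = 0" "Poly_Mapping.lookup b x = 0" if "x \<in> mvars f" for x
      using that disj \<open>b' \<in> _\<close> b lookup_eq_0_if_not_mvars[of _ h x] by blast+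
    have z': "Poly_Mapping.lookup a' x = 0" "Poly_Mapping.lookup a x = 0" if "x \<notin> mvars f" for x
      using that \<open>a' \<in> _\<close> a lookup_eq_0_if_not_mvars[of _ f x] by blast+
    have "Poly_Mapping.lookup a' x = Poly_Mapping.lookup a x \<and> Poly_Mapping.lookup b' x = Poly_Mapping.lookup b x" for x
      using *[of x] z[of x] z'[of x] by (cases "x \<in> mvars f") auto
    thus ?thesis by (auto intro: poly_mapping_eqI)
  qed
  have "Poly_Mapping.lookup (f * h) (a + b) =
      (\<Sum>a'\<in>Poly_Mapping.keys f. \<Sum>b'\<in>Poly_Mapping.keys h.
        if a' = a \<and> b' = b then Poly_Mapping.lookup f a * Poly_Mapping.lookup h b else 0)"
    unfolding mult_mon_expansion[of f h] lookup_sum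
    by (intro sum.cong refl) (use uniq in \<open>auto simp: lookup_single when_def\<close>)
  also have "\<dots> = (\<Sum>a'\<in>Poly_Mapping.keys f. if a' = a then Poly_Mapping.lookup f a * Poly_Mapping.lookup h b else 0)"
    by (intro sum.cong refl) (use b in \<open>auto\<close>)
  also have "\<dots> = Poly_Mapping.lookup f a * Poly_Mapping.lookup h b"
    using a by simp
  finally show ?thesis using a b by (auto simp: in_keys_iff)
qed

lemma deg_in_le:
  assumes "\<And>m. m \<in> Poly_Mapping.keys p \<Longrightarrow> Poly_Mapping.lookup m x \<le> n"
  shows "deg_in x p \<le> n"
  unfolding deg_in_def univ_in_def lin_ext_def
  by (rule degree_sum_le) (use assms in \<open>auto intro: order_trans[OF degree_monom_le]\<close>)

text \<open>Two factors of a polynomial of degree at most one in each variable share no variable, so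
  the monomials of the product are all the sums of a monomial of one and a monomial of the other.
  The variable set of a factor therefore allows recombination, and by \<open>connected\<close> only
  the trivial sets do.\<close>

lemma irreducible_multiaffineI:
  fixes F :: "'v::linorder mpoly"
  assumes nz: "mvars F \<noteq> {}"
    and affine: "\<And>m x. m \<in> Poly_Mapping.keys F \<Longrightarrow> Poly_Mapping.lookup m x \<le> 1"
    and connected: "\<And>A. A \<subseteq> mvars F \<Longrightarrow>
      (\<And>m m'. m \<in> Poly_Mapping.keys F \<Longrightarrow> m' \<in> Poly_Mapping.keys F \<Longrightarrow>
        \<exists>m''\<in>Poly_Mapping.keys F. \<forall>x. Poly_Mapping.lookup m'' x =
          (if x \<in> A then Poly_Mapping.lookup m x else Poly_Mapping.lookup m' x)) \<Longrightarrow>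
      A = {} \<or> A = mvars F"
  shows "irreducible F"
proof -
  have F0: "F \<noteq> 0" using nz by auto
  show ?thesis unfolding irreducible_def
  proof (intro conjI allI impI F0)
    show "\<not> F dvd 1" using nz by (simp add: mpoly_unit_iff)
    fix f h assume F: "F = f * h"
    hence nzfh: "f \<noteq> 0" "h \<noteq> 0" using F0 by auto
    have disj: "mvars f \<inter> mvars h = {}"
    proof (rule ccontr)
      assume "mvars f \<inter> mvars h \<noteq> {}"
      then obtain x where "deg_in x f \<noteq> 0" "deg_in x h \<noteq> 0"
        by (auto simp: deg_in_eq_0_iff)
      moreover have "deg_in x f + deg_in x h \<le> 1"
        using deg_in_le[of F x 1] affine deg_in_mult[OF nzfh, of x] F by auto
      ultimately show False by simp
    qed
    have "mvars f = {} \<or> mvars f = mvars F"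
    proof (rule connected)
      show "mvars f \<subseteq> mvars F" using F mvars_mult_eq[OF nzfh] by auto
      fix m m' assume m: "m \<in> Poly_Mapping.keys F" "m' \<in> Poly_Mapping.keys F"
      then obtain a b a' b' where ab: "m = a + b" "m' = a' + b'" "a \<in> Poly_Mapping.keys f"
        "b \<in> Poly_Mapping.keys h" "a' \<in> Poly_Mapping.keys f" "b' \<in> Poly_Mapping.keys h"
        unfolding F using keys_mult[of f h] by blast
      show "\<exists>m''\<in>Poly_Mapping.keys F. \<forall>x. Poly_Mapping.lookup m'' x =
          (if x \<in> mvars f then Poly_Mapping.lookup m x else Poly_Mapping.lookup m' x)"
      proof (intro bexI allI)
        show "a + b' \<in> Poly_Mapping.keys F"
          unfolding F by (rule keys_mult_disjoint[OF disj ab(3,6)])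
        fix x
        have "Poly_Mapping.lookup b x = 0" "Poly_Mapping.lookup b' x = 0" if "x \<in> mvars f"
          using that ab disj lookup_eq_0_if_not_mvars[of _ h x] by blast+
        moreover have "Poly_Mapping.lookup a x = 0" "Poly_Mapping.lookup a' x = 0" if "x \<notin> mvars f"
          using that ab lookup_eq_0_if_not_mvars[of _ f x] by blast+
        ultimately show "Poly_Mapping.lookup (a + b') x =
            (if x \<in> mvars f then Poly_Mapping.lookup m x else Poly_Mapping.lookup m' x)"
          by (auto simp: lookup_add ab)
      qed
    qed
    thus "f dvd 1 \<or> h dvd 1"
      using disj mvars_mult_eq[OF nzfh] F nzfh by (auto simp: mpoly_unit_iff)
  qed
qed

subsection \<open>Setting variables to zero\<close>

definition restrict_vars :: "'v set \<Rightarrow> 'v mpoly \<Rightarrow> 'v mpoly" where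
  "restrict_vars P = lin_ext (\<lambda>m c. if Poly_Mapping.keys m \<subseteq> P then mon m c else 0)"

interpretation restrict_vars: mono_hom "\<lambda>m c. if Poly_Mapping.keys m \<subseteq> P then mon m c else 0" for P
  by unfold_locales (auto simp: single_add mult_single keys_add_nat)

interpretation restrict_vars_hom: comm_ring_hom "restrict_vars P" for P
  unfolding restrict_vars_def by (rule restrict_vars.comm_ring_hom_lin_ext)

lemma restrict_vars_mon: "restrict_vars P (mon m c) = (if Poly_Mapping.keys m \<subseteq> P then mon m c else 0)"
  unfolding restrict_vars_def by simp

lemma mvars_restrict_vars: "mvars (restrict_vars P p) \<subseteq> P"
proof (induction p rule: mpoly_induct)
  case (add p q)
  then show ?case
    using mvars_add[of "restrict_vars P p" "restrict_vars P q"] by (auto simp: restrict_vars_hom.hom_add)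
qed (auto simp: restrict_vars_mon mvars_mono)

lemma restrict_vars_id: "mvars p \<subseteq> P \<Longrightarrow> restrict_vars P p = p"
proof -
  assume "mvars p \<subseteq> P"
  hence "restrict_vars P p = (\<Sum>m\<in>Poly_Mapping.keys p. mon m (Poly_Mapping.lookup p m))"
    unfolding restrict_vars_def lin_ext_def by (intro sum.cong) (auto simp: mvars_def)
  thus ?thesis by (simp only: mpoly_sum_monos[of p, symmetric])
qed

lemma meval_restrict_vars: "meval v (restrict_vars P p) = meval (\<lambda>x. if x \<in> P then v x else 0) p"
proof (induction p rule: mpoly_induct)
  case (mon m c)
  show ?case
  proof (cases "Poly_Mapping.keys m \<subseteq> P")
    case True
    hence "mval v m = mval (\<lambda>x. if x \<in> P then v x else 0) m"
      by (intro mval_cong) auto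
    thus ?thesis using True by (simp add: restrict_vars_mon)
  next
    case False
    then obtain x where "x \<in> Poly_Mapping.keys m" "x \<notin> P" by auto
    hence "mval (\<lambda>x. if x \<in> P then v x else 0) m = 0"
      unfolding mval_def by (intro prod_zero) (auto simp: in_keys_iff)
    thus ?thesis using False by (simp add: restrict_vars_mon)
  qed
qed (simp add: restrict_vars_hom.hom_add meval_hom.hom_add)

subsection \<open>Polynomial functions on matrices\<close>

definition entries :: "complex mat \<Rightarrow> nat \<times> nat \<Rightarrow> complex" where
  "entries A = (\<lambda>(s, t). A $$ (s - 1, t - 1))"

lemma peval_meval: "peval p A = meval (entries A) p"
  unfolding peval_def meval_def lin_ext_def mval_def entries_def
  by (intro sum.cong prod.cong refl arg_cong2[of _ _ _ _ "(*)"]) auto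

interpretation peval_hom: comm_ring_hom "\<lambda>p. peval p A" for A
  unfolding peval_meval by (rule meval_hom.comm_ring_hom_axioms)

lemma poly_vars_mvars: "poly_vars p = mvars p"
  by (simp add: poly_vars_def mvars_def)

lemma coordinate_var: "coordinate x = var x"
  by (simp add: coordinate_def var_def)

lemma peval_coordinate: "peval (coordinate (Suc r, Suc c)) A = A $$ (r, c)"
  by (simp add: peval_meval coordinate_def mval_def entries_def)

lemma polys_in_iff: "p \<in> polys_in P \<longleftrightarrow> mvars p \<subseteq> P"
  by (simp add: polys_in_def poly_vars_mvars)

lemma polys_in_mult: "p \<in> polys_in P \<Longrightarrow> q \<in> polys_in P \<Longrightarrow> p * q \<in> polys_in P"
  using mvars_mult[of p q] by (auto simp: polys_in_iff)

lemma sym_alg_mult: "p \<in> sym_alg N \<Longrightarrow> q \<in> sym_alg N \<Longrightarrow> p * q \<in> sym_alg N"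
  unfolding sym_alg_def by (rule polys_in_mult)

lemma one_in_sym_alg: "1 \<in> sym_alg N" and zero_in_sym_alg: "0 \<in> sym_alg N"
  by (auto simp: sym_alg_def polys_in_iff)

text \<open>Carries a point of affine space, where the Nullstellensatz is proved, to a matrix in the
  coordinate subspace given by \<open>P\<close>.\<close>

definition mat_with :: "nat \<Rightarrow> (nat \<times> nat) set \<Rightarrow> (nat \<times> nat \<Rightarrow> complex) \<Rightarrow> complex mat" where
  "mat_with N P v = mat N N (\<lambda>(r, c). if (Suc r, Suc c) \<in> P then v (Suc r, Suc c) else 0)"

lemma positions_pos_roots: "positions (pos_roots N) = {(s, t). 1 \<le> s \<and> s < t \<and> t \<le> N}"
proof (intro subset_antisym subsetI)
  fix x assume "x \<in> {(s, t). 1 \<le> s \<and> s < t \<and> t \<le> N}"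
  then obtain s t where "x = (s, t)" "1 \<le> s" "s < t" "t \<le> N" by auto
  hence "x = (\<lambda>(i, j). (i, Suc j)) (s, t - 1)" "(s, t - 1) \<in> pos_roots N"
    by (auto simp: pos_roots_def)
  thus "x \<in> positions (pos_roots N)"
    unfolding positions_def by (rule image_eqI)
qed (auto simp: positions_def pos_roots_def)

lemma positions_Diff: "positions (A - B) = positions A - positions B"
  unfolding positions_def by (rule image_set_diff) (auto intro!: injI)

lemma finite_positions: "finite (positions (pos_roots N))"
  by (rule finite_subset[of _ "{0..N} \<times> {0..N}"]) (auto simp: positions_pos_roots)

lemma mat_with_in_span: "mat_with N (positions R) v \<in> span_of_roots N R"
  by (auto simp: mat_with_def span_of_roots_def split: if_splits)

lemma span_of_roots_mono: "R \<subseteq> R' \<Longrightarrow> span_of_roots N R \<subseteq> span_of_roots N R'"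
  by (force simp: span_of_roots_def positions_def)

lemma m_space_subset_nilradical: "m_space N \<tau> \<subseteq> nilradical N"
  unfolding m_space_def nilradical_def by (rule span_of_roots_mono) auto

lemma peval_mat_with:
  assumes "mvars p \<subseteq> P" "P \<subseteq> positions (pos_roots N)"
  shows "peval p (mat_with N P v) = meval v p"
  unfolding peval_meval
proof (rule meval_cong)
  fix x assume "x \<in> mvars p"
  with assms obtain s t where "x = (s, t)" "x \<in> P" "1 \<le> s" "s < t" "t \<le> N"
    by (cases x) (auto simp: positions_pos_roots)
  thus "entries (mat_with N P v) x = v x" by (auto simp: entries_def mat_with_def)
qed

lemma peval_restrict_vars:
  assumes "p \<in> sym_alg N" "A \<in> span_of_roots N R" "R \<subseteq> pos_roots N"
  shows "peval (restrict_vars (positions R) p) A = peval p A"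
  unfolding peval_meval meval_restrict_vars
proof (rule meval_cong)
  fix x assume "x \<in> mvars p"
  then obtain s t where x: "x = (s, t)" "1 \<le> s" "s < t" "t \<le> N"
    using assms(1) by (cases x) (auto simp: positions_pos_roots sym_alg_def polys_in_iff)
  have "A $$ (s - 1, t - 1) = 0" if "(s, t) \<notin> positions R"
  proof -
    have "s - 1 < N" "t - 1 < N" "Suc (s - 1) = s" "Suc (t - 1) = t" using x by auto
    thus ?thesis using assms(2) that unfolding span_of_roots_def by fastforce
  qed
  thus "(if x \<in> positions R then entries A x else 0) = entries A x"
    using x by (auto simp: entries_def)
qed

subsection \<open>The Zariski topology\<close>

lemma topspace_zariski [simp]: "topspace (zariski N) = nilradical N"
proof -
  have "{A \<in> nilradical N. peval 1 A \<noteq> 0} = nilradical N" by simp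
  hence "nilradical N \<in> {{A \<in> nilradical N. peval p A \<noteq> 0} |p. p \<in> sym_alg N}"
    using one_in_sym_alg by blast
  thus ?thesis unfolding zariski_def topology_generated_by_topspace by auto
qed

lemma openin_zariski_nonzero: "p \<in> sym_alg N \<Longrightarrow> openin (zariski N) {A \<in> nilradical N. peval p A \<noteq> 0}"
  unfolding zariski_def by (rule topology_generated_by_Basis) auto

lemma closedin_zariski_zero: "p \<in> sym_alg N \<Longrightarrow> closedin (zariski N) {A \<in> nilradical N. peval p A = 0}"
proof -
  assume p: "p \<in> sym_alg N"
  have "nilradical N - {A \<in> nilradical N. peval p A = 0} = {A \<in> nilradical N. peval p A \<noteq> 0}" by auto
  thus ?thesis using openin_zariski_nonzero[OF p] by (auto simp: closedin_def)
qed

lemma zariski_basis: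
  assumes "openin (zariski N) U" "A \<in> U"
  shows "\<exists>p\<in>sym_alg N. peval p A \<noteq> 0 \<and> {B \<in> nilradical N. peval p B \<noteq> 0} \<subseteq> U"
proof -
  have "generate_topology_on {{A \<in> nilradical N. peval p A \<noteq> 0} |p. p \<in> sym_alg N} U"
    using assms(1) by (simp add: zariski_def openin_topology_generated_by_iff)
  thus ?thesis using assms(2)
  proof (induction arbitrary: A rule: generate_topology_on.induct)
    case (Int a b)
    then obtain p q where "p \<in> sym_alg N" "q \<in> sym_alg N" "peval p A \<noteq> 0" "peval q A \<noteq> 0"
      "{B \<in> nilradical N. peval p B \<noteq> 0} \<subseteq> a" "{B \<in> nilradical N. peval q B \<noteq> 0} \<subseteq> b"
      by blast
    thus ?case
      by (intro bexI[of _ "p * q"]) (auto simp: peval_hom.hom_mult intro: sym_alg_mult)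
  next
    case (UN K)
    then obtain k where "k \<in> K" "A \<in> k" by blast
    with UN.IH[OF this] show ?case by blast
  qed auto
qed

lemma zariski_closed_separate:
  assumes "closedin (zariski N) S" "A \<in> nilradical N" "A \<notin> S"
  shows "\<exists>p\<in>sym_alg N. peval p A \<noteq> 0 \<and> (\<forall>B\<in>S. peval p B = 0)"
proof -
  have "openin (zariski N) (nilradical N - S)"
    using assms(1) by (simp add: closedin_def)
  then obtain p where p: "p \<in> sym_alg N" "peval p A \<noteq> 0"
    "{B \<in> nilradical N. peval p B \<noteq> 0} \<subseteq> nilradical N - S"
    using zariski_basis[of N "nilradical N - S" A] assms by auto
  moreover have "S \<subseteq> nilradical N"
    using closedin_subset[OF assms(1)] by simp
  ultimately show ?thesis by (intro bexI[of _ p]) auto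
qed

lemma peval_closure_of:
  assumes "p \<in> sym_alg N" "V \<subseteq> nilradical N" "\<And>A. A \<in> V \<Longrightarrow> peval p A = 0"
    "A \<in> zariski N closure_of V"
  shows "peval p A = 0"
proof -
  have "zariski N closure_of V \<subseteq> {A \<in> nilradical N. peval p A = 0}"
    by (rule closure_of_minimal) (use assms closedin_zariski_zero in auto)
  thus ?thesis using assms by auto
qed

text \<open>A closed set missing a point of \<open>S\<close> is separated from it by a polynomial.
  If two closed sets cover \<open>S\<close> and neither contains it, the product of their two
  polynomials vanishes on \<open>S\<close> while neither factor does.\<close>

lemma irreducible_in_zariskiI:
  assumes "S \<subseteq> nilradical N" "S \<noteq> {}"
    and prime: "\<And>p q. p \<in> sym_alg N \<Longrightarrow> q \<in> sym_alg N \<Longrightarrow> (\<And>A. A \<in> S \<Longrightarrow> peval (p * q) A = 0) \<Longrightarrow>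
      (\<forall>A\<in>S. peval p A = 0) \<or> (\<forall>A\<in>S. peval q A = 0)"
  shows "irreducible_in (zariski N) S"
  unfolding irreducible_in_def
proof (intro conjI allI impI)
  fix K L assume KL: "closedin (zariski N) K \<and> closedin (zariski N) L \<and> S \<subseteq> K \<union> L"
  show "S \<subseteq> K \<or> S \<subseteq> L"
  proof (rule ccontr)
    assume "\<not> (S \<subseteq> K \<or> S \<subseteq> L)"
    then obtain A B where AB: "A \<in> S" "A \<notin> K" "B \<in> S" "B \<notin> L" by auto
    obtain p where p: "p \<in> sym_alg N" "peval p A \<noteq> 0" "\<forall>C\<in>K. peval p C = 0"
      using zariski_closed_separate[of N K A] KL AB assms(1) by auto
    obtain q where q: "q \<in> sym_alg N" "peval q B \<noteq> 0" "\<forall>C\<in>L. peval q C = 0"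
      using zariski_closed_separate[of N L B] KL AB assms(1) by auto
    have "peval (p * q) C = 0" if "C \<in> S" for C
      using that KL p q by (auto simp: peval_hom.hom_mult)
    from prime[OF p(1) q(1) this] p q AB show False by auto
  qed
qed (use assms in auto)

lemma irreducible_in_zariskiD:
  assumes "irreducible_in (zariski N) S" "p \<in> sym_alg N" "q \<in> sym_alg N"
    "\<And>A. A \<in> S \<Longrightarrow> peval (p * q) A = 0"
  shows "(\<forall>A\<in>S. peval p A = 0) \<or> (\<forall>A\<in>S. peval q A = 0)"
proof -
  let ?Z = "\<lambda>p. {A \<in> nilradical N. peval p A = 0}"
  have sub: "S \<subseteq> nilradical N" using assms(1) by (simp add: irreducible_in_def)
  hence "S \<subseteq> ?Z p \<union> ?Z q" using assms(4) by (auto simp: peval_hom.hom_mult)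
  hence "S \<subseteq> ?Z p \<or> S \<subseteq> ?Z q"
    using assms(1) closedin_zariski_zero[OF assms(2)] closedin_zariski_zero[OF assms(3)]
    unfolding irreducible_in_def by (elim conjE allE[of _ "?Z p"] allE[of _ "?Z q"] impE) simp_all
  thus ?thesis by auto
qed

text \<open>Choose \<open>q\<close> that vanishes off the open set but not on all of
  \<open>V\<close>. Then \<open>p * q\<close> vanishes on \<open>V\<close>, and by irreducibility it
  must be \<open>p\<close> that does.\<close>

lemma irreducible_in_dense:
  assumes irr: "irreducible_in (zariski N) V" and U: "openin (subtopology (zariski N) V) U" "U \<noteq> {}"
    and p: "p \<in> sym_alg N" "\<And>A. A \<in> U \<Longrightarrow> peval p A = 0" and A: "A \<in> V"
  shows "peval p A = 0"
proof -
  obtain W where W: "openin (zariski N) W" "U = W \<inter> V"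
    using U(1) by (auto simp: openin_subtopology)
  obtain B where B: "B \<in> W" "B \<in> V" using W U by auto
  obtain q where q: "q \<in> sym_alg N" "peval q B \<noteq> 0" "{B \<in> nilradical N. peval q B \<noteq> 0} \<subseteq> W"
    using zariski_basis[OF W(1) B(1)] by auto
  have "V \<subseteq> nilradical N" using irr by (simp add: irreducible_in_def)
  hence "peval (p * q) C = 0" if "C \<in> V" for C
    using that p(2)[of C] q(3) W by (cases "peval q C = 0") (auto simp: peval_hom.hom_mult)
  from irreducible_in_zariskiD[OF irr p(1) q(1) this] q B A show ?thesis by auto
qed

lemma irreducible_in_between_closure:
  assumes "irreducible_in (zariski N) V" "V \<subseteq> S" "S \<subseteq> zariski N closure_of V"
  shows "irreducible_in (zariski N) S"
proof (rule irreducible_in_zariskiI)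
  have V: "V \<subseteq> nilradical N" "V \<noteq> {}" using assms(1) by (auto simp: irreducible_in_def)
  show "S \<subseteq> nilradical N"
    using assms(3) closure_of_subset_topspace[of "zariski N" V] by simp
  show "S \<noteq> {}" using V assms(2) by auto
  fix p q assume pq: "p \<in> sym_alg N" "q \<in> sym_alg N" "\<And>A. A \<in> S \<Longrightarrow> peval (p * q) A = 0"
  hence "(\<forall>A\<in>V. peval p A = 0) \<or> (\<forall>A\<in>V. peval q A = 0)"
    by (intro irreducible_in_zariskiD[OF assms(1)]) (use assms(2) in auto)
  thus "(\<forall>A\<in>S. peval p A = 0) \<or> (\<forall>A\<in>S. peval q A = 0)"
    using peval_closure_of[of _ N V] pq V assms(3) by blast
qed

text \<open>Since the supremum is not 0, some chain has positive length, which gives the properties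
  of \<open>Y\<close>; a set strictly between \<open>Y\<close> and \<open>Z\<close> would give a
  chain of length 2.\<close>

lemma codim_in_eq_1D:
  assumes "codim_in X Y Z = 1"
  shows "closedin X Y" "irreducible_in X Y" "Y \<subset> Z"
    and "closedin X Z \<Longrightarrow> irreducible_in X Z \<Longrightarrow> closedin X W \<Longrightarrow> irreducible_in X W \<Longrightarrow> Y \<subseteq> W \<Longrightarrow> W \<subset> Z \<Longrightarrow> W = Y"
proof -
  define E where "E = {enat n |n. \<exists>C :: nat \<Rightarrow> 'a set. C 0 = Y \<and> (\<forall>i<n. C i \<subset> C (Suc i)) \<and>
     (\<forall>i\<le>n. closedin X (C i) \<and> irreducible_in X (C i) \<and> C i \<subseteq> Z)}"
  have sup: "Sup E = 1" using assms by (simp add: codim_in_def E_def)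
  have "\<not> (\<forall>e\<in>E. e \<le> 0)"
  proof
    assume "\<forall>e\<in>E. e \<le> 0"
    hence "Sup E \<le> 0" by (intro Sup_least) auto
    thus False using sup by simp
  qed
  then obtain n C where C: "n > 0" "C 0 = Y" "\<forall>i<n. C i \<subset> C (Suc i)"
    "\<forall>i\<le>n. closedin X (C i) \<and> irreducible_in X (C i) \<and> C i \<subseteq> Z"
    unfolding E_def by (auto simp: zero_enat_def)
  have "Y \<subset> C (Suc 0)" using C by auto
  moreover have "C (Suc 0) \<subseteq> Z" using C by (simp add: Suc_le_eq)
  moreover have "closedin X Y" "irreducible_in X Y" using C(2,4) by blast+
  ultimately show 1: "closedin X Y" "irreducible_in X Y" "Y \<subset> Z" by blast+
  show "W = Y" if W: "closedin X Z" "irreducible_in X Z" "closedin X W" "irreducible_in X W" "Y \<subseteq> W" "W \<subset> Z"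
  proof (rule ccontr)
    assume "W \<noteq> Y"
    define D where "D i = (if i = 0 then Y else if i = 1 then W else Z)" for i :: nat
    have "\<forall>i<2. D i \<subset> D (Suc i)"
      using W \<open>W \<noteq> Y\<close> by (auto simp: D_def less_2_cases_iff)
    moreover have "\<forall>i\<le>2. closedin X (D i) \<and> irreducible_in X (D i) \<and> D i \<subseteq> Z"
      using W 1 by (auto simp: D_def)
    ultimately have "enat 2 \<in> E"
      unfolding E_def by (intro CollectI exI[of _ 2] conjI refl exI[of _ D]) (auto simp: D_def)
    hence "enat 2 \<le> Sup E" by (rule Sup_upper)
    thus False by (simp add: sup one_enat_def)
  qed
qed

subsection \<open>Ideals and hypersurfaces in coordinate subspaces\<close>

lemma sym_alg_add: "p \<in> sym_alg N \<Longrightarrow> q \<in> sym_alg N \<Longrightarrow> p + q \<in> sym_alg N"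
  using mvars_add[of p q] by (auto simp: sym_alg_def polys_in_iff)

lemma ideal_gen_finite_iff:
  assumes "finite G"
  shows "p \<in> ideal_gen N G \<longleftrightarrow> (\<exists>c. (\<forall>g\<in>G. c g \<in> sym_alg N) \<and> p = (\<Sum>g\<in>G. c g * g))"
proof
  assume "p \<in> ideal_gen N G"
  then obtain F c where F: "finite F" "F \<subseteq> G" "\<forall>g\<in>F. c g \<in> sym_alg N" "p = (\<Sum>g\<in>F. c g * g)"
    by (auto simp: ideal_gen_def)
  have "p = (\<Sum>g\<in>G. (if g \<in> F then c g else 0) * g)"
    unfolding F(4) using F(2) assms by (intro sum.mono_neutral_cong_left) auto
  thus "\<exists>c. (\<forall>g\<in>G. c g \<in> sym_alg N) \<and> p = (\<Sum>g\<in>G. c g * g)"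
    using F(3) zero_in_sym_alg by (intro exI[of _ "\<lambda>g. if g \<in> F then c g else 0"]) auto
qed (use assms in \<open>auto simp: ideal_gen_def\<close>)

lemma ideal_gen_add:
  assumes "finite G" "p \<in> ideal_gen N G" "q \<in> ideal_gen N G"
  shows "p + q \<in> ideal_gen N G"
proof -
  obtain c d where "\<forall>g\<in>G. c g \<in> sym_alg N" "p = (\<Sum>g\<in>G. c g * g)"
    "\<forall>g\<in>G. d g \<in> sym_alg N" "q = (\<Sum>g\<in>G. d g * g)"
    using assms by (auto simp: ideal_gen_finite_iff)
  thus ?thesis unfolding ideal_gen_finite_iff[OF assms(1)]
    by (intro exI[of _ "\<lambda>g. c g + d g"]) (auto simp: sym_alg_add distrib_right sum.distrib)
qed

lemma ideal_gen_zero: "0 \<in> ideal_gen N G"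
  unfolding ideal_gen_def by (intro CollectI exI[of _ "{}"]) auto

lemma ideal_gen_mult: "g \<in> G \<Longrightarrow> h \<in> sym_alg N \<Longrightarrow> h * g \<in> ideal_gen N G"
  unfolding ideal_gen_def by (intro CollectI exI[of _ "{g}"] exI[of _ "\<lambda>_. h"]) auto

lemma ideal_gen_sum:
  "finite G \<Longrightarrow> (\<And>a. a \<in> A \<Longrightarrow> f a \<in> ideal_gen N G) \<Longrightarrow> sum f A \<in> ideal_gen N G"
  by (induction A rule: infinite_finite_induct) (auto intro: ideal_gen_add ideal_gen_zero)

text \<open>A monomial killed by the restriction contains a variable outside \<open>P\<close> and is
  thus a multiple of that coordinate.\<close>

lemma diff_restrict_vars_in_ideal:
  assumes p: "p \<in> sym_alg N" and G: "finite G" "coordinate ` (positions (pos_roots N) - P) \<subseteq> G"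
  shows "p - restrict_vars P p \<in> ideal_gen N G"
proof -
  let ?c = "Poly_Mapping.lookup p"
  have "p - restrict_vars P p = (\<Sum>m\<in>Poly_Mapping.keys p. mon m (?c m)) -
      (\<Sum>m\<in>Poly_Mapping.keys p. if Poly_Mapping.keys m \<subseteq> P then mon m (?c m) else 0)"
    by (simp only: mpoly_sum_monos[of p, symmetric] restrict_vars_def lin_ext_def)
  also have "\<dots> = (\<Sum>m\<in>Poly_Mapping.keys p. if Poly_Mapping.keys m \<subseteq> P then 0 else mon m (?c m))"
    unfolding sum_subtractf[symmetric] by (intro sum.cong) auto
  also have "\<dots> \<in> ideal_gen N G"
  proof (rule ideal_gen_sum[OF G(1)])
    fix m assume m: "m \<in> Poly_Mapping.keys p"
    show "(if Poly_Mapping.keys m \<subseteq> P then 0 else mon m (?c m)) \<in> ideal_gen N G"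
    proof (cases "Poly_Mapping.keys m \<subseteq> P")
      case False
      then obtain x where x: "x \<in> Poly_Mapping.keys m" "x \<notin> P" by auto
      have mv: "Poly_Mapping.keys m \<subseteq> positions (pos_roots N)"
        using p m by (auto simp: sym_alg_def polys_in_iff mvars_def)
      let ?m' = "m - Poly_Mapping.single x 1"
      have "?m' + Poly_Mapping.single x 1 = m"
        using x by (intro poly_mapping_eqI) (auto simp: lookup_add lookup_minus lookup_single when_def in_keys_iff)
      hence "mon m (?c m) = mon ?m' (?c m) * coordinate x"
        by (simp add: coordinate_def mult_single)
      moreover have "Poly_Mapping.keys ?m' \<subseteq> Poly_Mapping.keys m"
        by (auto simp: in_keys_iff lookup_minus)
      hence "mon ?m' (?c m) \<in> sym_alg N"
        using mv by (auto simp: sym_alg_def polys_in_iff mvars_mono)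
      ultimately show ?thesis
        using x mv G(2) False by (auto intro!: ideal_gen_mult)
    qed (simp add: ideal_gen_zero)
  qed
  finally show ?thesis .
qed

lemma closedin_zariskiI:
  assumes "S \<subseteq> nilradical N" "G \<subseteq> sym_alg N" "\<And>A p. A \<in> S \<Longrightarrow> p \<in> G \<Longrightarrow> peval p A = 0"
    "\<And>A. A \<in> nilradical N \<Longrightarrow> (\<And>p. p \<in> G \<Longrightarrow> peval p A = 0) \<Longrightarrow> A \<in> S"
  shows "closedin (zariski N) S"
proof -
  have "zariski N closure_of S \<subseteq> S"
  proof
    fix A assume A: "A \<in> zariski N closure_of S"
    moreover have "A \<in> nilradical N"
      using A closure_of_subset_topspace[of "zariski N" S] by auto
    moreover have "peval p A = 0" if "p \<in> G" for p
      using peval_closure_of[of p N S A] that assms A by blast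
    ultimately show "A \<in> S" using assms(4) by blast
  qed
  thus ?thesis using assms(1) closure_of_subset_eq[of S "zariski N"] by simp
qed

lemma coordinate_in_sym_alg: "x \<in> positions (pos_roots N) \<Longrightarrow> coordinate x \<in> sym_alg N"
  by (auto simp: sym_alg_def polys_in_iff coordinate_var)

lemma coordinate_zero_on_span:
  assumes "x \<in> positions (pos_roots N)" "x \<notin> positions R" "A \<in> span_of_roots N R"
  shows "peval (coordinate x) A = 0"
proof -
  obtain s t where x: "x = (s, t)" "1 \<le> s" "s < t" "t \<le> N"
    using assms(1) by (auto simp: positions_pos_roots)
  hence "s - 1 < N" "t - 1 < N" "x = (Suc (s - 1), Suc (t - 1))" by auto
  with assms(2,3) show ?thesis
    unfolding \<open>x = (Suc _, _)\<close> peval_coordinate span_of_roots_def by blast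
qed

lemma span_of_rootsI:
  assumes "A \<in> nilradical N" "\<And>x. x \<in> positions (pos_roots N) - positions R \<Longrightarrow> peval (coordinate x) A = 0"
  shows "A \<in> span_of_roots N R"
proof -
  have "(Suc r, Suc c) \<in> positions R" if "r < N" "c < N" "A $$ (r, c) \<noteq> 0" for r c
  proof (rule ccontr)
    assume "(Suc r, Suc c) \<notin> positions R"
    moreover have "(Suc r, Suc c) \<in> positions (pos_roots N)"
      using assms(1) that by (auto simp: nilradical_def span_of_roots_def)
    ultimately show False using assms(2)[of "(Suc r, Suc c)"] that by (simp add: peval_coordinate)
  qed
  thus ?thesis using assms(1) by (auto simp: nilradical_def span_of_roots_def)
qed

locale hypersurface =
  fixes N :: nat and R :: "(nat \<times> nat) set" and F :: cpoly
  assumes R: "R \<subseteq> pos_roots N" and F: "irreducible F" "mvars F \<subseteq> positions R"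
begin

abbreviation "M \<equiv> span_of_roots N R"
abbreviation "H \<equiv> {A \<in> M. peval F A = 0}"

lemma M_nilradical: "M \<subseteq> nilradical N"
  using span_of_roots_mono[OF R] by (simp add: nilradical_def)

lemma positions_R: "positions R \<subseteq> positions (pos_roots N)"
  using R by (auto simp: positions_def)

lemma F_sym_alg: "F \<in> sym_alg N"
  using F positions_R by (auto simp: sym_alg_def polys_in_iff)

lemma restrict_vars_eq_0_iff:
  assumes "p \<in> sym_alg N"
  shows "restrict_vars (positions R) p = 0 \<longleftrightarrow> (\<forall>A\<in>M. peval p A = 0)"
proof
  assume *: "\<forall>A\<in>M. peval p A = 0"
  show "restrict_vars (positions R) p = 0"
  proof (rule ccontr)
    assume "restrict_vars (positions R) p \<noteq> 0"
    then obtain w where "meval w (restrict_vars (positions R) p) \<noteq> 0"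
      using exists_meval_nonzero by blast
    hence "peval (restrict_vars (positions R) p) (mat_with N (positions R) w) \<noteq> 0"
      by (simp add: peval_mat_with mvars_restrict_vars positions_R)
    thus False
      using * assms R mat_with_in_span by (simp add: peval_restrict_vars[where R = R])
  qed
qed (use assms R in \<open>auto simp flip: peval_restrict_vars[where R = R]\<close>)

text \<open>The Nullstellensatz inside \<open>M\<close>: there a polynomial agrees with its
  restriction, which involves only the coordinates of \<open>M\<close>.\<close>

lemma dvd_restrict_vars_iff:
  assumes "p \<in> sym_alg N"
  shows "F dvd restrict_vars (positions R) p \<longleftrightarrow> (\<forall>A\<in>H. peval p A = 0)"
proof
  assume *: "\<forall>A\<in>H. peval p A = 0"
  show "F dvd restrict_vars (positions R) p"
  proof (rule hypersurface_nullstellensatz[OF F(1)])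
    fix w assume w: "meval w F = 0"
    let ?A = "mat_with N (positions R) w"
    have A: "?A \<in> M" by (rule mat_with_in_span)
    have "peval F ?A = 0" using w F positions_R by (simp add: peval_mat_with)
    hence "peval p ?A = 0" using * A by auto
    hence "peval (restrict_vars (positions R) p) ?A = 0"
      using assms A R by (simp add: peval_restrict_vars)
    thus "meval w (restrict_vars (positions R) p) = 0"
      by (simp add: peval_mat_with mvars_restrict_vars positions_R)
  qed
next
  assume "F dvd restrict_vars (positions R) p"
  then obtain h where h: "restrict_vars (positions R) p = F * h" ..
  show "\<forall>A\<in>H. peval p A = 0"
    using assms R h by (auto simp: peval_hom.hom_mult simp flip: peval_restrict_vars[where R = R])
qed

lemma closedin_M: "closedin (zariski N) M"
  by (rule closedin_zariskiI[where G = "coordinate ` (positions (pos_roots N) - positions R)"])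
    (use M_nilradical coordinate_zero_on_span span_of_rootsI in \<open>auto simp: coordinate_in_sym_alg\<close>)

lemma irreducible_in_M: "irreducible_in (zariski N) M"
proof (rule irreducible_in_zariskiI[OF M_nilradical])
  show "M \<noteq> {}" using mat_with_in_span by blast
  fix p q assume pq: "p \<in> sym_alg N" "q \<in> sym_alg N" "\<And>A. A \<in> M \<Longrightarrow> peval (p * q) A = 0"
  hence "restrict_vars (positions R) (p * q) = 0"
    by (simp add: restrict_vars_eq_0_iff sym_alg_mult)
  thus "(\<forall>A\<in>M. peval p A = 0) \<or> (\<forall>A\<in>M. peval q A = 0)"
    using pq by (simp add: restrict_vars_hom.hom_mult restrict_vars_eq_0_iff)
qed

lemma closedin_H: "closedin (zariski N) H"
  by (rule closedin_zariskiI[where G = "insert F (coordinate ` (positions (pos_roots N) - positions R))"])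
    (use M_nilradical coordinate_zero_on_span span_of_rootsI F_sym_alg in \<open>auto simp: coordinate_in_sym_alg\<close>)

lemma irreducible_in_H: "irreducible_in (zariski N) H"
proof (rule irreducible_in_zariskiI)
  show "H \<subseteq> nilradical N" using M_nilradical by auto
  show "H \<noteq> {}"
  proof
    assume "H = {}"
    hence "F dvd restrict_vars (positions R) 1"
      by (subst dvd_restrict_vars_iff) (auto simp: one_in_sym_alg)
    thus False using F by (simp add: irreducible_def)
  qed
  fix p q assume pq: "p \<in> sym_alg N" "q \<in> sym_alg N" "\<And>A. A \<in> H \<Longrightarrow> peval (p * q) A = 0"
  hence "F dvd restrict_vars (positions R) (p * q)"
    by (subst dvd_restrict_vars_iff) (auto simp: sym_alg_mult)
  hence "F dvd restrict_vars (positions R) p \<or> F dvd restrict_vars (positions R) q"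
    by (intro irreducible_dvd_mult[OF F(1)]) (simp add: restrict_vars_hom.hom_mult)
  thus "(\<forall>A\<in>H. peval p A = 0) \<or> (\<forall>A\<in>H. peval q A = 0)"
    using pq by (simp add: dvd_restrict_vars_iff)
qed

lemma codim_1_eq_H:
  assumes "codim_in (zariski N) Y M = 1" "\<And>A. A \<in> Y \<Longrightarrow> peval F A = 0"
  shows "Y = H"
proof -
  note D = codim_in_eq_1D[OF assms(1)]
  have "H \<subset> M"
  proof (rule psubsetI)
    show "H \<noteq> M"
    proof
      assume "H = M"
      hence "restrict_vars (positions R) F = 0"
        using restrict_vars_eq_0_iff[OF F_sym_alg] by auto
      thus False using F by (simp add: restrict_vars_id)
    qed
  qed auto
  moreover have "Y \<subseteq> H" using D(3) assms(2) by auto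
  ultimately show ?thesis
    using D(4)[OF closedin_M irreducible_in_M closedin_H irreducible_in_H] by auto
qed

lemma vanishing_ideal_H:
  "vanishing_ideal N H = ideal_gen N (insert F (coordinate ` (positions (pos_roots N) - positions R)))"
  (is "_ = ideal_gen N ?G")
proof (intro subset_antisym subsetI)
  have fin: "finite ?G" using finite_positions by auto
  fix p assume "p \<in> vanishing_ideal N H"
  hence p: "p \<in> sym_alg N" "F dvd restrict_vars (positions R) p"
    by (auto simp: vanishing_ideal_def dvd_restrict_vars_iff)
  then obtain h where h: "restrict_vars (positions R) p = F * h" by (auto elim: dvdE)
  have "h * F \<in> ideal_gen N ?G"
  proof (cases "F * h = 0")
    case True
    thus ?thesis by (auto simp: ideal_gen_zero)
  next
    case False
    hence "mvars h \<subseteq> positions R"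
      using mvars_factor(2)[of F h] mvars_restrict_vars[of "positions R" p] h by auto
    hence "h \<in> sym_alg N" using positions_R by (auto simp: sym_alg_def polys_in_iff)
    thus ?thesis by (intro ideal_gen_mult) auto
  qed
  moreover have "p - restrict_vars (positions R) p \<in> ideal_gen N ?G"
    by (rule diff_restrict_vars_in_ideal[OF p(1) fin]) auto
  ultimately have "(p - restrict_vars (positions R) p) + h * F \<in> ideal_gen N ?G"
    by (intro ideal_gen_add[OF fin])
  thus "p \<in> ideal_gen N ?G" by (simp add: h mult.commute)
next
  fix p assume "p \<in> ideal_gen N ?G"
  then obtain S c where p: "finite S" "S \<subseteq> ?G" "\<forall>g\<in>S. c g \<in> sym_alg N" "p = (\<Sum>g\<in>S. c g * g)"
    by (auto simp: ideal_gen_def)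
  have G: "g \<in> sym_alg N \<and> (\<forall>A\<in>H. peval g A = 0)" if "g \<in> ?G" for g
    using that F_sym_alg coordinate_in_sym_alg coordinate_zero_on_span by blast
  have "p \<in> sym_alg N \<and> (\<forall>A\<in>H. peval p A = 0)"
    unfolding p(4) using p(1-3)
  proof induction
    case (insert g S)
    thus ?case using G[of g]
      by (auto simp: peval_hom.hom_add peval_hom.hom_mult sym_alg_add sym_alg_mult)
  qed (auto simp: zero_in_sym_alg)
  thus "p \<in> vanishing_ideal N H" by (simp add: vanishing_ideal_def)
qed

end

subsection \<open>Minors of the pencil $t + A$\<close>

definition pencil :: "(nat \<Rightarrow> nat \<Rightarrow> 'a::comm_ring_1) \<Rightarrow> nat \<Rightarrow> nat \<Rightarrow> 'a poly" where
  "pencil a r c = [:a r c, if r = c then 1 else 0:]"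

text \<open>Rows and columns are chosen by arbitrary functions, in any order and with repetitions,
  because multilinear expansion produces such choices. A repetition makes the determinant
  zero.\<close>

definition pencil_minor :: "(nat \<Rightarrow> nat \<Rightarrow> 'a::comm_ring_1) \<Rightarrow> nat \<Rightarrow> (nat \<Rightarrow> nat) \<Rightarrow> (nat \<Rightarrow> nat) \<Rightarrow> 'a poly" where
  "pencil_minor a n f g = det (mat n n (\<lambda>(i, j). pencil a (f i) (g j)))"

lemma det_mat: "det (mat n n f) = (\<Sum>p | p permutes {0..<n}. signof p * (\<Prod>i = 0..<n. f (i, p i)))"
proof -
  have "det (mat n n f) = (\<Sum>p | p permutes {0..<n}. signof p * (\<Prod>i = 0..<n. mat n n f $$ (i, p i)))"
    by (rule det_def') simp
  also have "\<dots> = (\<Sum>p | p permutes {0..<n}. signof p * (\<Prod>i = 0..<n. f (i, p i)))"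
  proof (intro sum.cong refl arg_cong2[of _ _ _ _ "(*)"] prod.cong)
    fix p i assume "p \<in> {p. p permutes {0..<n}}" "i \<in> {0..<n}"
    hence "p i < n" "i < n" using permutes_in_image[of p "{0..<n}" i] by auto
    thus "mat n n f $$ (i, p i) = f (i, p i)" by simp
  qed
  finally show ?thesis .
qed

text \<open>The part of the Cauchy-Binet formula that divisibility needs: expanding row after row
  gives a combination of determinants formed from rows of \<open>X\<close>, all divisible by
  \<open>d\<close>.\<close>

lemma dvd_det_row_combinations:
  fixes X :: "nat \<Rightarrow> nat \<Rightarrow> 'a::comm_ring_1"
  assumes S: "finite S" and X: "\<And>\<phi>. (\<And>i. i < n \<Longrightarrow> \<phi> i \<in> S) \<Longrightarrow> d dvd det (mat n n (\<lambda>(i, j). X (\<phi> i) j))"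
    and ne: "S \<noteq> {}"
  shows "d dvd det (mat n n (\<lambda>(i, j). \<Sum>s\<in>S. c i s * X s j))"
proof -
  \<comment> \<open>The first \<open>m\<close> rows are combinations and the remaining ones single
    rows of \<open>X\<close>; induction on \<open>m\<close> converts one more row.\<close>
  let ?E = "\<lambda>m \<phi> i j. if i < m then \<Sum>s\<in>S. c i s * X s j else X (\<phi> i) j"
  have "d dvd (\<Sum>p | p permutes {0..<n}. signof p * (\<Prod>i = 0..<n. ?E m \<phi> i (p i)))"
    if "m \<le> n" "\<And>i. i < n \<Longrightarrow> \<phi> i \<in> S" for m \<phi>
    using that
  proof (induction m arbitrary: \<phi>)
    case 0
    then show ?case using X[of \<phi>] by (simp add: det_mat)
  next
    case (Suc m)
    have "(\<Prod>i = 0..<n. ?E (Suc m) \<phi> i (p i)) = (\<Sum>s\<in>S. c m s * (\<Prod>i = 0..<n. ?E m (\<phi>(m := s)) i (p i)))" for p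
    proof -
      have m: "m \<in> {0..<n}" using Suc.prems by simp
      have "(\<Prod>i = 0..<n. ?E (Suc m) \<phi> i (p i)) = (\<Sum>s\<in>S. c m s * X s (p m)) * (\<Prod>i\<in>{0..<n}-{m}. ?E (Suc m) \<phi> i (p i))"
        by (subst prod.remove[OF _ m]) auto
      also have "\<dots> = (\<Sum>s\<in>S. c m s * (X s (p m) * (\<Prod>i\<in>{0..<n}-{m}. ?E (Suc m) \<phi> i (p i))))"
        by (simp add: sum_distrib_right mult.assoc)
      also have "\<dots> = (\<Sum>s\<in>S. c m s * (\<Prod>i = 0..<n. ?E m (\<phi>(m := s)) i (p i)))"
      proof (intro sum.cong refl arg_cong2[of _ _ _ _ "(*)"])
        fix s assume "s \<in> S"
        have "(\<Prod>i = 0..<n. ?E m (\<phi>(m := s)) i (p i)) = X s (p m) * (\<Prod>i\<in>{0..<n}-{m}. ?E m (\<phi>(m := s)) i (p i))"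
          by (subst prod.remove[OF _ m]) auto
        also have "(\<Prod>i\<in>{0..<n}-{m}. ?E m (\<phi>(m := s)) i (p i)) = (\<Prod>i\<in>{0..<n}-{m}. ?E (Suc m) \<phi> i (p i))"
          by (intro prod.cong refl) auto
        finally show "X s (p m) * (\<Prod>i\<in>{0..<n}-{m}. ?E (Suc m) \<phi> i (p i)) = (\<Prod>i = 0..<n. ?E m (\<phi>(m := s)) i (p i))" ..
      qed
      finally show ?thesis .
    qed
    hence "(\<Sum>p | p permutes {0..<n}. signof p * (\<Prod>i = 0..<n. ?E (Suc m) \<phi> i (p i))) =
        (\<Sum>p | p permutes {0..<n}. \<Sum>s\<in>S. c m s * (signof p * (\<Prod>i = 0..<n. ?E m (\<phi>(m := s)) i (p i))))"
      by (simp only: sum_distrib_left mult.left_commute)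
    also have "\<dots> = (\<Sum>s\<in>S. c m s * (\<Sum>p | p permutes {0..<n}. signof p * (\<Prod>i = 0..<n. ?E m (\<phi>(m := s)) i (p i))))"
      unfolding sum_distrib_left by (rule sum.swap)
    also have "d dvd \<dots>"
      by (intro dvd_sum dvd_mult Suc.IH) (use Suc.prems in auto)
    finally show ?case .
  qed
  from this[of n "\<lambda>_. SOME s. s \<in> S"] ne
  have "d dvd (\<Sum>p | p permutes {0..<n}. signof p * (\<Prod>i = 0..<n. ?E n (\<lambda>_. SOME s. s \<in> S) i (p i)))"
    by (simp add: some_in_eq)
  also have "\<dots> = det (mat n n (\<lambda>(i, j). \<Sum>s\<in>S. c i s * X s j))"
    unfolding det_mat by (intro sum.cong refl arg_cong2[of _ _ _ _ "(*)"] prod.cong) auto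
  finally show ?thesis .
qed

lemma dvd_det_column_combinations:
  fixes X :: "nat \<Rightarrow> nat \<Rightarrow> 'a::comm_ring_1"
  assumes S: "finite S" and X: "\<And>\<phi>. (\<And>i. i < n \<Longrightarrow> \<phi> i \<in> S) \<Longrightarrow> d dvd det (mat n n (\<lambda>(i, j). X i (\<phi> j)))"
    and ne: "S \<noteq> {}"
  shows "d dvd det (mat n n (\<lambda>(i, j). \<Sum>s\<in>S. X i s * c s j))"
proof -
  have T: "det (mat n n (\<lambda>(i, j). h j i)) = det (mat n n (\<lambda>(i, j). h i j))" for h :: "nat \<Rightarrow> nat \<Rightarrow> 'a"
  proof -
    have "transpose_mat (mat n n (\<lambda>(i, j). h i j)) = mat n n (\<lambda>(i, j). h j i)" by auto
    thus ?thesis using det_transpose[of "mat n n (\<lambda>(i, j). h i j)" n] by simp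
  qed
  have "d dvd det (mat n n (\<lambda>(i, j). \<Sum>s\<in>S. c s i * X j s))"
    by (rule dvd_det_row_combinations[OF S _ ne]) (subst T, rule X)
  thus ?thesis by (subst T[symmetric]) (simp add: mult.commute)
qed

text \<open>From \<open>t + A = P * (t + B) * Q\<close> each minor of \<open>t + A\<close> is a
  combination of minors of \<open>t + B\<close> of the same size, so a common divisor of the latter
  divides the former.\<close>

lemma dvd_pencil_minors_similar:
  fixes A B P Q :: "'a::comm_ring_1 mat"
  assumes AB: "similar_mat_wit A B P Q" "A \<in> carrier_mat k k"
    and dvd: "\<And>f g. (\<And>i. i < n \<Longrightarrow> f i < k) \<Longrightarrow> (\<And>i. i < n \<Longrightarrow> g i < k) \<Longrightarrow>
      d dvd pencil_minor (\<lambda>r c. B $$ (r, c)) n f g"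
    and fg: "\<And>i. i < n \<Longrightarrow> f i < k" "\<And>i. i < n \<Longrightarrow> g i < k"
  shows "d dvd pencil_minor (\<lambda>r c. A $$ (r, c)) n f g"
proof (cases "k = 0")
  case True
  with fg have "n = 0" by (cases n) auto
  thus ?thesis using dvd[of f g] by (simp add: pencil_minor_def)
next
  case False
  have c: "B \<in> carrier_mat k k" "P \<in> carrier_mat k k" "Q \<in> carrier_mat k k"
    and A: "A = P * B * Q" and PQ: "P * Q = 1\<^sub>m k"
  proof -
    have "k = dim_row A" using AB(2) by auto
    note W = similar_mat_witD[OF this AB(1)]
    show "B \<in> carrier_mat k k" "P \<in> carrier_mat k k" "Q \<in> carrier_mat k k" "A = P * B * Q" "P * Q = 1\<^sub>m k"
      using W by blast+
  qed
  let ?B = "\<lambda>r c. B $$ (r, c)"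
  have ne: "{..<k} \<noteq> {}" using False by auto
  have entry: "pencil (\<lambda>r c. A $$ (r, c)) r c' = (\<Sum>s<k. [:P $$ (r, s):] * (\<Sum>u<k. pencil ?B s u * [:Q $$ (u, c'):]))"
    if "r < k" "c' < k" for r c'
  proof -
    have 1: "A $$ (r, c') = (\<Sum>s<k. P $$ (r, s) * (\<Sum>u<k. B $$ (s, u) * Q $$ (u, c')))"
    proof -
      have "A = P * (B * Q)" unfolding A by (rule assoc_mult_mat[OF c(2,1,3)])
      thus ?thesis using that c by (simp add: scalar_prod_def lessThan_atLeast0)
    qed
    have 2: "(if r = c' then 1 else 0) = (\<Sum>s<k. P $$ (r, s) * Q $$ (s, c'))"
    proof -
      have "(P * Q) $$ (r, c') = (\<Sum>s<k. P $$ (r, s) * Q $$ (s, c'))"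
        using that c by (simp add: scalar_prod_def lessThan_atLeast0)
      thus ?thesis using that by (simp add: PQ)
    qed
    have "(\<Sum>u<k. pencil ?B s u * [:Q $$ (u, c'):]) = [:\<Sum>u<k. B $$ (s, u) * Q $$ (u, c'), Q $$ (s, c'):]" if "s < k" for s
    proof -
      have "(\<Sum>u<k. pencil ?B s u * [:Q $$ (u, c'):]) = (\<Sum>u<k. [:B $$ (s, u) * Q $$ (u, c'):] + (if u = s then [:0, Q $$ (s, c'):] else 0))"
        by (intro sum.cong refl) (auto simp: pencil_def mult.commute)
      also have "\<dots> = (\<Sum>u<k. [:B $$ (s, u) * Q $$ (u, c'):]) + [:0, Q $$ (s, c'):]"
        using that by (simp add: sum.distrib)
      also have "(\<Sum>u<k. [:B $$ (s, u) * Q $$ (u, c'):]) = [:\<Sum>u<k. B $$ (s, u) * Q $$ (u, c'):]"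
        by (simp flip: monom_0 monom_sum)
      finally show ?thesis by simp
    qed
    hence "(\<Sum>s<k. [:P $$ (r, s):] * (\<Sum>u<k. pencil ?B s u * [:Q $$ (u, c'):])) =
        (\<Sum>s<k. [:P $$ (r, s):] * [:\<Sum>u<k. B $$ (s, u) * Q $$ (u, c'), Q $$ (s, c'):])"
      by (intro sum.cong refl) simp
    also have "\<dots> = (\<Sum>s<k. [:P $$ (r, s) * (\<Sum>u<k. B $$ (s, u) * Q $$ (u, c')):] + monom (P $$ (r, s) * Q $$ (s, c')) 1)"
      by (intro sum.cong refl) (simp add: monom_Suc monom_0)
    also have "\<dots> = [:A $$ (r, c'):] + monom (if r = c' then 1 else 0) 1"
      unfolding 1 2 sum.distrib by (simp flip: monom_0 monom_sum)
    finally show ?thesis by (simp add: pencil_def monom_Suc monom_0)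
  qed
  have "d dvd det (mat n n (\<lambda>(i, j). \<Sum>s<k. [:P $$ (f i, s):] * (\<Sum>u<k. pencil ?B s u * [:Q $$ (u, g j):])))"
  proof (rule dvd_det_row_combinations[OF _ _ ne])
    fix \<phi> assume \<phi>: "\<And>i. i < n \<Longrightarrow> \<phi> i \<in> {..<k}"
    show "d dvd det (mat n n (\<lambda>(i, j). \<Sum>u<k. pencil ?B (\<phi> i) u * [:Q $$ (u, g j):]))"
      by (rule dvd_det_column_combinations[OF _ _ ne])
        (use \<phi> dvd in \<open>auto simp: pencil_minor_def\<close>)
  qed auto
  also have "mat n n (\<lambda>(i, j). \<Sum>s<k. [:P $$ (f i, s):] * (\<Sum>u<k. pencil ?B s u * [:Q $$ (u, g j):])) =
      mat n n (\<lambda>(i, j). pencil (\<lambda>r c. A $$ (r, c)) (f i) (g j))"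
    by (rule eq_matI) (use fg in \<open>auto simp: entry\<close>)
  finally show ?thesis by (simp add: pencil_minor_def)
qed

subsection \<open>Counting fixed points of partial injections\<close>

text \<open>A term of a minor of size \<open>card X - q\<close> is a partial injection \<open>\<pi>\<close> defined on all but \<open>q\<close>
  elements, which fixes an element or raises its block number \<open>b\<close>.\<close>

locale rising_injection =
  fixes X R :: "'a set" and \<pi> :: "'a \<Rightarrow> 'a" and b :: "'a \<Rightarrow> nat" and q :: nat
  assumes fin: "finite X" and R: "R \<subseteq> X" and \<pi>: "\<pi> ` R \<subseteq> X" "inj_on \<pi> R"
    and rise: "\<And>r. r \<in> R \<Longrightarrow> \<pi> r = r \<or> b r < b (\<pi> r)"
    and card_R: "card X \<le> card R + q"
begin

definition "Fix = {r \<in> R. \<pi> r = r}"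

lemma finite_R: "finite R" and finite_Fix: "finite Fix"
  using R fin by (auto simp: Fix_def intro: finite_subset)

lemma card_ge_block: "card {x \<in> X. i \<le> b x} \<le> card {r \<in> R. i \<le> b r} + q"
proof -
  have "card {x \<in> X. i \<le> b x} + card {x \<in> X. \<not> i \<le> b x} = card X"
    using fin by (subst card_Un_disjoint[symmetric]) (auto intro: arg_cong[of _ _ card])
  moreover have "card {x \<in> R. i \<le> b x} + card {x \<in> R. \<not> i \<le> b x} = card R"
    using finite_R by (subst card_Un_disjoint[symmetric]) (auto intro: arg_cong[of _ _ card])
  moreover have "card {x \<in> R. \<not> i \<le> b x} \<le> card {x \<in> X. \<not> i \<le> b x}"
    using fin R by (intro card_mono) auto
  ultimately show ?thesis using card_R by linarith
qed

lemma movers_image: "\<pi> ` ({r \<in> R. i \<le> b r} - {r \<in> Fix. b r = i}) \<subseteq> {x \<in> X. i < b x}"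
  using \<pi>(1) rise by (force simp: Fix_def)

lemma card_movers: "card {r \<in> R. i \<le> b r} = card ({r \<in> R. i \<le> b r} - {r \<in> Fix. b r = i}) + card {r \<in> Fix. b r = i}"
  using finite_R finite_Fix
  by (subst card_Diff_subset) (auto simp: Fix_def intro!: le_add_diff_inverse2[symmetric] card_mono)

lemma card_movers_image:
  "card (\<pi> ` ({r \<in> R. i \<le> b r} - {r \<in> Fix. b r = i})) = card ({r \<in> R. i \<le> b r} - {r \<in> Fix. b r = i})"
  by (rule card_image) (use \<pi>(2) in \<open>auto intro: inj_on_subset\<close>)

lemma card_split_block: "card {x \<in> X. i \<le> b x} = card {x \<in> X. b x = i} + card {x \<in> X. i < b x}"
  using fin by (subst card_Un_disjoint[symmetric]) (auto intro: arg_cong[of _ _ card])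

text \<open>Take the elements of \<open>R\<close> in blocks from \<open>i\<close> on, without the
  fixed ones of block \<open>i\<close>: they are sent injectively into blocks after
  \<open>i\<close>, and \<open>R\<close> misses at most \<open>q\<close> elements
  altogether.\<close>

lemma card_block_le: "card {x \<in> X. b x = i} \<le> card {r \<in> Fix. b r = i} + q"
proof -
  have "card ({r \<in> R. i \<le> b r} - {r \<in> Fix. b r = i}) \<le> card {x \<in> X. i < b x}"
    using card_mono[OF _ movers_image[of i]] fin card_movers_image[of i] by simp
  thus ?thesis using card_ge_block[of i] card_movers[of i] card_split_block[of i] by linarith
qed

text \<open>In the case of equality all the estimates are sharp: the missing elements lie in blocks
  from \<open>i\<close> on, and every element after block \<open>i\<close> is a value of
  \<pi>.\<close>

lemma tight_block:
  assumes "card {x \<in> X. b x = i} = card {r \<in> Fix. b r = i} + q"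
  shows "{x \<in> X. b x < i} \<subseteq> R"
    and "\<pi> ` ({r \<in> R. i \<le> b r} - {r \<in> Fix. b r = i}) = {x \<in> X. i < b x}"
proof -
  have le: "card ({r \<in> R. i \<le> b r} - {r \<in> Fix. b r = i}) \<le> card {x \<in> X. i < b x}"
    using card_mono[OF _ movers_image[of i]] fin card_movers_image[of i] by simp
  hence eq: "card ({r \<in> R. i \<le> b r} - {r \<in> Fix. b r = i}) = card {x \<in> X. i < b x}"
    "card {r \<in> R. i \<le> b r} + q = card {x \<in> X. i \<le> b x}"
    using card_ge_block[of i] card_split_block[of i] card_movers[of i] assms(1) by linarith+
  show "\<pi> ` ({r \<in> R. i \<le> b r} - {r \<in> Fix. b r = i}) = {x \<in> X. i < b x}"
    by (rule card_subset_eq) (use fin movers_image[of i] card_movers_image[of i] eq in auto)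
  have 1: "card {x \<in> X. i \<le> b x} + card {x \<in> X. b x < i} = card X"
    using fin by (subst card_Un_disjoint[symmetric]) (auto intro: arg_cong[of _ _ card])
  have 2: "card {x \<in> R. i \<le> b x} + card {x \<in> R. b x < i} = card R"
    using finite_R by (subst card_Un_disjoint[symmetric]) (auto intro: arg_cong[of _ _ card])
  have 3: "card {x \<in> R. b x < i} \<le> card {x \<in> X. b x < i}"
    using fin R by (intro card_mono) auto
  have 4: "card {x \<in> R. b x < i} = card {x \<in> X. b x < i}"
    using 1 2 3 eq card_R card_split_block[of i] assms(1) by linarith
  have "{x \<in> R. b x < i} = {x \<in> X. b x < i}"
    by (rule card_subset_eq) (use fin R 4 in auto)
  thus "{x \<in> X. b x < i} \<subseteq> R" by auto
qed

lemma card_Fix: "card Fix = (\<Sum>i\<in>b ` X. card {r \<in> Fix. b r = i})"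
proof -
  have "b ` Fix \<subseteq> b ` X" using R by (auto simp: Fix_def)
  from sum.group[OF finite_Fix finite_imageI[OF fin] this, of "\<lambda>_. 1::nat"]
  show ?thesis by simp
qed

end

text \<open>Each block is numbered from 0 without gaps, so the elements with \<open>lvl\<close> at
  least \<open>q\<close> are counted by the truncated differences of block size and
  \<open>q\<close>.\<close>

definition level_function :: "'a set \<Rightarrow> ('a \<Rightarrow> nat) \<Rightarrow> ('a \<Rightarrow> nat) \<Rightarrow> bool" where
  "level_function X b lvl \<longleftrightarrow> (\<forall>i. bij_betw lvl {x \<in> X. b x = i} {..<card {x \<in> X. b x = i}})"

lemma level_function_card_block:
  assumes "level_function X b lvl"
  shows "card {x \<in> X. b x = i \<and> q \<le> lvl x} = card {x \<in> X. b x = i} - q"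
proof -
  let ?n = "card {x \<in> X. b x = i}"
  have bij: "bij_betw lvl {x \<in> X. b x = i} {..<?n}"
    using assms by (auto simp: level_function_def)
  have "lvl ` {x \<in> X. b x = i \<and> q \<le> lvl x} = {q..<?n}"
  proof -
    have "lvl ` {x \<in> X. b x = i \<and> q \<le> lvl x} = lvl ` {x \<in> X. b x = i} \<inter> {q..}" by auto
    thus ?thesis using bij by (auto simp: bij_betw_def)
  qed
  moreover have "inj_on lvl {x \<in> X. b x = i \<and> q \<le> lvl x}"
    using bij unfolding bij_betw_def by (elim conjE inj_on_subset) auto
  ultimately show ?thesis using card_image by fastforce
qed

lemma card_level_ge:
  assumes "level_function X b lvl" "finite X"
  shows "card {x \<in> X. q \<le> lvl x} = (\<Sum>i\<in>b ` X. card {x \<in> X. b x = i} - q)"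
proof -
  have "b ` {x \<in> X. q \<le> lvl x} \<subseteq> b ` X" by auto
  moreover have "finite {x \<in> X. q \<le> lvl x}" using assms by auto
  ultimately have "card {x \<in> X. q \<le> lvl x} = (\<Sum>i\<in>b ` X. card {x \<in> {x \<in> X. q \<le> lvl x}. b x = i})"
    using sum.group[of "{x \<in> X. q \<le> lvl x}" "b ` X" b "\<lambda>_. 1::nat"] assms by simp
  also have "\<dots> = (\<Sum>i\<in>b ` X. card {x \<in> X. b x = i \<and> q \<le> lvl x})"
    by (intro sum.cong refl arg_cong[of _ _ card]) auto
  finally show ?thesis by (simp add: level_function_card_block[OF assms(1)])
qed

context rising_injection
begin

lemma card_level_le_Fix:
  assumes "level_function X b lvl"
  shows "card {x \<in> X. q \<le> lvl x} \<le> card Fix"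
  unfolding card_level_ge[OF assms fin] card_Fix
  by (rule sum_mono) (use card_block_le in \<open>simp add: le_diff_conv\<close>)

text \<open>The total bound is a sum of bounds for the single blocks, so equality in total forces
  equality in each. This is how minimal order gives control over the individual terms of a
  minor.\<close>

lemma card_Fix_block_eq:
  assumes "level_function X b lvl" "card Fix = card {x \<in> X. q \<le> lvl x}"
  shows "card {r \<in> Fix. b r = i} = card {x \<in> X. b x = i} - q"
proof (cases "i \<in> b ` X")
  case True
  have "(\<Sum>i\<in>b ` X. card {x \<in> X. b x = i} - q) = (\<Sum>i\<in>b ` X. card {r \<in> Fix. b r = i})"
    using assms(2) by (simp add: card_level_ge[OF assms(1) fin] card_Fix)
  from sum_mono_inv[OF this _ True] show ?thesis
    using card_block_le fin by (simp add: le_diff_conv)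
next
  case False
  hence "{r \<in> Fix. b r = i} = {}" "{x \<in> X. b x = i} = {}"
    using R by (auto simp: Fix_def)
  thus ?thesis by (simp only: card.empty diff_0_eq_0)
qed

end

subsection \<open>Orders of minors\<close>

text \<open>Every permutation other than the identity has an index at which the weight does not increase.\<close>

lemma det_acyclic:
  fixes w :: "nat \<Rightarrow> nat" and h :: "nat \<times> nat \<Rightarrow> 'a::comm_ring_1"
  assumes "\<And>i j. i < n \<Longrightarrow> j < n \<Longrightarrow> i \<noteq> j \<Longrightarrow> h (i, j) \<noteq> 0 \<Longrightarrow> w i < w j"
  shows "det (mat n n h) = (\<Prod>i<n. h (i, i))"
proof -
  have "(\<Prod>i = 0..<n. h (i, p i)) = 0" if p: "p permutes {0..<n}" "p \<noteq> id" for p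
  proof (rule ccontr)
    assume "(\<Prod>i = 0..<n. h (i, p i)) \<noteq> 0"
    hence nz: "h (i, p i) \<noteq> 0" if "i < n" for i
      using that by (metis atLeast0LessThan finite_lessThan lessThan_iff prod_zero)
    have le: "w i \<le> w (p i)" if "i \<in> {0..<n}" for i
      using assms[of i "p i"] nz[of i] that permutes_in_image[OF p(1), of i] by (cases "p i = i") auto
    have sum_eq: "(\<Sum>i\<in>{0..<n}. w i) = (\<Sum>i\<in>{0..<n}. w (p i))"
      using sum.permute[OF p(1), of w] by (simp add: o_def)
    hence eq: "w i = w (p i)" if "i \<in> {0..<n}" for i
      using le by (intro sum_mono_inv[OF sum_eq _ that]) auto
    have "p i = i" for i
    proof (cases "i < n")
      case True
      show ?thesis
      proof (rule ccontr)
        assume "p i \<noteq> i"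
        hence "w i < w (p i)"
          using assms[of i "p i"] nz[OF True] True permutes_in_image[OF p(1), of i] by auto
        thus False using eq[of i] True by simp
      qed
    next
      case False
      thus ?thesis using p(1) by (simp add: permutes_def)
    qed
    thus False using p(2) by auto
  qed
  hence "det (mat n n h) = (\<Sum>p\<in>{id}. signof p * (\<Prod>i = 0..<n. h (i, p i)))"
    unfolding det_mat by (intro sum.mono_neutral_right) (auto simp: permutes_id finite_permutations)
  thus ?thesis by (simp add: sign_id lessThan_atLeast0)
qed

text \<open>A nonzero entry of \<open>t + A\<close> is either diagonal or raises \<open>b\<close>.
  Hence a nonzero term of a minor traces a partial injection as counted above, and each of its fixed
  points contributes a factor \<open>t\<close>.\<close>

lemma pencil_minor_term:
  fixes a :: "nat \<Rightarrow> nat \<Rightarrow> 'a::comm_ring_1"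
  assumes inc: "\<And>r c. r < k \<Longrightarrow> c < k \<Longrightarrow> a r c \<noteq> 0 \<Longrightarrow> b r < (b c :: nat)"
    and fg: "\<And>i. i < n \<Longrightarrow> f i < k" "\<And>i. i < n \<Longrightarrow> g i < k" "inj_on f {..<n}" "inj_on g {..<n}"
    and n: "k = n + q"
    and p: "p permutes {0..<n}" and nz: "(\<Prod>i = 0..<n. pencil a (f i) (g (p i))) \<noteq> 0"
  defines "\<pi> \<equiv> \<lambda>r. g (p (the_inv_into {..<n} f r))"
  shows "rising_injection {..<k} (f ` {..<n}) \<pi> b q"
    and "\<And>i. i < n \<Longrightarrow> \<pi> (f i) = g (p i)"
    and "monom 1 (card {r \<in> f ` {..<n}. \<pi> r = r}) dvd (\<Prod>i = 0..<n. pencil a (f i) (g (p i)))"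
proof -
  have pn: "p i < n" if "i < n" for i using permutes_in_image[OF p, of i] that by auto
  show \<pi>f: "\<pi> (f i) = g (p i)" if "i < n" for i
    using that fg(3) by (simp add: \<pi>_def the_inv_into_f_f)
  have nz': "pencil a (f i) (g (p i)) \<noteq> 0" if "i < n" for i
    using nz that by (metis atLeast0LessThan finite_lessThan lessThan_iff prod_zero)
  show "rising_injection {..<k} (f ` {..<n}) \<pi> b q"
  proof
    show "\<pi> ` f ` {..<n} \<subseteq> {..<k}" using \<pi>f pn fg by auto
    show "inj_on \<pi> (f ` {..<n})"
    proof (rule inj_onI)
      fix x y assume "x \<in> f ` {..<n}" "y \<in> f ` {..<n}" "\<pi> x = \<pi> y"
      then obtain i j where ij: "x = f i" "y = f j" "i < n" "j < n" "g (p i) = g (p j)"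
        using \<pi>f by auto
      hence "p i = p j" using pn fg(4) by (auto dest: inj_onD)
      thus "x = y" using permutes_inj[OF p] ij by (auto dest: injD)
    qed
    fix r assume "r \<in> f ` {..<n}"
    then obtain i where i: "r = f i" "i < n" by auto
    show "\<pi> r = r \<or> b r < b (\<pi> r)"
      using nz'[OF i(2)] inc[of "f i" "g (p i)"] fg i pn[OF i(2)] \<pi>f[OF i(2)]
      by (auto simp: pencil_def split: if_splits)
  next
    show "card {..<k} \<le> card (f ` {..<n}) + q" using n fg(3) by (simp add: card_image)
  qed (use fg in auto)
  let ?S = "{i. i < n \<and> \<pi> (f i) = f i}"
  have "{r \<in> f ` {..<n}. \<pi> r = r} = f ` ?S" by auto
  moreover have "inj_on f ?S" using fg(3) by (auto simp: inj_on_def)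
  ultimately have "card {r \<in> f ` {..<n}. \<pi> r = r} = card ?S" by (simp add: card_image)
  also have "monom (1::'a) (card ?S) = (\<Prod>i\<in>?S. monom 1 1)"
    by (simp add: monom_power)
  also have "\<dots> dvd (\<Prod>i\<in>?S. pencil a (f i) (g (p i)))"
  proof (rule prod_dvd_prod)
    fix i assume i: "i \<in> ?S"
    hence "g (p i) = f i" using \<pi>f[of i] by auto
    moreover from this have "a (f i) (f i) = 0"
      using inc[of "f i" "f i"] fg i by auto
    ultimately show "monom 1 1 dvd pencil a (f i) (g (p i))"
      by (simp add: pencil_def monom_Suc monom_0)
  qed
  also have "\<dots> dvd (\<Prod>i = 0..<n. pencil a (f i) (g (p i)))"
    by (rule prod_dvd_prod_subset) auto
  finally show "monom 1 (card {r \<in> f ` {..<n}. \<pi> r = r}) dvd (\<Prod>i = 0..<n. pencil a (f i) (g (p i)))" .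
qed

lemma pencil_minor_not_inj:
  assumes "\<not> (inj_on f {..<n} \<and> inj_on g {..<n})"
  shows "pencil_minor a n f g = 0"
proof -
  let ?M = "mat n n (\<lambda>(i, j). pencil a (f i) (g j))"
  from assms consider i j where "i < n" "j < n" "i \<noteq> j" "f i = f j"
    | i j where "i < n" "j < n" "i \<noteq> j" "g i = g j"
    by (auto simp: inj_on_def)
  thus ?thesis
  proof cases
    case 1
    hence "row ?M i = row ?M j" by (intro eq_vecI) auto
    with 1 show ?thesis unfolding pencil_minor_def
      by (intro det_identical_rows[of _ n i j]) auto
  next
    case 2
    hence "col ?M i = col ?M j" by (intro eq_vecI) auto
    hence "row (transpose_mat ?M) i = row (transpose_mat ?M) j" using 2 by simp
    with 2 have "det (transpose_mat ?M) = 0"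
      by (intro det_identical_rows[of _ n i j]) auto
    thus ?thesis unfolding pencil_minor_def by (subst (asm) det_transpose[of _ n]) auto
  qed
qed

lemma monom_le_dvd: "i \<le> j \<Longrightarrow> monom (1::'a::comm_ring_1) i dvd monom 1 j"
  by (metis dvd_triv_left le_add_diff_inverse mult_monom mult_1)

lemma pencil_minor_dvd:
  fixes a :: "nat \<Rightarrow> nat \<Rightarrow> 'a::comm_ring_1"
  assumes inc: "\<And>r c. r < k \<Longrightarrow> c < k \<Longrightarrow> a r c \<noteq> 0 \<Longrightarrow> b r < (b c :: nat)"
    and fg: "\<And>i. i < n \<Longrightarrow> f i < k" "\<And>i. i < n \<Longrightarrow> g i < k"
    and n: "k = n + q" and lvl: "level_function {..<k} b lvl"
  shows "monom 1 (card {x \<in> {..<k}. q \<le> lvl x}) dvd pencil_minor a n f g"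
proof (cases "inj_on f {..<n} \<and> inj_on g {..<n}")
  case True
  show ?thesis unfolding pencil_minor_def det_mat
  proof (intro dvd_sum dvd_mult)
    fix p assume "p \<in> {p. p permutes {0..<n}}"
    hence p: "p permutes {0..<n}" by simp
    show "monom 1 (card {x \<in> {..<k}. q \<le> lvl x}) dvd (\<Prod>i = 0..<n. case (i, p i) of (i, j) \<Rightarrow> pencil a (f i) (g j))"
    proof (cases "(\<Prod>i = 0..<n. pencil a (f i) (g (p i))) = 0")
      case False
      define \<pi> where "\<pi> = (\<lambda>r. g (p (the_inv_into {..<n} f r)))"
      interpret rising_injection "{..<k}" "f ` {..<n}" \<pi> b q
        unfolding \<pi>_def by (rule pencil_minor_term) (use inc fg n p False True in auto)
      have "monom 1 (card Fix) dvd (\<Prod>i = 0..<n. pencil a (f i) (g (p i)))"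
        unfolding Fix_def unfolding \<pi>_def
        by (rule pencil_minor_term(3)) (use inc fg n p False True in auto)
      thus ?thesis using monom_le_dvd[OF card_level_le_Fix[OF lvl]] dvd_trans by auto
    qed simp
  qed
next
  case False
  show ?thesis unfolding pencil_minor_not_inj[OF False] by (rule dvd_0_right)
qed

text \<open>Sharpness of the order, for a matrix that joins every index outside \<open>L\<close> to
  its successor of the same level. The minor leaves out the rows in \<open>L\<close> of level below
  \<open>q\<close>. Rows of level below \<open>q\<close> are paired with the column of their
  successor, which contributes 1; the others are paired with their own column, which contributes
  \<open>t\<close>.\<close>

lemma pencil_minor_tracks:
  fixes k q :: nat and b lvl nxt :: "nat \<Rightarrow> nat" and L :: "nat set"
  assumes nxt: "\<And>x. x < k \<Longrightarrow> x \<notin> L \<Longrightarrow> nxt x < k \<and> lvl (nxt x) = lvl x \<and> b x < b (nxt x)"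
    and inj: "inj_on nxt ({..<k} - L)"
    and a: "\<And>r c. r < k \<Longrightarrow> c < k \<Longrightarrow> a r c = (if r \<notin> L \<and> c = nxt r then 1 else (0::'a::comm_ring_1))"
    and L: "card {x \<in> L. x < k \<and> lvl x < q} = q"
  shows "\<exists>f g. (\<forall>i<k - q. f i < k) \<and> (\<forall>i<k - q. g i < k) \<and>
    pencil_minor a (k - q) f g = monom 1 (card {x \<in> {..<k}. q \<le> lvl x})"
proof -
  define R where "R = {..<k} - {x \<in> L. x < k \<and> lvl x < q}"
  have "card R = k - q"
    unfolding R_def by (subst card_Diff_subset) (auto simp: L intro: finite_subset[of _ "{..<k}"])
  moreover have "finite R" by (simp add: R_def)
  ultimately obtain f where f: "bij_betw f {..<k - q} R"
    using ex_bij_betw_nat_finite[of R] by (auto simp: lessThan_atLeast0)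
  define \<pi> where "\<pi> x = (if q \<le> lvl x then x else nxt x)" for x
  define K where "K = (\<Sum>x<k. b x)"
  have bK: "b x \<le> K" if "x < k" for x
    unfolding K_def using that by (intro member_le_sum) auto
  \<comment> \<open>From level \<open>q\<close> on, an off-diagonal entry of the minor is an entry
    of the matrix and goes up in \<open>b\<close>. Below level \<open>q\<close> it is the
    \<open>t\<close> at \<open>r = nxt r'\<close> and goes down in \<open>b\<close>. Reversing
    \<open>b\<close> on the lower levels makes the weight increase in both cases.\<close>
  define w where "w x = (if lvl x < q then K - b x else b x)" for x
  have fR: "f i \<in> R" if "i < k - q" for i using f that by (auto simp: bij_betw_def)
  have fk: "f i < k" if "i < k - q" for i using fR[OF that] by (auto simp: R_def)
  have R\<pi>: "lvl (\<pi> r) = lvl r" "\<pi> r < k" if "r \<in> R" for r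
    using that nxt[of r] by (auto simp: \<pi>_def R_def)
  have "pencil_minor a (k - q) f (\<pi> \<circ> f) = (\<Prod>i<k - q. pencil a (f i) (\<pi> (f i)))"
    unfolding pencil_minor_def
  proof (subst det_acyclic[where w = "w \<circ> f"])
    fix i j assume ij: "i < k - q" "j < k - q" "i \<noteq> j"
      "(case (i, j) of (i, j) \<Rightarrow> pencil a (f i) ((\<pi> \<circ> f) j)) \<noteq> 0"
    define r r' where "r = f i" and "r' = f j"
    have rr: "r \<in> R" "r' \<in> R" "r < k" "r' < k" using fR fk ij by (auto simp: r_def r'_def)
    have ne: "r \<noteq> r'" using f ij by (auto simp: r_def r'_def bij_betw_def dest: inj_onD)
    have "r = \<pi> r' \<or> a r (\<pi> r') \<noteq> 0"
      using ij(4) by (auto simp: pencil_def r_def r'_def split: if_splits)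
    hence *: "r = \<pi> r' \<or> r \<notin> L \<and> \<pi> r' = nxt r"
      using a[of r "\<pi> r'"] rr R\<pi> by (auto split: if_splits)
    hence lvl: "lvl r = lvl r'" using R\<pi>[OF rr(2)] nxt[of r] rr by auto
    have "w r < w r'"
    proof (cases "q \<le> lvl r'")
      case True
      with * ne lvl nxt[of r] rr show ?thesis by (auto simp: \<pi>_def w_def)
    next
      case False
      hence r'L: "r' \<notin> L" using rr by (auto simp: R_def)
      from False * have "r = nxt r' \<or> r \<notin> L \<and> nxt r' = nxt r" by (simp add: \<pi>_def)
      moreover have "\<not> (r \<notin> L \<and> nxt r' = nxt r)"
        using inj_onD[OF inj, of r' r] r'L rr ne by auto
      ultimately have "r = nxt r'" by blast
      thus ?thesis using nxt[of r'] r'L rr False lvl bK[of r] by (auto simp: w_def)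
    qed
    thus "(w \<circ> f) i < (w \<circ> f) j" by (simp add: r_def r'_def)
  qed simp
  also have "\<dots> = (\<Prod>r\<in>R. pencil a r (\<pi> r))"
    by (rule prod.reindex_bij_betw[OF f])
  also have "\<dots> = (\<Prod>r\<in>R. if q \<le> lvl r then monom 1 1 else 1)"
  proof (intro prod.cong refl)
    fix r assume r: "r \<in> R"
    show "pencil a r (\<pi> r) = (if q \<le> lvl r then monom 1 1 else 1)"
      using r nxt[of r] a[of r "\<pi> r"] a[of r r] by (auto simp: pencil_def \<pi>_def R_def monom_Suc monom_0)
  qed
  also have "\<dots> = monom 1 1 ^ card {r \<in> R. q \<le> lvl r}"
    using \<open>finite R\<close> by (simp add: prod.If_cases Int_def Collect_conj_eq[symmetric])
  also have "{r \<in> R. q \<le> lvl r} = {x \<in> {..<k}. q \<le> lvl x}"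
    by (auto simp: R_def)
  finally have "pencil_minor a (k - q) f (\<pi> \<circ> f) = monom 1 (card {x \<in> {..<k}. q \<le> lvl x})"
    by (simp add: monom_power o_def)
  moreover have "\<forall>i<k - q. (\<pi> \<circ> f) i < k" using fR R\<pi> by auto
  ultimately show ?thesis using fk by blast
qed

subsection \<open>Nilpotent Jordan matrices\<close>

text \<open>For a Jordan matrix \<open>pos_of\<close> is the quantity that rises along the nonzero
  entries, while \<open>block_of\<close> serves as the level. Both count from 0.\<close>

fun block_of :: "nat list \<Rightarrow> nat \<Rightarrow> nat" where
  "block_of [] x = 0"
| "block_of (l # ls) x = (if x < l then 0 else Suc (block_of ls (x - l)))"

fun pos_of :: "nat list \<Rightarrow> nat \<Rightarrow> nat" where
  "pos_of [] x = 0"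
| "pos_of (l # ls) x = (if x < l then x else pos_of ls (x - l))"

lemma block_pos_bij:
  "bij_betw (\<lambda>x. (block_of \<mu> x, pos_of \<mu> x)) {..<sum_list \<mu>} {(r, i). r < length \<mu> \<and> i < \<mu> ! r}"
proof (induction \<mu>)
  case (Cons l \<mu>)
  let ?h = "\<lambda>\<mu> x. (block_of \<mu> x, pos_of \<mu> x)"
  have 1: "bij_betw (?h (l # \<mu>)) {..<l} ({0} \<times> {..<l})"
    by (rule bij_betwI[where g = snd]) auto
  have 2: "bij_betw (?h (l # \<mu>)) {l..<l + sum_list \<mu>} ((\<lambda>(r, i). (Suc r, i)) ` {(r, i). r < length \<mu> \<and> i < \<mu> ! r})"
  proof -
    have "bij_betw (\<lambda>x. x - l) {l..<l + sum_list \<mu>} {..<sum_list \<mu>}"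
      by (rule bij_betwI[where g = "\<lambda>x. x + l"]) auto
    from bij_betw_trans[OF bij_betw_trans[OF this Cons.IH] bij_betw_imageI[of "\<lambda>(r, i). (Suc r, i)" _ "(\<lambda>(r, i). (Suc r, i)) ` {(r, i). r < length \<mu> \<and> i < \<mu> ! r}"]]
    have "bij_betw ((\<lambda>(r, i). (Suc r, i)) \<circ> (?h \<mu> \<circ> (\<lambda>x. x - l))) {l..<l + sum_list \<mu>}
        ((\<lambda>(r, i). (Suc r, i)) ` {(r, i). r < length \<mu> \<and> i < \<mu> ! r})"
      by (auto simp: inj_on_def)
    thus ?thesis by (rule bij_betw_cong[THEN iffD1, rotated]) auto
  qed
  have "bij_betw (?h (l # \<mu>)) ({..<l} \<union> {l..<l + sum_list \<mu>})
      ({0} \<times> {..<l} \<union> (\<lambda>(r, i). (Suc r, i)) ` {(r, i). r < length \<mu> \<and> i < \<mu> ! r})"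
    by (rule bij_betw_combine[OF 1 2]) auto
  moreover have "{..<l} \<union> {l..<l + sum_list \<mu>} = {..<sum_list (l # \<mu>)}" by auto
  moreover have "{0} \<times> {..<l} \<union> (\<lambda>(r, i). (Suc r, i)) ` {(r, i). r < length \<mu> \<and> i < \<mu> ! r} =
      {(r, i). r < length (l # \<mu>) \<and> i < (l # \<mu>) ! r}"
    by (auto simp: image_iff nth_Cons split: nat.splits)
  ultimately show ?case by metis
qed (auto simp: bij_betw_def)

lemma pos_of_Suc: "block_of \<mu> (Suc x) = block_of \<mu> x \<Longrightarrow> Suc x < sum_list \<mu> \<Longrightarrow> pos_of \<mu> (Suc x) = Suc (pos_of \<mu> x)"
proof (induction \<mu> arbitrary: x)
  case (Cons l \<mu>)
  show ?case
  proof (cases "Suc x < l")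
    case False
    with Cons.prems have "\<not> x < l" by (auto split: if_splits)
    with Cons.prems Cons.IH[of "x - l"] show ?thesis by (auto simp: Suc_diff_le)
  qed auto
qed auto

lemma jordan_matrix_entry:
  "r < sum_list \<mu> \<Longrightarrow> c < sum_list \<mu> \<Longrightarrow> jordan_matrix (map (\<lambda>l. (l, 0::'a::comm_ring_1)) \<mu>) $$ (r, c) =
    (if c = Suc r \<and> block_of \<mu> (Suc r) = block_of \<mu> r then 1 else 0)"
proof (induction \<mu> arbitrary: r c)
  case (Cons l \<mu>)
  have s: "sum_list (map fst (map (\<lambda>l. (l, 0::'a)) \<mu>)) = sum_list \<mu>"
    by (simp add: o_def)
  show ?case
    using Cons.prems Cons.IH[of "r - l" "c - l"]
    by (auto simp: jordan_matrix_Cons s Suc_diff_le o_def)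
qed auto

lemma last_in_block:
  assumes "r < length \<mu>" "0 \<notin> set \<mu>" "x < sum_list \<mu>" "block_of \<mu> x = r"
  shows "\<not> (Suc x < sum_list \<mu> \<and> block_of \<mu> (Suc x) = block_of \<mu> x) \<longleftrightarrow> Suc (pos_of \<mu> x) = \<mu> ! r"
proof
  let ?h = "\<lambda>x. (block_of \<mu> x, pos_of \<mu> x)"
  note bij = block_pos_bij[of \<mu>]
  have x: "pos_of \<mu> x < \<mu> ! r"
    using bij_betwE[OF bij] assms by auto
  show "Suc (pos_of \<mu> x) = \<mu> ! r" if "\<not> (Suc x < sum_list \<mu> \<and> block_of \<mu> (Suc x) = block_of \<mu> x)"
    using that assms
  proof (induction \<mu> arbitrary: x r)
    case (Cons l \<mu>)
    show ?case
    proof (cases "x < l")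
      case True
      with Cons.prems have "Suc x = l" by (auto split: if_splits)
      thus ?thesis using Cons.prems True by auto
    next
      case False
      hence "\<not> (Suc (x - l) < sum_list \<mu> \<and> block_of \<mu> (Suc (x - l)) = block_of \<mu> (x - l))"
        using Cons.prems by (auto simp: Suc_diff_le)
      hence "Suc (pos_of \<mu> (x - l)) = \<mu> ! (r - 1)"
        by (rule Cons.IH) (use Cons.prems False in auto)
      thus ?thesis using Cons.prems False by auto
    qed
  qed auto
  show "\<not> (Suc x < sum_list \<mu> \<and> block_of \<mu> (Suc x) = block_of \<mu> x)" if "Suc (pos_of \<mu> x) = \<mu> ! r"
  proof
    assume *: "Suc x < sum_list \<mu> \<and> block_of \<mu> (Suc x) = block_of \<mu> x"
    hence "pos_of \<mu> (Suc x) = \<mu> ! r" using pos_of_Suc[of \<mu> x] that by simp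
    moreover have "pos_of \<mu> (Suc x) < \<mu> ! block_of \<mu> (Suc x)"
      using bspec[OF bij_betwE[OF bij], of "Suc x"] * by auto
    ultimately show False using * assms by simp
  qed
qed

lemma similar_mat_wit_carrier:
  assumes "similar_mat_wit A B P Q" "A \<in> carrier_mat k k"
  shows "B \<in> carrier_mat k k"
proof -
  have "k = dim_row A" using assms(2) by auto
  from similar_mat_witD[OF this assms(1)] show ?thesis by blast
qed

context
  fixes \<mu> :: "nat list"
  assumes sorted: "sorted_wrt (\<ge>) \<mu>" and pos: "0 \<notin> set \<mu>"
begin

text \<open>Position \<open>i\<close> occurs exactly in the Jordan blocks longer than
  \<open>i\<close>, and these come first because \<mu> is weakly decreasing.\<close>

lemma jordan_level_function: "level_function {..<sum_list \<mu>} (pos_of \<mu>) (block_of \<mu>)"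
  unfolding level_function_def
proof
  fix i
  let ?X = "{x \<in> {..<sum_list \<mu>}. pos_of \<mu> x = i}"
  note bij = block_pos_bij[of \<mu>]
  have image: "block_of \<mu> ` ?X = {r. r < length \<mu> \<and> i < \<mu> ! r}"
  proof (intro subset_antisym subsetI)
    fix r assume "r \<in> {r. r < length \<mu> \<and> i < \<mu> ! r}"
    hence "(r, i) \<in> (\<lambda>x. (block_of \<mu> x, pos_of \<mu> x)) ` {..<sum_list \<mu>}"
      using bij by (auto simp: bij_betw_def)
    thus "r \<in> block_of \<mu> ` ?X" by auto
  qed (use bij_betwE[OF bij] in auto)
  have "\<exists>n. {r. r < length \<mu> \<and> i < \<mu> ! r} = {..<n}"
  proof -
    define n where "n = (LEAST n. n \<ge> length \<mu> \<or> \<mu> ! n \<le> i)"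
    have n: "n \<ge> length \<mu> \<or> \<mu> ! n \<le> i"
      unfolding n_def by (rule LeastI[of _ "length \<mu>"]) simp
    have less: "r < length \<mu> \<and> i < \<mu> ! r" if "r < n" for r
      using not_less_Least[of r "\<lambda>n. n \<ge> length \<mu> \<or> \<mu> ! n \<le> i"] that by (auto simp: n_def)
    have "r < n" if "r < length \<mu>" "i < \<mu> ! r" for r
    proof (rule ccontr)
      assume "\<not> r < n"
      hence "\<mu> ! r \<le> \<mu> ! n"
        using sorted_wrt_nth_less[OF sorted, of n r] that by (cases "n = r") auto
      with n that \<open>\<not> r < n\<close> show False by auto
    qed
    with less show ?thesis by (intro exI[of _ n]) auto
  qed
  then obtain n where n: "block_of \<mu> ` ?X = {..<n}" unfolding image ..
  have inj: "inj_on (block_of \<mu>) ?X"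
    using bij by (auto simp: bij_betw_def inj_on_def)
  have "card ?X = n" using card_image[OF inj] unfolding n by simp
  thus "bij_betw (block_of \<mu>) ?X {..<card ?X}"
    using inj n by (simp add: bij_betw_def)
qed

lemma card_block_of_ge: "card {x \<in> {..<sum_list \<mu>}. q \<le> block_of \<mu> x} = sum_list (drop q \<mu>)"
proof -
  let ?h = "\<lambda>x. (block_of \<mu> x, pos_of \<mu> x)"
  have bij: "bij_betw ?h {..<sum_list \<mu>} (SIGMA r:{..<length \<mu>}. {..<\<mu> ! r})"
  proof -
    have "{(r, i). r < length \<mu> \<and> i < \<mu> ! r} = (SIGMA r:{..<length \<mu>}. {..<\<mu> ! r})" by auto
    thus ?thesis using block_pos_bij[of \<mu>] by simp
  qed
  have "?h ` {x \<in> {..<sum_list \<mu>}. q \<le> block_of \<mu> x} = (SIGMA r:{q..<length \<mu>}. {..<\<mu> ! r})"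
  proof -
    have "?h ` {x \<in> {..<sum_list \<mu>}. q \<le> block_of \<mu> x} = ?h ` {..<sum_list \<mu>} \<inter> {(r, i). q \<le> r}" by auto
    thus ?thesis using bij by (auto simp: bij_betw_def)
  qed
  moreover have inj: "inj_on ?h {x \<in> {..<sum_list \<mu>}. q \<le> block_of \<mu> x}"
    using bij unfolding bij_betw_def by (blast intro: inj_on_subset)
  ultimately have "card {x \<in> {..<sum_list \<mu>}. q \<le> block_of \<mu> x} = (\<Sum>r\<in>{q..<length \<mu>}. \<mu> ! r)"
    using card_image[OF inj] by simp
  also have "\<dots> = (\<Sum>r\<in>{0..<length \<mu> - q}. \<mu> ! (q + r))"
    by (rule sum.reindex_bij_witness[of _ "\<lambda>r. q + r" "\<lambda>r. r - q"]) auto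
  also have "\<dots> = sum_list (drop q \<mu>)"
    by (simp add: sum_list_sum_nth)
  finally show ?thesis .
qed

lemma jordan_last_card:
  assumes "q \<le> length \<mu>"
  shows "card {x \<in> {x. \<not> (Suc x < sum_list \<mu> \<and> block_of \<mu> (Suc x) = block_of \<mu> x)}. x < sum_list \<mu> \<and> block_of \<mu> x < q} = q"
    (is "card ?S = q")
proof -
  let ?h = "\<lambda>x. (block_of \<mu> x, pos_of \<mu> x)"
  note bij = block_pos_bij[of \<mu>]
  have "block_of \<mu> ` ?S = {..<q}"
  proof (intro subset_antisym subsetI)
    fix r assume r: "r \<in> {..<q}"
    hence "\<mu> ! r \<noteq> 0" using pos assms by (metis lessThan_iff nth_mem order_less_le_trans)
    hence "(r, \<mu> ! r - 1) \<in> ?h ` {..<sum_list \<mu>}"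
      using bij r assms by (auto simp: bij_betw_def)
    then obtain x where x: "x < sum_list \<mu>" "block_of \<mu> x = r" "pos_of \<mu> x = \<mu> ! r - 1" by auto
    hence "x \<in> ?S" using last_in_block[of r \<mu> x] r assms pos \<open>\<mu> ! r \<noteq> 0\<close> by auto
    thus "r \<in> block_of \<mu> ` ?S" using x by blast
  qed auto
  moreover have inj: "inj_on (block_of \<mu>) ?S"
  proof (rule inj_onI)
    fix x y assume xy: "x \<in> ?S" "y \<in> ?S" "block_of \<mu> x = block_of \<mu> y"
    have lt: "block_of \<mu> x < length \<mu>" using bij_betwE[OF bij] xy by auto
    have "Suc (pos_of \<mu> x) = Suc (pos_of \<mu> y)"
      using last_in_block[OF lt pos, of x] last_in_block[OF lt pos, of y] xy by auto
    thus "x = y" using bij xy by (auto simp: bij_betw_def inj_on_def)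
  qed
  ultimately show ?thesis using card_image[OF inj] by simp
qed

text \<open>Similarity reduces this to the Jordan matrix, where the indices of level at least
  \<open>q\<close> are those outside the first \<open>q\<close> Jordan blocks.\<close>

lemma pencil_minor_jordan_type_dvd:
  assumes A: "nilpotent_jordan_type A \<mu>" "A \<in> carrier_mat k k"
    and fg: "\<And>i. i < n \<Longrightarrow> f i < k" "\<And>i. i < n \<Longrightarrow> g i < k" and n: "k = n + q"
  shows "monom 1 (sum_list (drop q \<mu>)) dvd pencil_minor (\<lambda>r c. A $$ (r, c)) n f g"
proof -
  let ?J = "jordan_matrix (map (\<lambda>l. (l, 0::complex)) \<mu>)"
  obtain P Q where PQ: "similar_mat_wit A ?J P Q"
    using A by (auto simp: nilpotent_jordan_type_def jordan_nf_def similar_mat_def)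
  have "?J \<in> carrier_mat k k" by (rule similar_mat_wit_carrier[OF PQ A(2)])
  hence k: "k = sum_list \<mu>" by (auto simp: o_def)
  show ?thesis
  proof (rule dvd_pencil_minors_similar[OF PQ A(2) _ fg])
    fix f g assume fg: "\<And>i. i < n \<Longrightarrow> f i < k" "\<And>i. i < n \<Longrightarrow> g i < k"
    have "monom 1 (card {x \<in> {..<k}. q \<le> block_of \<mu> x}) dvd pencil_minor (\<lambda>r c. ?J $$ (r, c)) n f g"
    proof (rule pencil_minor_dvd[where b = "pos_of \<mu>"])
      fix r c assume "r < k" "c < k" "?J $$ (r, c) \<noteq> 0"
      thus "pos_of \<mu> r < pos_of \<mu> c"
        by (auto simp: k jordan_matrix_entry pos_of_Suc split: if_splits)
    qed (use fg n k jordan_level_function in auto)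
    thus "monom 1 (sum_list (drop q \<mu>)) dvd pencil_minor (\<lambda>r c. ?J $$ (r, c)) n f g"
      by (simp only: k card_block_of_ge)
  qed auto
qed

text \<open>If all minors had larger order, similarity in the other direction would transfer this to
  the Jordan matrix, against the minor computed by \<open>pencil_minor_tracks\<close>.\<close>

lemma pencil_minor_jordan_type_coeff:
  assumes A: "nilpotent_jordan_type A \<mu>" "A \<in> carrier_mat k k" and q: "q \<le> length \<mu>"
  shows "\<exists>f g. (\<forall>i<k - q. f i < k) \<and> (\<forall>i<k - q. g i < k) \<and>
    coeff (pencil_minor (\<lambda>r c. A $$ (r, c)) (k - q) f g) (sum_list (drop q \<mu>)) \<noteq> 0"
proof (rule ccontr)
  let ?e = "sum_list (drop q \<mu>)" and ?n = "k - q"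
  assume neg: "\<not> ?thesis"
  let ?J = "jordan_matrix (map (\<lambda>l. (l, 0::complex)) \<mu>)"
  obtain P Q where PQ: "similar_mat_wit A ?J P Q"
    using A by (auto simp: nilpotent_jordan_type_def jordan_nf_def similar_mat_def)
  have J: "?J \<in> carrier_mat k k" by (rule similar_mat_wit_carrier[OF PQ A(2)])
  hence k: "k = sum_list \<mu>" by (auto simp: o_def)
  have "length \<mu> \<le> sum_list \<mu>" using pos
    by (induction \<mu>) (auto simp: Suc_le_eq intro: add_less_le_mono[of 0 _ "length _" "sum_list _", simplified])
  hence n: "k = ?n + q" using q k by auto
  have dvd: "monom 1 (Suc ?e) dvd pencil_minor (\<lambda>r c. A $$ (r, c)) ?n f g"
    if fg: "\<And>i. i < ?n \<Longrightarrow> f i < k" "\<And>i. i < ?n \<Longrightarrow> g i < k" for f g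
  proof -
    have "\<forall>m<?e. coeff (pencil_minor (\<lambda>r c. A $$ (r, c)) ?n f g) m = 0"
      using pencil_minor_jordan_type_dvd[OF A fg n] by (simp add: monom_1_dvd_iff')
    moreover have "coeff (pencil_minor (\<lambda>r c. A $$ (r, c)) ?n f g) ?e = 0"
      using neg fg by blast
    ultimately show ?thesis by (auto simp: monom_1_dvd_iff' less_Suc_eq)
  qed
  have "\<exists>f g. (\<forall>i<sum_list \<mu> - q. f i < sum_list \<mu>) \<and> (\<forall>i<sum_list \<mu> - q. g i < sum_list \<mu>) \<and>
    pencil_minor (\<lambda>r c. ?J $$ (r, c)) (sum_list \<mu> - q) f g = monom 1 (card {x \<in> {..<sum_list \<mu>}. q \<le> block_of \<mu> x})"
  proof (rule pencil_minor_tracks[where b = "pos_of \<mu>" and nxt = Suc and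
      L = "{x. \<not> (Suc x < sum_list \<mu> \<and> block_of \<mu> (Suc x) = block_of \<mu> x)}"])
    show "\<And>r c. r < sum_list \<mu> \<Longrightarrow> c < sum_list \<mu> \<Longrightarrow> ?J $$ (r, c) =
        (if r \<notin> {x. \<not> (Suc x < sum_list \<mu> \<and> block_of \<mu> (Suc x) = block_of \<mu> x)} \<and> c = Suc r then 1 else 0)"
      by (auto simp: jordan_matrix_entry)
  qed (use jordan_last_card[OF q] in \<open>auto simp: pos_of_Suc\<close>)
  then obtain f g where fg: "\<And>i. i < ?n \<Longrightarrow> f i < k" "\<And>i. i < ?n \<Longrightarrow> g i < k"
    and m: "pencil_minor (\<lambda>r c. ?J $$ (r, c)) ?n f g = monom 1 ?e"
    unfolding card_block_of_ge k by blast
  have "monom 1 (Suc ?e) dvd pencil_minor (\<lambda>r c. ?J $$ (r, c)) ?n f g"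
    by (rule dvd_pencil_minors_similar[OF similar_mat_wit_sym[OF PQ] J dvd fg])
  thus False unfolding m by (auto simp: monom_1_dvd_iff')
qed

end

subsection \<open>The polynomial of a pair of chains of equal length\<close>

lemma pencil_minor_hom:
  assumes "comm_ring_hom h"
  shows "pencil_minor (\<lambda>r c. h (a r c)) n f g = map_poly h (pencil_minor a n f g)"
proof -
  interpret h: comm_ring_hom h by fact
  interpret mh: map_poly_comm_ring_hom h ..
  have "map_mat (map_poly h) (mat n n (\<lambda>(i, j). pencil a (f i) (g j))) =
      mat n n (\<lambda>(i, j). pencil (\<lambda>r c. h (a r c)) (f i) (g j))"
    by (rule eq_matI) (auto simp: pencil_def h.map_poly_pCons_hom)
  thus ?thesis unfolding pencil_minor_def by (metis mh.hom_det)
qed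

definition level :: "(nat \<Rightarrow> nat) \<Rightarrow> nat \<Rightarrow> nat" where
  "level b x = card {y. y < x \<and> b y = b x}"

lemma bij_betw_rank:
  fixes S :: "nat set"
  assumes S: "finite S"
  shows "bij_betw (\<lambda>x. card {y \<in> S. y < x}) S {..<card S}"
proof -
  let ?h = "\<lambda>x. card {y \<in> S. y < x}"
  have less: "?h x < ?h y" if "x \<in> S" "y \<in> S" "x < y" for x y
    by (rule psubset_card_mono) (use S that in auto)
  have inj: "inj_on ?h S"
  proof (rule inj_onI)
    fix x y assume "x \<in> S" "y \<in> S" "?h x = ?h y"
    thus "x = y" using less[of x y] less[of y x] by (cases x y rule: linorder_cases) auto
  qed
  have "?h ` S \<subseteq> {..<card S}"
    using S by (auto intro!: psubset_card_mono)
  hence "?h ` S = {..<card S}"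
    by (rule card_subset_eq[rotated]) (simp_all add: card_image[OF inj])
  thus ?thesis using inj by (simp add: bij_betw_def)
qed

text \<open>As the interval starts where a block starts, no earlier index shares a block with it,
  and levels counted among all indices agree with those counted inside.\<close>

lemma level_function_interval:
  assumes "\<And>y. y < off \<Longrightarrow> b y < (b off :: nat)" "\<And>x. off \<le> x \<Longrightarrow> x < k \<Longrightarrow> b off \<le> b x"
  shows "level_function {off..<k} b (level b)"
  unfolding level_function_def
proof
  fix i
  let ?S = "{x \<in> {off..<k}. b x = i}"
  have "bij_betw (\<lambda>x. card {y \<in> ?S. y < x}) ?S {..<card ?S}"
    by (rule bij_betw_rank) auto
  moreover have "card {y \<in> ?S. y < x} = level b x" if "x \<in> ?S" for x
  proof -
    have "off \<le> y" if "b y = b x" for y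
      using assms(1)[of y] assms(2)[of x] that \<open>x \<in> ?S\<close> by (cases "y < off") auto
    thus ?thesis unfolding level_def using that by (intro arg_cong[of _ _ card]) auto
  qed
  ultimately show "bij_betw (level b) ?S {..<card ?S}"
    by (rule bij_betw_cong[THEN iffD1, rotated])
qed

lemma prod_monom: "finite S \<Longrightarrow> (\<Prod>i\<in>S. monom (a i) (k i)) = monom (\<Prod>i\<in>S. a i) (\<Sum>i\<in>S. k i)"
  by (induction S rule: finite_induct) (auto simp: mult_monom monom_0)

lemma prod_mon: "finite S \<Longrightarrow> (\<Prod>i\<in>S. mon (a i) 1) = mon (\<Sum>i\<in>S. a i) 1"
  by (induction S rule: finite_induct) (auto simp: mult_single)

lemma lookup_of_int_mult: "Poly_Mapping.lookup (of_int z * p) k = of_int z * Poly_Mapping.lookup p k"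
  for p :: "'v mpoly"
proof -
  have "Poly_Mapping.lookup (of_nat n * p) k = of_nat n * Poly_Mapping.lookup p k" for n
    by (induction n) (auto simp: lookup_add algebra_simps)
  thus ?thesis by (cases z rule: int_cases2) auto
qed

lemma coeff_of_int_mult: "coeff (of_int z * p) k = of_int z * coeff p k"
  by (simp add: of_int_poly)

text \<open>The generic matrix among those whose nonzero entries raise \<open>b\<close>. Variables
  are numbered from 1, matrix indices from 0.\<close>

definition generic_entry :: "(nat \<Rightarrow> nat) \<Rightarrow> nat \<Rightarrow> nat \<Rightarrow> cpoly" where
  "generic_entry b r c = (if b r < b c then var (Suc r, Suc c) else 0)"

lemma meval_coeff_pencil_minor:
  "meval w (coeff (pencil_minor (generic_entry b) n f g) d) =
    coeff (pencil_minor (\<lambda>r c. if b r < b c then w (Suc r, Suc c) else 0) n f g) d"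
proof -
  have "(\<lambda>r c. meval w (generic_entry b r c)) = (\<lambda>r c. if b r < b c then w (Suc r, Suc c) else 0)"
    by (auto simp: fun_eq_iff generic_entry_def var_def mval_def)
  thus ?thesis
    using pencil_minor_hom[OF meval_hom.comm_ring_hom_axioms[of w], of "generic_entry b" n f g]
    by (simp add: coeff_map_poly)
qed

lemma entries_Suc: "entries A (Suc r, Suc c) = A $$ (r, c)"
  by (simp add: entries_def)

text \<open>The two chains of length \<open>I\<close> are \<open>{off..<off + I}\<close> and \<open>{N - I..<N}\<close>. The exponent \<open>e\<close> is the
  smallest one for which the coefficient is not identically zero.\<close>

locale chain_pair =
  fixes N off I :: nat and b :: "nat \<Rightarrow> nat"
  assumes mono: "\<And>x y. x \<le> y \<Longrightarrow> y < N \<Longrightarrow> b x \<le> b y"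
    and before: "\<And>x. x < off \<Longrightarrow> b x < b off"
    and size: "0 < I" "off + I < N"
    and first: "{x \<in> {off..<N}. b x = b off} = {off..<off + I}"
    and last: "{x \<in> {off..<N}. b x = b (N - 1)} = {N - I..<N}"
    and first_less_last: "b off < b (N - 1)"
    and middle: "\<And>i. b off < i \<Longrightarrow> i < b (N - 1) \<Longrightarrow> card {x \<in> {off..<N}. b x = i} \<noteq> I"
begin

definition "X = {off..<N}"
definition "Rows = {off..<N - I}"
definition "Cols = {off + I..<N}"
definition "e = card {x \<in> X. I \<le> level b x}"

abbreviation "gen \<equiv> generic_entry b"

definition F :: cpoly where
  "F = coeff (pencil_minor gen (N - off - I) (\<lambda>i. off + i) (\<lambda>i. off + I + i)) e"

text \<open>Following \<pi> through the moved elements from the first chain yields the disjoint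
  paths. The number of fixed points is the power of \<open>t\<close> in the term, so fixing it at
  \<open>e\<close> selects the coefficient \<open>F\<close>.\<close>

definition path_system :: "(nat \<Rightarrow> nat) \<Rightarrow> bool" where
  "path_system \<pi> \<longleftrightarrow> bij_betw \<pi> Rows Cols \<and> (\<forall>r\<in>Rows. \<pi> r = r \<or> b r < b (\<pi> r)) \<and>
    card {r \<in> Rows. \<pi> r = r} = e"

definition edge_monomial :: "((nat \<times> nat) \<Rightarrow>\<^sub>0 nat) \<Rightarrow> (nat \<Rightarrow> nat) \<Rightarrow> bool" where
  "edge_monomial m \<pi> \<longleftrightarrow> (\<forall>s t. Poly_Mapping.lookup m (s, t) =
    (if \<exists>r\<in>Rows. \<pi> r \<noteq> r \<and> s = Suc r \<and> t = Suc (\<pi> r) then 1 else 0))"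

lemma peval_F:
  "peval F A = coeff (pencil_minor (\<lambda>r c. if b r < b c then A $$ (r, c) else 0)
    (N - off - I) (\<lambda>i. off + i) (\<lambda>i. off + I + i)) e"
  unfolding F_def peval_meval meval_coeff_pencil_minor entries_Suc ..

abbreviation "m \<equiv> N - off - I"

text \<open>Path systems in the coordinates of the minor: row \<open>i\<close> stands for the index
  \<open>off + i\<close> and column \<open>j\<close> for \<open>off + I + j\<close>, so a fixed
  point reads \<open>i = I + p i\<close>.\<close>

definition good_perms :: "(nat \<Rightarrow> nat) set" where
  "good_perms = {p. p permutes {0..<m} \<and> (\<forall>i<m. i = I + p i \<or> b (off + i) < b (off + I + p i)) \<and>
    card {i \<in> {0..<m}. i = I + p i} = e}"

definition perm_monomial :: "(nat \<Rightarrow> nat) \<Rightarrow> (nat \<times> nat) \<Rightarrow>\<^sub>0 nat" where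
  "perm_monomial p = (\<Sum>i = 0..<m. if i = I + p i then 0 else Poly_Mapping.single (Suc (off + i), Suc (off + I + p i)) 1)"

text \<open>At a diagonal position the generic entry is zero and only \<open>t\<close> remains; any
  other position contributes no \<open>t\<close>. The product thus has a single term in
  \<open>t\<close>, whose degree is the number of fixed points.\<close>

lemma coeff_term:
  "coeff (\<Prod>i = 0..<m. pencil gen (off + i) (off + I + p i)) e =
    (if (\<forall>i<m. i = I + p i \<or> b (off + i) < b (off + I + p i)) \<and> card {i \<in> {0..<m}. i = I + p i} = e
     then mon (perm_monomial p) 1 else 0)"
proof -
  let ?fix = "\<lambda>i. i = I + p i"
  have "(\<Prod>i = 0..<m. pencil gen (off + i) (off + I + p i)) =
      (\<Prod>i = 0..<m. monom (if ?fix i then 1 else gen (off + i) (off + I + p i)) (if ?fix i then 1 else 0))"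
  proof (intro prod.cong refl)
    fix i
    show "pencil gen (off + i) (off + I + p i) =
        monom (if ?fix i then 1 else gen (off + i) (off + I + p i)) (if ?fix i then 1 else 0)"
    proof (cases "?fix i")
      case True
      hence "off + I + p i = off + i" by simp
      show ?thesis unfolding \<open>off + I + p i = off + i\<close>
        using True by (simp add: pencil_def generic_entry_def monom_Suc monom_0)
    qed (auto simp: pencil_def monom_0)
  qed
  also have "\<dots> = monom (\<Prod>i = 0..<m. if ?fix i then 1 else gen (off + i) (off + I + p i))
      (card {i \<in> {0..<m}. ?fix i})"
    by (subst prod_monom) (simp_all add: sum.If_cases Int_def)
  finally have 1: "coeff (\<Prod>i = 0..<m. pencil gen (off + i) (off + I + p i)) e =
    (if card {i \<in> {0..<m}. ?fix i} = e then
      \<Prod>i = 0..<m. if ?fix i then 1 else gen (off + i) (off + I + p i) else 0)"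
    by simp
  have 2: "(\<Prod>i = 0..<m. if ?fix i then 1 else gen (off + i) (off + I + p i)) =
    (if \<forall>i<m. ?fix i \<or> b (off + i) < b (off + I + p i) then mon (perm_monomial p) 1 else 0)"
  proof (cases "\<forall>i<m. ?fix i \<or> b (off + i) < b (off + I + p i)")
    case True
    hence "(\<Prod>i = 0..<m. if ?fix i then 1 else gen (off + i) (off + I + p i)) =
      (\<Prod>i = 0..<m. mon (if ?fix i then 0 else Poly_Mapping.single (Suc (off + i), Suc (off + I + p i)) 1) 1)"
      by (intro prod.cong refl) (auto simp: generic_entry_def var_def)
    thus ?thesis using True by (simp add: prod_mon perm_monomial_def)
  next
    case False
    then obtain i where "i < m" "\<not> ?fix i" "\<not> b (off + i) < b (off + I + p i)" by auto
    hence "(\<Prod>i = 0..<m. if ?fix i then 1 else gen (off + i) (off + I + p i)) = 0"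
      by (intro prod_zero) (auto simp: generic_entry_def intro!: bexI[of _ i])
    thus ?thesis by (simp only: False if_False)
  qed
  have "(if P then if Q then a else 0 else 0) = (if Q \<and> P then a else 0)" for P Q and a :: cpoly
    by simp
  thus ?thesis unfolding 1 2 .
qed

lemma F_sum: "F = (\<Sum>p\<in>good_perms. of_int (sign p) * mon (perm_monomial p) 1)"
proof -
  have "F = (\<Sum>p | p permutes {0..<m}. of_int (sign p) *
      coeff (\<Prod>i = 0..<m. pencil gen (off + i) (off + I + p i)) e)"
    unfolding F_def pencil_minor_def det_mat by (simp add: coeff_sum coeff_of_int_mult)
  also have "\<dots> = (\<Sum>p\<in>good_perms. of_int (sign p) * mon (perm_monomial p) 1)"
    unfolding coeff_term
    by (intro sum.mono_neutral_cong_right) (auto simp: good_perms_def finite_permutations)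
  finally show ?thesis .
qed

lemma lookup_perm_monomial:
  "Poly_Mapping.lookup (perm_monomial p) (s, t) =
    (if \<exists>i<m. i \<noteq> I + p i \<and> s = Suc (off + i) \<and> t = Suc (off + I + p i) then 1 else 0)"
proof -
  have "Poly_Mapping.lookup (perm_monomial p) (s, t) =
      (\<Sum>i = 0..<m. if i = s - Suc off then
        (if i \<noteq> I + p i \<and> s = Suc (off + i) \<and> t = Suc (off + I + p i) then 1 else 0) else 0)"
    unfolding perm_monomial_def lookup_sum
    by (intro sum.cong refl) (auto simp: lookup_single when_def)
  also have "\<dots> = (if \<exists>i<m. i \<noteq> I + p i \<and> s = Suc (off + i) \<and> t = Suc (off + I + p i) then 1 else 0)"
    by (subst sum.delta) auto
  finally show ?thesis .
qed

text \<open>The variables show where the moved indices go, and the others satisfy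
  \<open>i = I + p i\<close>. So no two terms of the determinant cancel in \<open>F\<close>.\<close>

lemma perm_monomial_inj: "inj_on perm_monomial good_perms"
proof (rule inj_onI)
  fix p p' assume pp: "p \<in> good_perms" "p' \<in> good_perms" "perm_monomial p = perm_monomial p'"
  have *: "p' i = p i" if "i < m" "i \<noteq> I + p i" "perm_monomial p = perm_monomial p'" for i p p'
  proof -
    have "Poly_Mapping.lookup (perm_monomial p') (Suc (off + i), Suc (off + I + p i)) = 1"
      by (subst that(3)[symmetric]) (use that(1,2) in \<open>auto simp: lookup_perm_monomial\<close>)
    thus ?thesis by (auto simp: lookup_perm_monomial split: if_splits)
  qed
  show "p = p'"
  proof
    fix i
    show "p i = p' i"
    proof (cases "i < m")
      case True
      consider "i \<noteq> I + p i" | "i \<noteq> I + p' i" | "I + p i = I + p' i" by metis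
      thus ?thesis
      proof cases
        case 1
        from *[OF True this pp(3)] show ?thesis ..
      next
        case 2
        from *[OF True this pp(3)[symmetric]] show ?thesis .
      qed simp
    next
      case False
      thus ?thesis using pp by (auto simp: good_perms_def permutes_def)
    qed
  qed
qed

lemma keys_F: "Poly_Mapping.keys F = perm_monomial ` good_perms"
proof -
  have fin: "finite good_perms"
    by (rule finite_subset[of _ "{p. p permutes {0..<m}}"]) (auto simp: good_perms_def finite_permutations)
  have L: "Poly_Mapping.lookup F k = (\<Sum>p\<in>good_perms. if perm_monomial p = k then of_int (sign p) else 0)" for k
    unfolding F_sum lookup_sum
    by (intro sum.cong refl) (simp add: lookup_of_int_mult lookup_single when_def)
  show ?thesis
  proof (intro subset_antisym subsetI)
    fix k assume "k \<in> Poly_Mapping.keys F"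
    hence "(\<Sum>p\<in>good_perms. if perm_monomial p = k then of_int (sign p) else (0::complex)) \<noteq> 0"
      by (simp add: in_keys_iff L)
    then obtain p where "p \<in> good_perms" "(if perm_monomial p = k then of_int (sign p) else (0::complex)) \<noteq> 0"
      by (rule sum.not_neutral_contains_not_neutral)
    thus "k \<in> perm_monomial ` good_perms" by (auto split: if_splits)
  next
    fix k assume "k \<in> perm_monomial ` good_perms"
    then obtain p where p: "p \<in> good_perms" "k = perm_monomial p" by auto
    have "Poly_Mapping.lookup F k = (\<Sum>q\<in>good_perms. if q = p then of_int (sign p) else 0)"
      unfolding L p using inj_onD[OF perm_monomial_inj] p by (intro sum.cong refl) auto
    also have "\<dots> = of_int (sign p)" using p fin by simp
    finally show "k \<in> Poly_Mapping.keys F" by (simp add: in_keys_iff sign_def)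
  qed
qed

lemma key_path_system:
  assumes "k \<in> Poly_Mapping.keys F"
  shows "\<exists>\<pi>. path_system \<pi> \<and> edge_monomial k \<pi>"
proof -
  obtain p where p: "p \<in> good_perms" "k = perm_monomial p" using assms keys_F by auto
  define \<pi> where "\<pi> = (\<lambda>r. off + I + p (r - off))"
  have perm: "p permutes {0..<m}" using p by (simp add: good_perms_def)
  have b1: "bij_betw (\<lambda>r. r - off) Rows {0..<m}"
    by (rule bij_betwI[where g = "\<lambda>i. i + off"]) (use size in \<open>auto simp: Rows_def\<close>)
  have b2: "bij_betw (\<lambda>i. off + I + i) {0..<m} Cols"
    by (rule bij_betwI[where g = "\<lambda>i. i - off - I"]) (use size in \<open>auto simp: Cols_def\<close>)
  have bij: "bij_betw \<pi> Rows Cols"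
    using bij_betw_trans[OF bij_betw_trans[OF b1 permutes_imp_bij[OF perm]] b2] by (simp add: \<pi>_def o_def)
  have rise: "\<pi> r = r \<or> b r < b (\<pi> r)" if "r \<in> Rows" for r
  proof -
    have "r - off < m" "off + (r - off) = r" using that size by (auto simp: Rows_def)
    thus ?thesis using p(1) unfolding good_perms_def \<pi>_def by force
  qed
  have "bij_betw (\<lambda>r. r - off) {r \<in> Rows. \<pi> r = r} {i \<in> {0..<m}. i = I + p i}"
    by (rule bij_betwI[where g = "\<lambda>i. i + off"]) (use size in \<open>auto simp: Rows_def \<pi>_def\<close>)
  from bij_betw_same_card[OF this] have "card {r \<in> Rows. \<pi> r = r} = e"
    using p by (simp add: good_perms_def)
  moreover have "edge_monomial k \<pi>"
    unfolding edge_monomial_def p(2) lookup_perm_monomial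
  proof (intro allI if_cong refl iffI)
    fix s t
    assume "\<exists>i<m. i \<noteq> I + p i \<and> s = Suc (off + i) \<and> t = Suc (off + I + p i)"
    then obtain i where "i < m" "i \<noteq> I + p i" "s = Suc (off + i)" "t = Suc (off + I + p i)" by auto
    thus "\<exists>r\<in>Rows. \<pi> r \<noteq> r \<and> s = Suc r \<and> t = Suc (\<pi> r)"
      using size by (intro bexI[of _ "off + i"]) (auto simp: Rows_def \<pi>_def)
  next
    fix s t
    assume "\<exists>r\<in>Rows. \<pi> r \<noteq> r \<and> s = Suc r \<and> t = Suc (\<pi> r)"
    then obtain r where "r \<in> Rows" "\<pi> r \<noteq> r" "s = Suc r" "t = Suc (\<pi> r)" by auto
    thus "\<exists>i<m. i \<noteq> I + p i \<and> s = Suc (off + i) \<and> t = Suc (off + I + p i)"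
      using size by (intro exI[of _ "r - off"]) (auto simp: Rows_def \<pi>_def)
  qed
  ultimately show ?thesis using bij rise by (auto simp: path_system_def)
qed

lemma path_system_key:
  assumes "path_system \<pi>"
  shows "\<exists>k\<in>Poly_Mapping.keys F. edge_monomial k \<pi>"
proof -
  have bij: "bij_betw \<pi> Rows Cols" using assms by (simp add: path_system_def)
  define p where "p i = (if i < m then \<pi> (off + i) - off - I else i)" for i
  have b1: "bij_betw (\<lambda>i. off + i) {0..<m} Rows"
    by (rule bij_betwI[where g = "\<lambda>i. i - off"]) (use size in \<open>auto simp: Rows_def\<close>)
  have b2: "bij_betw (\<lambda>c. c - off - I) Cols {0..<m}"
    by (rule bij_betwI[where g = "\<lambda>i. i + off + I"]) (use size in \<open>auto simp: Cols_def\<close>)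
  have "bij_betw ((\<lambda>c. c - off - I) \<circ> (\<pi> \<circ> (\<lambda>i. off + i))) {0..<m} {0..<m}"
    by (rule bij_betw_trans[OF bij_betw_trans[OF b1 bij] b2])
  hence "bij_betw p {0..<m} {0..<m}"
    by (rule bij_betw_cong[THEN iffD1, rotated]) (auto simp: p_def)
  hence perm: "p permutes {0..<m}"
    by (rule bij_imp_permutes) (auto simp: p_def)
  have \<pi>: "\<pi> (off + i) = off + I + p i" "off + i \<in> Rows" if "i < m" for i
  proof -
    show "off + i \<in> Rows" using that size by (auto simp: Rows_def)
    hence "\<pi> (off + i) \<in> Cols" using bij by (auto simp: bij_betw_def)
    thus "\<pi> (off + i) = off + I + p i" using that by (auto simp: p_def Cols_def)
  qed
  have "bij_betw (\<lambda>i. off + i) {i \<in> {0..<m}. i = I + p i} {r \<in> Rows. \<pi> r = r}"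
  proof (rule bij_betwI[where g = "\<lambda>i. i - off"])
    show "(\<lambda>i. i - off) \<in> {r \<in> Rows. \<pi> r = r} \<rightarrow> {i \<in> {0..<m}. i = I + p i}"
    proof
      fix r assume "r \<in> {r \<in> Rows. \<pi> r = r}"
      hence "r - off < m" "off + (r - off) = r" "\<pi> r = r" using size by (auto simp: Rows_def)
      thus "r - off \<in> {i \<in> {0..<m}. i = I + p i}" using \<pi>(1)[of "r - off"] by auto
    qed
  qed (use \<pi> in \<open>auto simp: Rows_def\<close>)
  from bij_betw_same_card[OF this] have "card {i \<in> {0..<m}. i = I + p i} = e"
    using assms by (simp add: path_system_def)
  moreover have "i = I + p i \<or> b (off + i) < b (off + I + p i)" if "i < m" for i
    using assms \<pi>[OF that] unfolding path_system_def by force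
  ultimately have good: "p \<in> good_perms" using perm by (auto simp: good_perms_def)
  have "edge_monomial (perm_monomial p) \<pi>"
    unfolding edge_monomial_def lookup_perm_monomial
  proof (intro allI if_cong refl iffI)
    fix s t
    assume "\<exists>i<m. i \<noteq> I + p i \<and> s = Suc (off + i) \<and> t = Suc (off + I + p i)"
    then obtain i where "i < m" "i \<noteq> I + p i" "s = Suc (off + i)" "t = Suc (off + I + p i)" by auto
    thus "\<exists>r\<in>Rows. \<pi> r \<noteq> r \<and> s = Suc r \<and> t = Suc (\<pi> r)"
      using \<pi>[of i] by (intro bexI[of _ "off + i"]) auto
  next
    fix s t
    assume "\<exists>r\<in>Rows. \<pi> r \<noteq> r \<and> s = Suc r \<and> t = Suc (\<pi> r)"
    then obtain r where r: "r \<in> Rows" "\<pi> r \<noteq> r" "s = Suc r" "t = Suc (\<pi> r)" by auto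
    hence "r - off < m" "off + (r - off) = r" using size by (auto simp: Rows_def)
    thus "\<exists>i<m. i \<noteq> I + p i \<and> s = Suc (off + i) \<and> t = Suc (off + I + p i)"
      using \<pi>(1)[of "r - off"] r by (intro exI[of _ "r - off"]) auto
  qed
  thus ?thesis using good keys_F by auto
qed

end

section \<open>Path systems between the two chains\<close>

context chain_pair
begin

abbreviation "J \<equiv> b off"
abbreviation "K \<equiv> b (N - 1)"
abbreviation "block i \<equiv> {x \<in> X. b x = i}"

lemma X_bounds: "x \<in> X \<Longrightarrow> J \<le> b x \<and> b x \<le> K"
  using mono[of off x] mono[of x "N - 1"] by (auto simp: X_def)

lemma finite_X [simp]: "finite X" "finite Rows"
  by (auto simp: X_def Rows_def)

lemma Rows_iff: "x \<in> Rows \<longleftrightarrow> x \<in> X \<and> b x < K"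
proof -
  have "x \<in> X \<Longrightarrow> x < N - I \<longleftrightarrow> b x \<noteq> K"
  proof -
    assume "x \<in> X"
    moreover have "x \<in> {x \<in> {off..<N}. b x = K} \<longleftrightarrow> x \<in> {N - I..<N}" by (simp only: last)
    ultimately show ?thesis by (simp add: X_def) linarith
  qed
  moreover have "x \<in> Rows \<Longrightarrow> x \<in> X" by (auto simp: Rows_def X_def)
  moreover have "x \<in> Rows \<longleftrightarrow> x \<in> X \<and> x < N - I" by (auto simp: Rows_def X_def)
  ultimately show ?thesis using X_bounds[of x] by (metis order_less_le)
qed

lemma Cols_iff: "x \<in> Cols \<longleftrightarrow> x \<in> X \<and> J < b x"
proof -
  have "x \<in> X \<Longrightarrow> off + I \<le> x \<longleftrightarrow> b x \<noteq> J"
  proof -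
    assume "x \<in> X"
    moreover have "x \<in> {x \<in> {off..<N}. b x = J} \<longleftrightarrow> x \<in> {off..<off + I}" by (simp only: first)
    ultimately show ?thesis by (simp add: X_def) linarith
  qed
  moreover have "x \<in> Cols \<longleftrightarrow> x \<in> X \<and> off + I \<le> x" by (auto simp: Cols_def X_def)
  ultimately show ?thesis using X_bounds[of x] by (metis order_less_le)
qed

lemma card_first_block: "card (block J) = I"
  using first by (simp add: X_def)

lemma card_last_block: "card (block K) = I"
  using last size by (simp add: X_def)

lemma card_X: "card X = card Rows + I"
  using size by (simp add: X_def Rows_def)

lemma level_function_X: "level_function X b (level b)"
  unfolding X_def by (rule level_function_interval) (use before mono in auto)

lemma path_system_rising: "path_system \<pi> \<Longrightarrow> rising_injection X Rows \<pi> b I"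
  by unfold_locales (auto simp: path_system_def bij_betw_def card_X Rows_iff Cols_iff)

text \<open>A path system attains the minimal number of fixed points, so each block fixes exactly
  its excess over \<open>I\<close>.\<close>

lemma path_system_fixed:
  assumes "path_system \<pi>"
  shows "card {r \<in> Rows. \<pi> r = r \<and> b r = i} = card (block i) - I"
proof -
  interpret rising_injection X Rows \<pi> b I by (rule path_system_rising[OF assms])
  have "card {r \<in> Fix. b r = i} = card (block i) - I"
    by (rule card_Fix_block_eq[OF level_function_X])
      (use assms in \<open>simp add: path_system_def e_def Fix_def\<close>)
  thus ?thesis by (simp add: Fix_def)
qed

subsection \<open>Constructing path systems from tracks\<close>

text \<open>The elements carrying a track number below \<open>I\<close> are joined to \<open>I\<close> disjoint paths; the
  others are fixed.\<close>

definition tracks :: "(nat \<Rightarrow> nat) \<Rightarrow> bool" where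
  "tracks tr \<longleftrightarrow> (\<forall>x\<in>X. \<forall>y\<in>X. b x = b y \<longrightarrow> tr x = tr y \<longrightarrow> x = y) \<and>
    (\<forall>x\<in>X. card (block (b x)) < I \<longrightarrow> tr x < I) \<and>
    (\<forall>x\<in>X. I \<le> card (block (b x)) \<longrightarrow> (\<forall>u<I. \<exists>y\<in>block (b x). tr y = u))"

definition is_next :: "(nat \<Rightarrow> nat) \<Rightarrow> nat \<Rightarrow> nat \<Rightarrow> bool" where
  "is_next tr x y \<longleftrightarrow> y \<in> X \<and> tr y = tr x \<and> b x < b y \<and> (\<forall>z\<in>X. tr z = tr x \<longrightarrow> b x < b z \<longrightarrow> b y \<le> b z)"

definition track_path :: "(nat \<Rightarrow> nat) \<Rightarrow> nat \<Rightarrow> nat" where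
  "track_path tr x = (if tr x < I then SOME y. is_next tr x y else x)"

lemma off_in: "off \<in> X" "N - 1 \<in> X"
  using size by (auto simp: X_def)

lemma tracks_hit:
  "tracks tr \<Longrightarrow> x \<in> X \<Longrightarrow> I \<le> card (block (b x)) \<Longrightarrow> u < I \<Longrightarrow> \<exists>y\<in>block (b x). tr y = u"
  unfolding tracks_def by blast

text \<open>The last block has \<open>I\<close> elements, hence meets every track below
  \<open>I\<close>; so a successor on the track always exists.\<close>

lemma track_path_next:
  assumes "tracks tr" "x \<in> Rows" "tr x < I"
  shows "is_next tr x (track_path tr x)"
proof -
  have "\<exists>y\<in>block K. tr y = tr x"
    by (rule tracks_hit[OF assms(1) off_in(2) eq_refl[OF card_last_block[symmetric]] assms(3)])
  hence "\<exists>y. y \<in> X \<and> tr y = tr x \<and> b x < b y"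
    using assms by (auto simp: Rows_iff)
  from ex_has_least_nat[of "\<lambda>y. y \<in> X \<and> tr y = tr x \<and> b x < b y", OF someI_ex[OF this], of b]
  have "\<exists>y. is_next tr x y" by (auto simp: is_next_def)
  thus ?thesis using assms(3) by (simp add: track_path_def someI_ex)
qed

lemma track_path_active:
  assumes "tracks tr" "x \<in> Rows" "tr x < I"
  shows "track_path tr x \<in> X" "tr (track_path tr x) = tr x" "b x < b (track_path tr x)"
  using track_path_next[OF assms] by (auto simp: is_next_def)

lemma track_path_inactive: "\<not> tr x < I \<Longrightarrow> track_path tr x = x"
  by (simp add: track_path_def)

lemma is_next_unique:
  assumes "tracks tr" "is_next tr x y" "is_next tr x z"
  shows "y = z"
proof -
  have "b y = b z" using assms(2,3) by (auto simp: is_next_def intro: antisym)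
  thus ?thesis using assms by (auto simp: is_next_def tracks_def)
qed

lemma tracks_inactive_card:
  assumes "tracks tr" "i \<in> b ` X"
  shows "card {x \<in> X. b x = i \<and> \<not> tr x < I} = card (block i) - I"
proof -
  have inj: "inj_on tr (block i)"
    using assms(1) by (auto simp: tracks_def inj_on_def)
  obtain x where x: "x \<in> X" "b x = i" using assms(2) by auto
  have split: "card (block i) = card {x \<in> X. b x = i \<and> tr x < I} + card {x \<in> X. b x = i \<and> \<not> tr x < I}"
    by (subst card_Un_disjoint[symmetric]) (auto intro: arg_cong[of _ _ card])
  show ?thesis
  proof (cases "card (block i) < I")
    case True
    hence "{x \<in> X. b x = i \<and> \<not> tr x < I} = {}"
      using assms(1) unfolding tracks_def by auto
    thus ?thesis using True by (simp only: card.empty)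
  next
    case False
    have "tr ` {x \<in> X. b x = i \<and> tr x < I} = {..<I}"
    proof (intro subset_antisym subsetI)
      fix u assume "u \<in> {..<I}"
      then obtain y where "y \<in> block i" "tr y = u"
        using tracks_hit[OF assms(1) x(1), of u] x(2) False by auto
      thus "u \<in> tr ` {x \<in> X. b x = i \<and> tr x < I}" using \<open>u \<in> _\<close> by auto
    qed auto
    moreover have inj': "inj_on tr {x \<in> X. b x = i \<and> tr x < I}"
      using inj by (rule inj_on_subset) auto
    ultimately have "card {x \<in> X. b x = i \<and> tr x < I} = I"
      using card_image[OF inj'] by simp
    thus ?thesis using split by simp
  qed
qed

text \<open>The two outer blocks have \<open>I\<close> elements, all on tracks below
  \<open>I\<close>, so no fixed row lies in the first block and all images are columns; injectivity
  and equal cardinalities do the rest. Each block fixes its truncated excess over \<open>I\<close>,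
  which adds up to \<open>e\<close>.\<close>

lemma track_path_system:
  assumes tr: "tracks tr"
  shows "path_system (track_path tr)"
proof -
  let ?\<pi> = "track_path tr"
  have active: "tr x < I" if "x \<in> X" "b x = J \<or> b x = K" for x
  proof -
    have "card {y \<in> X. b y = b x \<and> \<not> tr y < I} = 0"
      using tracks_inactive_card[OF tr, of "b x"] that card_first_block card_last_block by auto
    thus ?thesis using that by auto
  qed
  note nx = track_path_next[OF tr]
  have fixed: "?\<pi> x = x \<longleftrightarrow> \<not> tr x < I" if "x \<in> Rows" for x
    using track_path_active(3)[OF tr that] track_path_inactive[of tr x] by force
  have tr_\<pi>: "tr (?\<pi> x) = tr x" if "x \<in> Rows" for x
    using track_path_active(2)[OF tr that] track_path_inactive[of tr x] by force
  have inj: "inj_on ?\<pi> Rows"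
  proof (rule inj_onI)
    fix x y assume xy: "x \<in> Rows" "y \<in> Rows" "?\<pi> x = ?\<pi> y"
    hence t: "tr x = tr y" using tr_\<pi> by metis
    show "x = y"
    proof (cases "tr x < I")
      case True
      hence n: "is_next tr x (?\<pi> x)" "is_next tr y (?\<pi> x)"
        using nx[OF xy(1)] nx[OF xy(2)] t xy by auto
      have "\<not> b x < b y" "\<not> b y < b x"
        using n xy t by (auto simp: is_next_def Rows_iff not_less)
      hence "b x = b y" by simp
      thus ?thesis using tr t xy by (auto simp: tracks_def Rows_iff)
    qed (use xy t in \<open>auto simp: track_path_def\<close>)
  qed
  have rise: "?\<pi> r = r \<or> b r < b (?\<pi> r)" if "r \<in> Rows" for r
    using track_path_active(3)[OF tr that] track_path_inactive[of tr r] by blast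
  have "?\<pi> ` Rows \<subseteq> Cols"
  proof
    fix y assume "y \<in> ?\<pi> ` Rows"
    then obtain x where x: "x \<in> Rows" "y = ?\<pi> x" by auto
    show "y \<in> Cols"
    proof (cases "tr x < I")
      case True
      thus ?thesis using track_path_active[OF tr x(1)] x X_bounds[of x] by (auto simp: Cols_iff Rows_iff)
    next
      case False
      hence "b x \<noteq> J" "y = x" using active[of x] x by (auto simp: track_path_def Rows_iff)
      thus ?thesis using x(1) X_bounds[of x] unfolding Cols_iff Rows_iff by (metis order_less_le)
    qed
  qed
  hence "?\<pi> ` Rows = Cols"
  proof (rule card_subset_eq[rotated])
    show "card (?\<pi> ` Rows) = card Cols"
      unfolding card_image[OF inj] using size by (simp add: Rows_def Cols_def)
  qed (simp add: Cols_def)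
  hence bij: "bij_betw ?\<pi> Rows Cols" using inj by (simp add: bij_betw_def)
  have "card {r \<in> Rows. ?\<pi> r = r} = card {x \<in> X. \<not> tr x < I}"
    using fixed active X_bounds by (intro arg_cong[of _ _ card]) (auto simp: Rows_iff order_less_le)
  also have "\<dots> = (\<Sum>i\<in>b ` X. card {x \<in> {x \<in> X. \<not> tr x < I}. b x = i})"
  proof -
    have "b ` {x \<in> X. \<not> tr x < I} \<subseteq> b ` X" by auto
    from sum.group[OF _ _ this, of "\<lambda>_. 1::nat"] show ?thesis by simp
  qed
  also have "\<dots> = (\<Sum>i\<in>b ` X. card (block i) - I)"
    by (intro sum.cong refl, subst tracks_inactive_card[OF tr, symmetric])
      (auto intro: arg_cong[of _ _ card])
  also have "\<dots> = e"
    unfolding e_def by (rule card_level_ge[OF level_function_X, symmetric]) simp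
  finally show ?thesis using bij rise by (simp add: path_system_def)
qed

lemma level_range:
  "x \<in> X \<Longrightarrow> level b x < card (block (b x))"
  "x \<in> X \<Longrightarrow> u < card (block (b x)) \<Longrightarrow> \<exists>y\<in>block (b x). level b y = u"
  "x \<in> X \<Longrightarrow> y \<in> X \<Longrightarrow> b x = b y \<Longrightarrow> level b x = level b y \<Longrightarrow> x = y"
proof -
  have bij: "bij_betw (level b) (block i) {..<card (block i)}" for i
    using level_function_X by (simp add: level_function_def)
  show "x \<in> X \<Longrightarrow> level b x < card (block (b x))"
    using bij_betwE[OF bij[of "b x"]] by auto
  show "x \<in> X \<Longrightarrow> u < card (block (b x)) \<Longrightarrow> \<exists>y\<in>block (b x). level b y = u"
  proof -
    assume "u < card (block (b x))"
    hence "u \<in> level b ` block (b x)" using bij[of "b x"] unfolding bij_betw_def by simp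
    thus ?thesis by auto
  qed
  show "x \<in> X \<Longrightarrow> y \<in> X \<Longrightarrow> b x = b y \<Longrightarrow> level b x = level b y \<Longrightarrow> x = y"
    using bij[of "b x"] by (auto simp: bij_betw_def dest: inj_onD)
qed

text \<open>Relabelling the levels inside the blocks is the source of all explicit path systems
  below. Short blocks must stay on the \<open>I\<close> tracks, and the others must still meet all
  of them.\<close>

lemma tracks_permuted_levels:
  assumes inj: "\<And>i. inj (\<sigma> i)"
    and small: "\<And>i u. card (block i) < I \<Longrightarrow> u < card (block i) \<Longrightarrow> \<sigma> i u < (I::nat)"
    and large: "\<And>i u. I \<le> card (block i) \<Longrightarrow> u < I \<Longrightarrow> \<exists>v<card (block i). \<sigma> i v = u"
  shows "tracks (\<lambda>x. \<sigma> (b x) (level b x))"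
  unfolding tracks_def
proof (intro conjI ballI impI allI)
  fix x y assume "x \<in> X" "y \<in> X" "b x = b y" "\<sigma> (b x) (level b x) = \<sigma> (b y) (level b y)"
  thus "x = y" using inj level_range(3)[of x y] by (auto dest: injD)
next
  fix x assume "x \<in> X" "card (block (b x)) < I"
  thus "\<sigma> (b x) (level b x) < I" using small level_range(1)[of x] by blast
next
  fix x u assume x: "x \<in> X" "I \<le> card (block (b x))" "u < I"
  then obtain v where v: "v < card (block (b x))" "\<sigma> (b x) v = u" using large by blast
  obtain y where y: "y \<in> block (b x)" "level b y = v" using level_range(2)[OF x(1) v(1)] by blast
  thus "\<exists>y\<in>block (b x). \<sigma> (b y) (level b y) = u" using v by (intro bexI[of _ y]) auto
qed

section \<open>Variables and irreducibility of \<open>F\<close>\<close>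

definition edge :: "nat \<Rightarrow> nat \<Rightarrow> bool" where
  "edge r c \<longleftrightarrow> (Suc r, Suc c) \<in> mvars F"

lemma edgeI: "path_system \<pi> \<Longrightarrow> r \<in> Rows \<Longrightarrow> \<pi> r \<noteq> r \<Longrightarrow> edge r (\<pi> r)"
  using path_system_key[of \<pi>] unfolding edge_def mvars_def edge_monomial_def
  by (auto simp: in_keys_iff intro!: bexI)

lemma edgeE:
  assumes "x \<in> mvars F"
  obtains \<pi> r where "path_system \<pi>" "r \<in> Rows" "\<pi> r \<noteq> r" "x = (Suc r, Suc (\<pi> r))"
proof -
  obtain s t k where x: "x = (s, t)" and k: "k \<in> Poly_Mapping.keys F" "Poly_Mapping.lookup k (s, t) \<noteq> 0"
    using assms by (cases x) (auto simp: mvars_def in_keys_iff)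
  obtain \<pi> where \<pi>: "path_system \<pi>" "edge_monomial k \<pi>" using key_path_system[OF k(1)] by auto
  have "\<exists>r\<in>Rows. \<pi> r \<noteq> r \<and> s = Suc r \<and> t = Suc (\<pi> r)"
    using k(2) \<pi>(2) unfolding edge_monomial_def by (auto split: if_splits)
  thus thesis using that \<pi>(1) x by blast
qed

text \<open>Both \<open>r\<close> and \<open>c\<close> are relabelled onto track
  \<open>I - 1\<close>. The blocks between them are shorter than \<open>I\<close> and keep their
  levels, all below \<open>I - 1\<close>, so that track runs straight from \<open>r\<close> to
  \<open>c\<close>.\<close>

lemma edge_if_small_between:
  assumes "r \<in> X" "c \<in> X" "b r < b c" "\<And>x. x \<in> X \<Longrightarrow> b r < b x \<Longrightarrow> b x < b c \<Longrightarrow> card (block (b x)) < I"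
  shows "edge r c"
proof -
  define \<sigma> where "\<sigma> i = (if i = b r then Transposition.transpose (level b r) (I - 1)
    else if i = b c then Transposition.transpose (level b c) (I - 1) else id)" for i
  define tr where "tr x = \<sigma> (b x) (level b x)" for x
  have lv: "level b x < card (block (b x))" if "x \<in> X" for x using level_range(1)[OF that] .
  have "tracks tr" unfolding tr_def
  proof (rule tracks_permuted_levels)
    show "inj (\<sigma> i)" for i by (simp add: \<sigma>_def)
    show "\<sigma> i u < I" if "card (block i) < I" "u < card (block i)" for i u
      using that lv[OF assms(1)] lv[OF assms(2)] size(1)
      by (auto simp: \<sigma>_def Transposition.transpose_def)
    show "\<exists>v<card (block i). \<sigma> i v = u" if "I \<le> card (block i)" "u < I" for i u
    proof (rule exI[of _ "\<sigma> i u"], rule conjI)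
      show "\<sigma> i u < card (block i)"
        using that lv[OF assms(1)] lv[OF assms(2)] size(1)
        by (auto simp: \<sigma>_def Transposition.transpose_def)
      show "\<sigma> i (\<sigma> i u) = u" by (simp add: \<sigma>_def)
    qed
  qed
  have rR: "r \<in> Rows" using assms X_bounds[OF assms(2)] by (auto simp: Rows_iff)
  have tr_r: "tr r = I - 1" and tr_c: "tr c = I - 1"
    using assms(3) by (auto simp: tr_def \<sigma>_def)
  have "is_next tr r c" unfolding is_next_def
  proof (intro conjI ballI impI)
    fix z assume z: "z \<in> X" "tr z = tr r" "b r < b z"
    show "b c \<le> b z"
    proof (rule ccontr)
      assume "\<not> b c \<le> b z"
      hence "tr z = level b z" "card (block (b z)) < I"
        using z assms(4)[of z] by (auto simp: tr_def \<sigma>_def)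
      thus False using lv[OF z(1)] z(2) tr_r by simp
    qed
  qed (use assms tr_r tr_c in auto)
  moreover have "is_next tr r (track_path tr r)"
    by (rule track_path_next[OF \<open>tracks tr\<close> rR]) (use tr_r size in simp)
  ultimately have "track_path tr r = c" using is_next_unique[OF \<open>tracks tr\<close>] by blast
  moreover have "c \<noteq> r" using assms(3) by auto
  ultimately show ?thesis
    using edgeI[OF track_path_system[OF \<open>tracks tr\<close>] rR] by simp
qed

lemma mvars_F_nonempty: "mvars F \<noteq> {}"
proof -
  \<comment> \<open>\<open>N - I - 1\<close> is the last row, so no block lies strictly between it
    and the last one.\<close>
  have "edge (N - I - 1) (N - 1)"
  proof (rule edge_if_small_between)
    show "N - I - 1 \<in> X" using size by (auto simp: X_def)
    have R: "N - I - 1 \<in> Rows" using size by (auto simp: Rows_def)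
    thus "b (N - I - 1) < b (N - 1)" by (simp add: Rows_iff)
    fix x assume x: "x \<in> X" "b (N - I - 1) < b x" "b x < b (N - 1)"
    hence "x \<in> Rows" by (simp add: Rows_iff)
    hence "b x \<le> b (N - I - 1)" using size by (intro mono) (auto simp: Rows_def)
    thus "card (block (b x)) < I" using x by simp
  qed (rule off_in)
  thus ?thesis by (auto simp: edge_def)
qed

lemma mvars_F_rising:
  assumes "x \<in> mvars F"
  obtains r c where "x = (Suc r, Suc c)" "r \<in> Rows" "c \<in> Cols" "b r < b c"
proof -
  obtain \<pi> r where \<pi>: "path_system \<pi>" and r: "r \<in> Rows" "\<pi> r \<noteq> r" "x = (Suc r, Suc (\<pi> r))"
    using edgeE[OF assms] .
  hence "\<pi> r \<in> Cols" "b r < b (\<pi> r)" by (auto simp: path_system_def bij_betw_def)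
  with that r show thesis by blast
qed

lemma path_system_Cols: "path_system \<pi> \<Longrightarrow> r \<in> Rows \<Longrightarrow> \<pi> r \<in> Cols"
  by (auto simp: path_system_def bij_betw_def)

lemma path_system_surj: "path_system \<pi> \<Longrightarrow> c \<in> Cols \<Longrightarrow> \<exists>r\<in>Rows. \<pi> r = c"
proof -
  assume "path_system \<pi>" "c \<in> Cols"
  hence "c \<in> \<pi> ` Rows" by (simp add: path_system_def bij_betw_def)
  thus ?thesis by blast
qed

text \<open>\<open>off\<close> is a row but not a column, so no path system fixes it.\<close>

lemma first_row_edge: "\<exists>c. edge off c"
proof -
  obtain k where "k \<in> Poly_Mapping.keys F" using mvars_F_nonempty by (auto simp: mvars_def)
  then obtain \<pi> where \<pi>: "path_system \<pi>" using key_path_system by blast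
  have "off \<in> Rows" using size by (auto simp: Rows_def)
  moreover have "off \<notin> Cols" using size by (auto simp: Cols_def)
  ultimately have "\<pi> off \<noteq> off" using path_system_Cols[OF \<pi>, of off] by auto
  from edgeI[OF \<pi> \<open>off \<in> Rows\<close> this] show ?thesis ..
qed

lemma last_column_edge: "\<exists>r. edge r (N - 1)"
proof -
  obtain k where "k \<in> Poly_Mapping.keys F" using mvars_F_nonempty by (auto simp: mvars_def)
  then obtain \<pi> where \<pi>: "path_system \<pi>" using key_path_system by blast
  have "N - 1 \<in> Cols" using size by (auto simp: Cols_def)
  then obtain r where r: "r \<in> Rows" "\<pi> r = N - 1"
    using path_system_surj[OF \<pi>] by blast
  have "N - 1 \<notin> Rows" using size by (auto simp: Rows_def)
  hence "\<pi> r \<noteq> r" using r by metis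
  from edgeI[OF \<pi> r(1) this] show ?thesis using r by auto
qed

lemma keys_F_affine: "k \<in> Poly_Mapping.keys F \<Longrightarrow> Poly_Mapping.lookup k x \<le> 1"
  using key_path_system[of k] by (cases x) (auto simp: edge_monomial_def)

lemma homogeneous_F: "homogeneous_poly (card Rows - e) F"
  unfolding homogeneous_poly_def
proof
  fix k assume k: "k \<in> Poly_Mapping.keys F"
  obtain \<pi> where \<pi>: "path_system \<pi>" "edge_monomial k \<pi>" using key_path_system[OF k] by auto
  have keys: "Poly_Mapping.keys k = (\<lambda>r. (Suc r, Suc (\<pi> r))) ` {r \<in> Rows. \<pi> r \<noteq> r}"
  proof (intro subset_antisym subsetI)
    fix x assume "x \<in> Poly_Mapping.keys k"
    then obtain s t where "x = (s, t)" "Poly_Mapping.lookup k (s, t) \<noteq> 0" by (cases x) (auto simp: in_keys_iff)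
    thus "x \<in> (\<lambda>r. (Suc r, Suc (\<pi> r))) ` {r \<in> Rows. \<pi> r \<noteq> r}"
      using \<pi>(2) unfolding edge_monomial_def by (auto split: if_splits)
  next
    fix x assume "x \<in> (\<lambda>r. (Suc r, Suc (\<pi> r))) ` {r \<in> Rows. \<pi> r \<noteq> r}"
    then obtain r where "x = (Suc r, Suc (\<pi> r))" "r \<in> Rows" "\<pi> r \<noteq> r" by auto
    thus "x \<in> Poly_Mapping.keys k" using \<pi>(2) by (auto simp: edge_monomial_def in_keys_iff)
  qed
  have "(\<Sum>v\<in>Poly_Mapping.keys k. Poly_Mapping.lookup k v) = (\<Sum>v\<in>Poly_Mapping.keys k. 1)"
  proof (intro sum.cong refl)
    fix v assume "v \<in> Poly_Mapping.keys k"
    thus "Poly_Mapping.lookup k v = 1"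
      using keys_F_affine[OF k, of v] by (auto simp: in_keys_iff)
  qed
  also have "\<dots> = card {r \<in> Rows. \<pi> r \<noteq> r}"
    unfolding keys by (simp add: card_image inj_on_def)
  also have "\<dots> = card Rows - e"
  proof -
    have "card Rows = card {r \<in> Rows. \<pi> r \<noteq> r} + card {r \<in> Rows. \<pi> r = r}"
      by (subst card_Un_disjoint[symmetric]) (auto intro: arg_cong[of _ _ card])
    thus ?thesis using \<pi>(1) by (simp add: path_system_def)
  qed
  finally show "(\<Sum>v\<in>Poly_Mapping.keys k. Poly_Mapping.lookup k v) = card Rows - e" .
qed

text \<open>The polynomial is multiaffine, so a factorization colours its variables such that the
  monomials of \<open>F\<close> are closed under combining the first colour of one with the second colour of
  another. All variables have the same colour: two variables in a common row or column never
  occur together, and at a block longer than \<open>I\<close> the paths entering and leaving it must use the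
  same elements, of which there is a choice.\<close>

lemma monochromatic:
  assumes A: "A \<subseteq> mvars F"
    and exchange: "\<And>k k'. k \<in> Poly_Mapping.keys F \<Longrightarrow> k' \<in> Poly_Mapping.keys F \<Longrightarrow>
        \<exists>k''\<in>Poly_Mapping.keys F. \<forall>x. Poly_Mapping.lookup k'' x =
          (if x \<in> A then Poly_Mapping.lookup k x else Poly_Mapping.lookup k' x)"
  shows "A = {} \<or> A = mvars F"
proof -
  let ?A = "\<lambda>r c. (Suc r, Suc c) \<in> A"
  \<comment> \<open>The exchange property for path systems: edges coloured by \<open>A\<close> come
    from the first system, the others from the second.\<close>
  have mix: "\<exists>\<pi>''. path_system \<pi>'' \<and> (\<forall>r\<in>Rows. \<forall>c. \<pi>'' r = c \<and> \<pi>'' r \<noteq> r \<longleftrightarrow>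
      (if ?A r c then \<pi> r = c \<and> \<pi> r \<noteq> r else \<pi>' r = c \<and> \<pi>' r \<noteq> r))"
    if \<pi>: "path_system \<pi>" "path_system \<pi>'" for \<pi> \<pi>'
  proof -
    have L: "Poly_Mapping.lookup k (Suc r, Suc c) = 1 \<longleftrightarrow> \<pi> r = c \<and> \<pi> r \<noteq> r"
      if "edge_monomial k \<pi>" "r \<in> Rows" for k \<pi> r c
      using that by (auto simp: edge_monomial_def)
    obtain k k' where k: "k \<in> Poly_Mapping.keys F" "edge_monomial k \<pi>"
      "k' \<in> Poly_Mapping.keys F" "edge_monomial k' \<pi>'"
      using path_system_key \<pi> by metis
    obtain k'' where k'': "k'' \<in> Poly_Mapping.keys F" "\<And>x. Poly_Mapping.lookup k'' x =
        (if x \<in> A then Poly_Mapping.lookup k x else Poly_Mapping.lookup k' x)"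
      using exchange[OF k(1,3)] by blast
    obtain \<pi>'' where \<pi>'': "path_system \<pi>''" "edge_monomial k'' \<pi>''"
      using key_path_system[OF k''(1)] by blast
    have "\<pi>'' r = c \<and> \<pi>'' r \<noteq> r \<longleftrightarrow>
      (if ?A r c then \<pi> r = c \<and> \<pi> r \<noteq> r else \<pi>' r = c \<and> \<pi>' r \<noteq> r)" if "r \<in> Rows" for r c
      unfolding L[OF \<pi>''(2) that, of c, symmetric] L[OF k(2) that, of c, symmetric]
        L[OF k(4) that, of c, symmetric] k''(2) by simp
    thus ?thesis using \<pi>''(1) by blast
  qed
  have edge_path: "\<exists>\<pi>. path_system \<pi> \<and> r \<in> Rows \<and> \<pi> r = c \<and> \<pi> r \<noteq> r" if "edge r c" for r c
    using that unfolding edge_def by (elim edgeE) auto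
  \<comment> \<open>If two edges out of \<open>r\<close> had different colours, a mixed system would
    leave \<open>r\<close> along both. Likewise, two edges of different colours into one column
    would both be used.\<close>
  have row: "?A r c \<longleftrightarrow> ?A r c'" if "edge r c" "edge r c'" for r c c'
  proof -
    have "False" if h: "?A r c" "\<not> ?A r c'" "edge r c" "edge r c'" for c c'
    proof -
      obtain \<pi> \<pi>' where p: "path_system \<pi>" "r \<in> Rows" "\<pi> r = c" "\<pi> r \<noteq> r"
          "path_system \<pi>'" "\<pi>' r = c'" "\<pi>' r \<noteq> r"
        using edge_path[OF h(3)] edge_path[OF h(4)] by blast
      obtain \<pi>'' where *: "\<And>r c. r \<in> Rows \<Longrightarrow> \<pi>'' r = c \<and> \<pi>'' r \<noteq> r \<longleftrightarrow>
          (if ?A r c then \<pi> r = c \<and> \<pi> r \<noteq> r else \<pi>' r = c \<and> \<pi>' r \<noteq> r)"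
        using mix[OF p(1,5)] by blast
      have "\<pi>'' r = c" "\<pi>'' r = c'" using *[OF p(2), of c] *[OF p(2), of c'] p h by simp_all
      thus False using h by auto
    qed
    thus ?thesis using that by blast
  qed
  have col: "?A r c \<longleftrightarrow> ?A r' c" if "edge r c" "edge r' c" for r r' c
  proof -
    have "False" if h: "?A r c" "\<not> ?A r' c" "edge r c" "edge r' c" for r r'
    proof -
      obtain \<pi> \<pi>' where p: "path_system \<pi>" "r \<in> Rows" "\<pi> r = c" "\<pi> r \<noteq> r"
          "path_system \<pi>'" "r' \<in> Rows" "\<pi>' r' = c" "\<pi>' r' \<noteq> r'"
        using edge_path[OF h(3)] edge_path[OF h(4)] by blast
      obtain \<pi>'' where *: "path_system \<pi>''" "\<And>r c. r \<in> Rows \<Longrightarrow> \<pi>'' r = c \<and> \<pi>'' r \<noteq> r \<longleftrightarrow>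
          (if ?A r c then \<pi> r = c \<and> \<pi> r \<noteq> r else \<pi>' r = c \<and> \<pi>' r \<noteq> r)"
        using mix[OF p(1,5)] by blast
      have "\<pi>'' r = c" "\<pi>'' r' = c" "r \<in> Rows" "r' \<in> Rows"
        using *(2)[OF p(2), of c] *(2)[OF p(6), of c] p h by simp_all
      moreover have "inj_on \<pi>'' Rows" using *(1) by (simp add: path_system_def bij_betw_def)
      ultimately have "r = r'" by (simp add: inj_on_def)
      thus False using h by auto
    qed
    thus ?thesis using that by blast
  qed
  \<comment> \<open>Each row now has a single colour, and it remains to pass it on from one row to
    the next.\<close>
  define red where "red r \<longleftrightarrow> (\<exists>c. edge r c \<and> ?A r c)" for r
  have red_iff: "red r \<longleftrightarrow> ?A r c" if "edge r c" for r c
  proof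
    assume "red r"
    then obtain c' where "edge r c'" "?A r c'" unfolding red_def by blast
    thus "?A r c" using row[OF _ that] by blast
  qed (use that red_def in blast)
  have next_block: "\<exists>c\<in>X. b r < b c \<and> (\<forall>x\<in>X. b r < b x \<longrightarrow> b c \<le> b x)" if "r \<in> Rows" for r
  proof -
    have "N - 1 \<in> X \<and> b r < b (N - 1)" using that off_in by (auto simp: Rows_iff)
    from ex_has_least_nat[of "\<lambda>c. c \<in> X \<and> b r < b c", OF this, of b] show ?thesis by auto
  qed
  have step: "red r \<longleftrightarrow> red (Suc r)" if R: "r \<in> Rows" "Suc r \<in> Rows" for r
  proof -
    have XR: "r \<in> X" "Suc r \<in> X" using R by (auto simp: Rows_iff)
    have between: "\<not> (b r < b x \<and> b x < b (Suc r))" if "x \<in> X" for x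
    proof (cases "x \<le> r")
      case True
      thus ?thesis using mono[of x r] XR by (auto simp: X_def)
    next
      case False
      thus ?thesis using mono[of "Suc r" x] that by (auto simp: X_def)
    qed
    have le: "b r \<le> b (Suc r)" using mono[of r "Suc r"] XR by (auto simp: X_def)
    obtain c where c: "c \<in> X" "b (Suc r) < b c" "\<And>x. x \<in> X \<Longrightarrow> b (Suc r) < b x \<Longrightarrow> b c \<le> b x"
      using next_block[OF R(2)] by blast
    have e2: "edge (Suc r) c"
      by (rule edge_if_small_between) (use c XR in \<open>auto simp: not_less[symmetric]\<close>)
    \<comment> \<open>If \<open>Suc r\<close> lies in the block of \<open>r\<close> or in one
      shorter than \<open>I\<close>, then \<open>r\<close> has an edge into the column
      \<open>c\<close> as well, and the column transfers the colour. Otherwise the block of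
      \<open>Suc r\<close> is a possible border between the colours.\<close>
    show ?thesis
    proof (cases "b r = b (Suc r) \<or> card (block (b (Suc r))) < I")
      case True
      have "edge r c"
      proof (rule edge_if_small_between)
        fix x assume x: "x \<in> X" "b r < b x" "b x < b c"
        hence "\<not> b (Suc r) < b x" using c(3)[of x] by auto
        moreover have "\<not> b x < b (Suc r)" using between[of x] x by auto
        ultimately have "b x = b (Suc r)" by simp
        thus "card (block (b x)) < I" using True x by auto
      qed (use c XR le in auto)
      thus ?thesis using col[OF _ e2] red_iff[OF e2] red_iff[of r c] by simp
    next
      case False
      define B where "B = b (Suc r)"
      have B: "b r < B" "J < B" "B < K"
        using False le R X_bounds[OF XR(1)] by (auto simp: B_def Rows_iff)
      \<comment> \<open>Size exactly \<open>I\<close> is excluded by \<open>middle\<close>: in such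
        a block every element would lie on a path and there would be no choice to exploit.\<close>
      have big: "I < card (block B)"
        using False middle[OF B(2,3)] by (simp add: B_def X_def)
      have blockB: "x \<in> Rows" "x \<in> Cols" if "x \<in> block B" for x
        using that B by (auto simp: Rows_iff Cols_iff)
      have into: "?A r' x \<longleftrightarrow> red r" if "edge r' x" "x \<in> block B" for r' x
      proof -
        have "edge r x"
          by (rule edge_if_small_between) (use XR that B between in \<open>auto simp: B_def\<close>)
        thus ?thesis using col[OF that(1)] red_iff[of r x] by simp
      qed
      have out: "?A x y \<longleftrightarrow> red (Suc r)" if "edge x y" "x \<in> block B" for x y
      proof -
        have "edge x c"
          by (rule edge_if_small_between) (use c that in \<open>auto simp: B_def not_less[symmetric]\<close>)
        thus ?thesis using row[OF that(1)] col[OF _ e2] red_iff[OF e2] by simp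
      qed
      show ?thesis
      proof (rule ccontr)
        assume neq: "\<not> (red r \<longleftrightarrow> red (Suc r))"
        \<comment> \<open>Exchanging the levels \<open>I - 1\<close> and \<open>I\<close> in the
          block \<open>B\<close> alone gives a second path system, which fixes the element of level
          \<open>I - 1\<close> where the first one moves it.\<close>
        define \<sigma> where "\<sigma> i = (if i = B then Transposition.transpose (I - 1) I else id)" for i :: nat
        define tr' where "tr' x = \<sigma> (b x) (level b x)" for x
        have t: "tracks (level b)"
          using tracks_permuted_levels[of "\<lambda>_. id"] by (simp add: order_less_trans)
        have t': "tracks tr'" unfolding tr'_def
        proof (rule tracks_permuted_levels)
          show "inj (\<sigma> i)" for i by (simp add: \<sigma>_def)
          show "\<sigma> i u < I" if "card (block i) < I" "u < card (block i)" for i u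
            using that big by (auto simp: \<sigma>_def)
          show "\<exists>v<card (block i). \<sigma> i v = u" if "I \<le> card (block i)" "u < I" for i u
            using that big by (intro exI[of _ "\<sigma> i u"]) (auto simp: \<sigma>_def Transposition.transpose_def)
        qed
        have moves: "\<pi> x \<noteq> x \<longleftrightarrow> tr x < I" if "tracks tr" "\<pi> = track_path tr" "x \<in> Rows" for tr x \<pi>
          using track_path_active(3)[OF that(1,3)] track_path_inactive[of tr x] that(2) by force
        define \<pi>1 \<pi>2 where "\<pi>1 = track_path (level b)" and "\<pi>2 = track_path tr'"
        have p12: "path_system \<pi>1" "path_system \<pi>2"
          using track_path_system t t' by (auto simp: \<pi>1_def \<pi>2_def)
        obtain \<pi> \<pi>' where \<pi>: "(\<pi> = \<pi>1 \<and> \<pi>' = \<pi>2) \<or> (\<pi> = \<pi>2 \<and> \<pi>' = \<pi>1)" by blast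
        have ps: "path_system \<pi>" "path_system \<pi>'" using \<pi> p12 by auto
        obtain \<pi>'' where \<pi>'': "path_system \<pi>''" "\<And>r c. r \<in> Rows \<Longrightarrow> \<pi>'' r = c \<and> \<pi>'' r \<noteq> r \<longleftrightarrow>
            (if ?A r c then \<pi> r = c \<and> \<pi> r \<noteq> r else \<pi>' r = c \<and> \<pi>' r \<noteq> r)"
          using mix[OF ps] by blast
        \<comment> \<open>An element of an inner block is both a row and a column, so a path system
          enters it iff it leaves it. With two colours the mixed system would enter \<open>x\<close>
          as one of the two systems does and leave it as the other.\<close>
        have entered: "(\<exists>y\<in>Rows. \<pi> y = x \<and> \<pi> y \<noteq> y) \<longleftrightarrow> \<pi> x \<noteq> x" if h: "path_system \<pi>" "x \<in> block B" for \<pi> x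
        proof -
          have inj: "inj_on \<pi> Rows" using h(1) by (simp add: path_system_def bij_betw_def)
          obtain y where y: "y \<in> Rows" "\<pi> y = x"
            using path_system_surj[OF h(1) blockB(2)[OF h(2)]] by blast
          show ?thesis
          proof (cases "\<pi> x = x")
            case True
            have "y' = x" if "y' \<in> Rows" "\<pi> y' = x" for y'
              by (rule inj_onD[OF inj]) (simp_all only: that True blockB(1)[OF h(2)])
            thus ?thesis using True by metis
          next
            case False
            with y have "\<pi> y \<noteq> y" by metis
            with False y show ?thesis by metis
          qed
        qed
        obtain x where x: "x \<in> block B" "level b x = I - 1"
        proof -
          have "I - 1 < card (block (b (Suc r)))" using big by (simp add: B_def)
          from level_range(2)[OF XR(2) this] show thesis using that by (auto simp: B_def)
        qed
        have x1: "\<pi>1 x \<noteq> x" "\<pi>2 x = x"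
          using moves[OF t \<pi>1_def blockB(1)[OF x(1)]] moves[OF t' \<pi>2_def blockB(1)[OF x(1)]] x size
          by (auto simp: tr'_def \<sigma>_def)
        have enter'': "(\<exists>y\<in>Rows. \<pi>'' y = x \<and> \<pi>'' y \<noteq> y) \<longleftrightarrow>
            (if red r then \<pi> x \<noteq> x else \<pi>' x \<noteq> x)"
        proof -
          have "(\<pi>'' y = x \<and> \<pi>'' y \<noteq> y) \<longleftrightarrow> (if red r then \<pi> y = x \<and> \<pi> y \<noteq> y else \<pi>' y = x \<and> \<pi>' y \<noteq> y)"
            if "y \<in> Rows" for y
          proof (cases "edge y x")
            case True
            thus ?thesis using \<pi>''(2)[OF that, of x] into[OF True x(1)] by simp
          next
            case False
            thus ?thesis using edgeI[OF \<pi>''(1) that] edgeI[OF ps(1) that] edgeI[OF ps(2) that] by auto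
          qed
          thus ?thesis using entered[OF ps(1) x(1)] entered[OF ps(2) x(1)] by (cases "red r") auto
        qed
        have leave'': "\<pi>'' x \<noteq> x \<longleftrightarrow> (if red (Suc r) then \<pi> x \<noteq> x else \<pi>' x \<noteq> x)"
        proof -
          have "(\<pi>'' x = y \<and> \<pi>'' x \<noteq> x) \<longleftrightarrow> (if red (Suc r) then \<pi> x = y \<and> \<pi> x \<noteq> x else \<pi>' x = y \<and> \<pi>' x \<noteq> x)" for y
          proof (cases "edge x y")
            case True
            thus ?thesis using \<pi>''(2)[OF blockB(1)[OF x(1)], of y] out[OF True x(1)] by simp
          next
            case False
            thus ?thesis using edgeI[OF \<pi>''(1) blockB(1)[OF x(1)]] edgeI[OF ps(1) blockB(1)[OF x(1)]]
              edgeI[OF ps(2) blockB(1)[OF x(1)]] by auto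
          qed
          thus ?thesis by (cases "red (Suc r)") auto
        qed
        show False
          using enter'' leave'' entered[OF \<pi>''(1) x(1)] x1 neq \<pi> by (auto split: if_splits)
      qed
    qed
  qed
  have all: "red x \<longleftrightarrow> red off" if "x \<in> Rows" for x
  proof -
    have "off \<le> x" "x < N - I" using that by (auto simp: Rows_def)
    thus ?thesis
    proof (induction x rule: dec_induct)
      case (step x)
      thus ?case using \<open>\<And>r. r \<in> Rows \<Longrightarrow> Suc r \<in> Rows \<Longrightarrow> red r \<longleftrightarrow> red (Suc r)\<close>[of x] by (auto simp: Rows_def)
    qed simp
  qed
  have colour: "x \<in> A \<longleftrightarrow> red off" if h: "x \<in> mvars F" for x
  proof -
    obtain r c where rc: "x = (Suc r, Suc c)" "r \<in> Rows" using mvars_F_rising[OF h] by metis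
    hence "edge r c" using h by (simp add: edge_def)
    thus ?thesis using red_iff[of r c] all[OF rc(2)] rc(1) by blast
  qed
  thus ?thesis using A by (cases "red off") auto
qed

lemma irreducible_F: "irreducible F"
  by (rule irreducible_multiaffineI[OF mvars_F_nonempty keys_F_affine monochromatic])

end

subsection \<open>Vanishing of the polynomial\<close>

lemma order_zero_le_if_coeff_nonzero:
  fixes p :: "complex poly"
  assumes "coeff p n \<noteq> 0"
  shows "order 0 p \<le> n"
proof -
  have "p \<noteq> 0" using assms by auto
  moreover have "\<not> monom 1 (Suc n) dvd p" using assms by (auto simp: monom_1_dvd_iff')
  ultimately show ?thesis
    using order_divides[of 0 "Suc n" p] by (simp add: monom_altdef)
qed

text \<open>Orders at zero are additive, and a nonzero coefficient bounds the order from
  above.\<close>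

lemma not_monom_dvd_mult:
  fixes p q :: "complex poly"
  assumes "coeff p i \<noteq> 0" "coeff q j \<noteq> 0"
  shows "\<not> monom 1 (Suc (i + j)) dvd p * q"
proof
  assume "monom 1 (Suc (i + j)) dvd p * q"
  hence "[:- 0, 1:] ^ Suc (i + j) dvd p * q" by (simp only: monom_altdef smult_1_left neg_0_equal_iff_equal) simp
  moreover have "p * q \<noteq> 0" using assms by auto
  ultimately have "Suc (i + j) \<le> order 0 (p * q)" by (simp only: order_divides) blast
  also have "\<dots> = order 0 p + order 0 q" using \<open>p * q \<noteq> 0\<close> by (rule order_mult)
  finally show False
    using order_zero_le_if_coeff_nonzero[OF assms(1)] order_zero_le_if_coeff_nonzero[OF assms(2)] by simp
qed

lemma pencil_minor_cong:
  assumes "\<And>i j. i < n \<Longrightarrow> j < n \<Longrightarrow> a (f i) (g j) = a' (f i) (g j)"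
  shows "pencil_minor a n f g = pencil_minor a' n f g"
  unfolding pencil_minor_def by (intro arg_cong[of _ _ det] eq_matI) (auto simp: pencil_def assms)

context chain_pair
begin

lemma level_function_lessThan: "k \<le> N \<Longrightarrow> level_function {..<k} b (level b)"
  using level_function_interval[of 0 b k] mono[of 0] by (simp add: lessThan_atLeast0)

text \<open>Extend the given minor of the corner up to the first chain by the minor defining \<open>F\<close>. Modulo
  the next power of \<open>t\<close>, the terms of the larger minor that use the lower left block vanish: the
  columns of that block belong to indices up to the first chain, so such a term fixes an index of
  the first chain, which a term of minimal order cannot do.\<close>

lemma peval_F_eq_0:
  assumes A: "\<And>r c. r < N \<Longrightarrow> c < N \<Longrightarrow> A $$ (r, c) \<noteq> 0 \<Longrightarrow> b r < b c"
    and fg: "\<And>i. i < off \<Longrightarrow> f i < off + I" "\<And>i. i < off \<Longrightarrow> g i < off + I"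
    and nz: "coeff (pencil_minor (\<lambda>r c. A $$ (r, c)) off f g) (card {x \<in> {..<off + I}. I \<le> level b x}) \<noteq> 0"
    and dvd: "\<And>f g. (\<And>i. i < N - I \<Longrightarrow> f i < N) \<Longrightarrow> (\<And>i. i < N - I \<Longrightarrow> g i < N) \<Longrightarrow>
      monom 1 (Suc (card {x \<in> {..<N}. I \<le> level b x})) dvd pencil_minor (\<lambda>r c. A $$ (r, c)) (N - I) f g"
  shows "peval F A = 0"
proof (rule ccontr)
  assume F0: "peval F A \<noteq> 0"
  define M where "M = off + I"
  let ?a = "\<lambda>r c. A $$ (r, c)"
  let ?e1 = "card {x \<in> {..<M}. I \<le> level b x}"
  let ?e0 = "card {x \<in> {..<N}. I \<le> level b x}"
  have MN: "M < N" using size by (simp add: M_def)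
  have lvlM: "level_function {..<M} b (level b)" and lvlN: "level_function {..<N} b (level b)"
    using level_function_lessThan MN by auto
  have bM: "b x \<le> J" if "x < M" for x
  proof (cases "x < off")
    case True
    thus ?thesis using before by (simp add: less_imp_le)
  next
    case False
    hence "x \<in> {x \<in> {off..<N}. b x = J}" unfolding first using that by (simp add: M_def)
    thus ?thesis by simp
  qed
  have bJ: "b x = J \<longleftrightarrow> off \<le> x \<and> x < M" if "x < N" for x
  proof (cases "x < off")
    case True
    thus ?thesis using before[OF True] by simp
  next
    case False
    hence "b x = J \<longleftrightarrow> x \<in> {x \<in> {off..<N}. b x = J}" using that by simp
    thus ?thesis unfolding first using False by (simp add: M_def)
  qed
  have lt_off: "b x < J \<longleftrightarrow> x < off" if "x < M" for x
    using before[of x] bJ[of x] that MN by (cases "x < off") auto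
  \<comment> \<open>The two ranges overlap in the first chain of the pair, which has only
    \<open>I\<close> elements and so none of level \<open>I\<close> or more; nothing is counted
    twice.\<close>
  have e_sum: "?e0 = ?e1 + e"
  proof -
    have low: "level b x < I" if "off \<le> x" "x < M" for x
      using level_range(1)[of x] bJ[of x] that MN card_first_block by (simp add: X_def)
    have "{x \<in> {..<N}. I \<le> level b x} = {x \<in> {..<M}. I \<le> level b x} \<union> {x \<in> X. I \<le> level b x}"
      using MN by (auto simp: X_def M_def not_le)
    moreover have "{x \<in> {..<M}. I \<le> level b x} \<inter> {x \<in> X. I \<le> level b x} = {}"
      using low by (force simp: X_def)
    ultimately show ?thesis by (simp add: e_def card_Un_disjoint)
  qed

  have inj: "inj_on f {..<off}" "inj_on g {..<off}"
  proof -
    have "pencil_minor ?a off f g \<noteq> 0" using nz by (metis coeff_0)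
    thus "inj_on f {..<off}" "inj_on g {..<off}" using pencil_minor_not_inj by metis+
  qed
  obtain p where p: "p permutes {0..<off}"
    and pz: "coeff (\<Prod>i = 0..<off. pencil ?a (f i) (g (p i))) ?e1 \<noteq> 0"
  proof -
    have "(\<Sum>p | p permutes {0..<off}. of_int (sign p) * coeff (\<Prod>i = 0..<off. pencil ?a (f i) (g (p i))) ?e1) \<noteq> 0"
      using nz unfolding pencil_minor_def det_mat M_def[symmetric] by (simp add: coeff_sum coeff_of_int_mult)
    then obtain p where "p permutes {0..<off}"
      "of_int (sign p) * coeff (\<Prod>i = 0..<off. pencil ?a (f i) (g (p i))) ?e1 \<noteq> 0"
      by (rule sum.not_neutral_contains_not_neutral) blast
    thus thesis using that by auto
  qed
  have pz': "(\<Prod>i = 0..<off. pencil ?a (f i) (g (p i))) \<noteq> 0" using pz by (metis coeff_0)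
  \<comment> \<open>A term of minimal order fixes no element of the block \<open>J\<close>, since
    that block has \<open>I\<close> elements. The block is then tight, so every index before
    \<open>off\<close> is a row of the minor, and there are only \<open>off\<close> rows.\<close>
  have f_image: "f ` {..<off} = {..<off}"
  proof -
    define \<pi> where "\<pi> = (\<lambda>r. g (p (the_inv_into {..<off} f r)))"
    have T: "rising_injection {..<M} (f ` {..<off}) \<pi> b I"
      "monom 1 (card {r \<in> f ` {..<off}. \<pi> r = r}) dvd (\<Prod>i = 0..<off. pencil ?a (f i) (g (p i)))"
    proof -
      have inc: "b r < b c" if "r < M" "c < M" "A $$ (r, c) \<noteq> 0" for r c
        using A[of r c] that MN by simp
      note terms = pencil_minor_term[OF inc fg[folded M_def] inj M_def p pz']
      show "rising_injection {..<M} (f ` {..<off}) \<pi> b I"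
        unfolding \<pi>_def by (rule terms(1))
      show "monom 1 (card {r \<in> f ` {..<off}. \<pi> r = r}) dvd (\<Prod>i = 0..<off. pencil ?a (f i) (g (p i)))"
        unfolding \<pi>_def by (rule terms(3))
    qed
    interpret rising_injection "{..<M}" "f ` {..<off}" \<pi> b I by (rule T(1))
    have "card Fix \<le> ?e1"
      using T(2) pz unfolding Fix_def monom_1_dvd_iff' by (meson not_le)
    hence "card Fix = ?e1" using card_level_le_Fix[OF lvlM] by simp
    from card_Fix_block_eq[OF lvlM this, of J]
    have "card {r \<in> Fix. b r = J} = card {x \<in> {..<M}. b x = J} - I" .
    moreover have "{x \<in> {..<M}. b x = J} = {off..<M}" using bJ MN by auto
    ultimately have "card {x \<in> {..<M}. b x = J} = card {r \<in> Fix. b r = J} + I"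
      by (simp add: M_def)
    from tight_block(1)[OF this] have "{..<off} \<subseteq> f ` {..<off}"
      using lt_off by (auto simp: M_def)
    thus ?thesis by (rule card_subset_eq[symmetric, rotated]) (use inj in \<open>auto simp: card_image\<close>)
  qed

  \<comment> \<open>The given minor of the corner, extended by the rows and columns of the minor
    that defines \<open>F\<close>.\<close>
  define f' g' where "f' i = (if i < off then f i else i)" and "g' i = (if i < off then g i else I + i)" for i
  let ?n = "N - I"
  have n: "?n = off + m" "?n \<le> N" using size by auto
  have f'N: "f' i < N" if "i < ?n" for i using that fg(1)[of i] MN by (auto simp: f'_def M_def)
  have g'N: "g' i < N" if "i < ?n" for i using that fg(2)[of i] MN by (auto simp: g'_def M_def)
  have f_off: "f i < off" if "i < off" for i using f_image that by auto
  have f'inj: "inj_on f' {..<?n}"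
  proof (rule inj_onI)
    fix x y assume "x \<in> {..<?n}" "y \<in> {..<?n}" "f' x = f' y"
    thus "x = y" using f_off[of x] f_off[of y] inj_onD[OF inj(1), of x y] by (auto simp: f'_def split: if_splits)
  qed
  have g'inj: "inj_on g' {..<?n}"
  proof (rule inj_onI)
    fix x y assume "x \<in> {..<?n}" "y \<in> {..<?n}" "g' x = g' y"
    thus "x = y" using fg(2)[of x] fg(2)[of y] inj_onD[OF inj(2), of x y] by (auto simp: g'_def split: if_splits)
  qed
  \<comment> \<open>\<open>h0\<close> is \<open>h\<close> with the lower left block replaced by
    zero, which turns the determinant into the product of the two minors.\<close>
  define h h0 where "h i j = pencil ?a (f' i) (g' j)"
    and "h0 i j = (if off \<le> i \<and> j < off then 0 else pencil ?a (f' i) (g' j))" for i j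

  have "monom 1 (Suc ?e0) dvd (\<Prod>i = 0..<?n. h i (p i)) - (\<Prod>i = 0..<?n. h0 i (p i))"
    if p: "p permutes {0..<?n}" for p
  proof (cases "(\<exists>i<?n. off \<le> i \<and> p i < off) \<and> (\<Prod>i = 0..<?n. h i (p i)) \<noteq> 0")
    case False
    have "(\<Prod>i = 0..<?n. h i (p i)) = (\<Prod>i = 0..<?n. h0 i (p i))"
    proof (cases "\<exists>i<?n. off \<le> i \<and> p i < off")
      case True
      then obtain i where "i < ?n" "off \<le> i" "p i < off" by auto
      hence "(\<Prod>i = 0..<?n. h0 i (p i)) = 0"
        by (intro prod_zero) (auto simp: h0_def intro!: bexI[of _ i])
      moreover have "(\<Prod>i = 0..<?n. h i (p i)) = 0" using False True by blast
      ultimately show ?thesis by (simp only:)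
    next
      case False
      thus ?thesis by (intro prod.cong refl) (auto simp: h_def h0_def)
    qed
    thus ?thesis by simp
  next
    case True
    then obtain i where i: "i < ?n" "off \<le> i" "p i < off" by auto
    have hz: "(\<Prod>i = 0..<?n. pencil ?a (f' i) (g' (p i))) \<noteq> 0" using True by (simp add: h_def)
    define \<pi> where "\<pi> = (\<lambda>r. g' (p (the_inv_into {..<?n} f' r)))"
    have T: "rising_injection {..<N} (f' ` {..<?n}) \<pi> b I" "\<And>i. i < ?n \<Longrightarrow> \<pi> (f' i) = g' (p i)"
      "monom 1 (card {r \<in> f' ` {..<?n}. \<pi> r = r}) dvd (\<Prod>i = 0..<?n. pencil ?a (f' i) (g' (p i)))"
    proof -
      have N: "N = ?n + I" using size by simp
      note terms = pencil_minor_term[OF A f'N g'N f'inj g'inj N p hz]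
      show "rising_injection {..<N} (f' ` {..<?n}) \<pi> b I"
        unfolding \<pi>_def by (rule terms(1))
      show "\<And>i. i < ?n \<Longrightarrow> \<pi> (f' i) = g' (p i)"
        unfolding \<pi>_def by (rule terms(2))
      show "monom 1 (card {r \<in> f' ` {..<?n}. \<pi> r = r}) dvd (\<Prod>i = 0..<?n. pencil ?a (f' i) (g' (p i)))"
        unfolding \<pi>_def by (rule terms(3))
    qed
    interpret rising_injection "{..<N}" "f' ` {..<?n}" \<pi> b I by (rule T(1))
    have \<pi>i: "\<pi> i = g (p i)" "i \<in> f' ` {..<?n}"
      using T(2)[OF i(1)] i by (auto simp: f'_def g'_def intro!: image_eqI[of _ _ i])
    have "b (\<pi> i) \<le> J" unfolding \<pi>i(1) using bM fg(2)[OF i(3)] by (simp add: M_def)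
    moreover have "J \<le> b i" by (rule mono) (use i in simp_all)
    ultimately have "\<not> b i < b (\<pi> i)" by simp
    hence fixi: "i \<in> Fix" using rise[OF \<pi>i(2)] \<pi>i(2) by (auto simp: Fix_def)
    hence "i < M" using \<pi>i fg(2)[OF i(3)] by (auto simp: Fix_def M_def)
    hence bi: "b i = J" using bJ i MN by auto
    have "card Fix \<noteq> ?e0"
    proof
      assume "card Fix = ?e0"
      from card_Fix_block_eq[OF lvlN this, of J]
      have "card {r \<in> Fix. b r = J} = card {x \<in> {..<N}. b x = J} - I" .
      moreover have "{x \<in> {..<N}. b x = J} = {off..<M}" using bJ MN by auto
      ultimately have "card {r \<in> Fix. b r = J} = 0" by (simp add: M_def)
      thus False using fixi bi finite_Fix by auto
    qed
    hence "Suc ?e0 \<le> card Fix" using card_level_le_Fix[OF lvlN] by simp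
    hence "monom 1 (Suc ?e0) dvd (\<Prod>i = 0..<?n. h i (p i))"
      using T(3) monom_le_dvd[of "Suc ?e0" "card Fix"] unfolding Fix_def h_def by (blast intro: dvd_trans)
    moreover have "(\<Prod>i = 0..<?n. h0 i (p i)) = 0"
      using i by (intro prod_zero) (auto simp: h0_def intro!: bexI[of _ i])
    ultimately show ?thesis by (simp only: diff_0_right)
  qed
  hence "monom 1 (Suc ?e0) dvd (\<Sum>p | p permutes {0..<?n}. signof p *
      ((\<Prod>i = 0..<?n. h i (p i)) - (\<Prod>i = 0..<?n. h0 i (p i))))"
    by (intro dvd_sum dvd_mult) auto
  also have "\<dots> = det (mat ?n ?n (\<lambda>(i, j). h i j)) - det (mat ?n ?n (\<lambda>(i, j). h0 i j))"
    unfolding det_mat by (simp add: sum_subtractf right_diff_distrib)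
  finally have "monom 1 (Suc ?e0) dvd det (mat ?n ?n (\<lambda>(i, j). h0 i j))"
    using dvd[OF f'N g'N] unfolding pencil_minor_def h_def[symmetric] by (simp add: dvd_diff_right_iff)
  moreover have "det (mat ?n ?n (\<lambda>(i, j). h0 i j)) = pencil_minor ?a off f g *
      pencil_minor ?a m (\<lambda>i. off + i) (\<lambda>i. off + I + i)"
  proof -
    let ?B = "four_block_mat (mat off off (\<lambda>(i, j). pencil ?a (f i) (g j)))
      (mat off m (\<lambda>(i, j). pencil ?a (f i) (off + I + j))) (0\<^sub>m m off)
      (mat m m (\<lambda>(i, j). pencil ?a (off + i) (off + I + j)))"
    have eq: "mat ?n ?n (\<lambda>(i, j). h0 i j) = ?B"
    proof (rule eq_matI)
      fix i j assume "i < dim_row ?B" "j < dim_col ?B"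
      hence ij: "i < off + m" "j < off + m" by simp_all
      have *: "off + (i - off) = i" "off + I + (j - off) = I + j" if "\<not> i < off" "\<not> j < off" using that by simp_all
      have **: "off + I + (j - off) = I + j" if "\<not> j < off" using that by simp
      show "mat ?n ?n (\<lambda>(i, j). h0 i j) $$ (i, j) = ?B $$ (i, j)"
        using ij n(1) by (cases "i < off"; cases "j < off")
          (simp_all add: h0_def f'_def g'_def * ** del: add_diff_assoc)
    qed (simp_all only: n(1) dim_row_mat dim_col_mat index_mat_four_block)
    show ?thesis unfolding pencil_minor_def eq
      by (rule det_four_block_mat_lower_left_zero) (rule mat_carrier refl)+
  qed
  moreover have "pencil_minor ?a m (\<lambda>i. off + i) (\<lambda>i. off + I + i) =
      pencil_minor (\<lambda>r c. if b r < b c then A $$ (r, c) else 0) m (\<lambda>i. off + i) (\<lambda>i. off + I + i)"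
  proof (rule pencil_minor_cong)
    fix i j assume "i < m" "j < m"
    hence "off + i < N" "off + I + j < N" by linarith+
    thus "A $$ (off + i, off + I + j) = (if b (off + i) < b (off + I + j) then A $$ (off + i, off + I + j) else 0)"
      using A[of "off + i" "off + I + j"] by auto
  qed
  ultimately have "monom 1 (Suc (?e1 + e)) dvd pencil_minor ?a off f g *
      pencil_minor (\<lambda>r c. if b r < b c then A $$ (r, c) else 0) m (\<lambda>i. off + i) (\<lambda>i. off + I + i)"
    by (simp only: e_sum)
  thus False
    using not_monom_dvd_mult[OF nz[folded M_def] F0[unfolded peval_F]] by blast
qed

end

subsection \<open>Blocks of a parabolic subalgebra\<close>

text \<open>Matrix indices start at 0, so the simple root \<open>i\<close> separates the indices \<open>i - 1\<close> and \<open>i\<close>;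
  \<open>blk \<tau> x\<close> is the number of the chain containing the index \<open>x\<close>.\<close>

definition blk :: "nat set \<Rightarrow> nat \<Rightarrow> nat" where
  "blk \<tau> x = card ({1..x} - \<tau>)"

lemma blk_0 [simp]: "blk \<tau> 0 = 0"
  by (simp add: blk_def)

lemma blk_Suc: "blk \<tau> (Suc x) = blk \<tau> x + (if Suc x \<in> \<tau> then 0 else 1)"
proof -
  have "{1..Suc x} - \<tau> = (if Suc x \<in> \<tau> then {1..x} - \<tau> else insert (Suc x) ({1..x} - \<tau>))"
    by (auto simp: le_Suc_eq)
  thus ?thesis by (simp add: blk_def)
qed

lemma blk_mono: "x \<le> y \<Longrightarrow> blk \<tau> x \<le> blk \<tau> y"
  by (induction y rule: dec_induct) (auto simp: blk_Suc)

text \<open>The number of chain borders between \<open>r\<close> and \<open>c\<close> is the number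
  of simple roots there outside \<tau>. So the block number rises exactly at the positions of the
  roots outside \<open>pos_roots_of\<close>.\<close>

lemma blk_less_iff: "blk \<tau> r < blk \<tau> c \<longleftrightarrow> r < c \<and> \<not> {Suc r..c} \<subseteq> \<tau>"
proof (cases "r < c")
  case True
  have "{1..c} - \<tau> = ({1..r} - \<tau>) \<union> ({Suc r..c} - \<tau>)" using True by auto
  moreover have "({1..r} - \<tau>) \<inter> ({Suc r..c} - \<tau>) = {}" by auto
  ultimately have "blk \<tau> c = blk \<tau> r + card ({Suc r..c} - \<tau>)"
    unfolding blk_def by (simp add: card_Un_disjoint)
  thus ?thesis using True by (auto simp: card_gt_0_iff)
next
  case False
  thus ?thesis using blk_mono[of c r \<tau>] by simp
qed

lemma mem_positions: "(Suc r, Suc c) \<in> positions R \<longleftrightarrow> (Suc r, c) \<in> R"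
  by (auto simp: positions_def)

lemma positions_m_space:
  "(Suc r, Suc c) \<in> positions (pos_roots N - pos_roots_of N \<tau>) \<longleftrightarrow> c < N \<and> blk \<tau> r < blk \<tau> c"
  unfolding mem_positions by (auto simp: pos_roots_def pos_roots_of_def blk_less_iff)

lemma m_space_iff:
  "A \<in> m_space N \<tau> \<longleftrightarrow> A \<in> carrier_mat N N \<and>
    (\<forall>r<N. \<forall>c<N. A $$ (r, c) \<noteq> 0 \<longrightarrow> blk \<tau> r < blk \<tau> c)"
  unfolding m_space_def span_of_roots_def positions_m_space by auto

lemma level_function_blk: "level_function {..<k} (blk \<tau>) (level (blk \<tau>))"
  using level_function_interval[of 0 "blk \<tau>" k] by (simp add: lessThan_atLeast0)

lemma level_le: "level b x \<le> x"
proof -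
  have "level b x \<le> card {..<x}" unfolding level_def by (rule card_mono) auto
  thus ?thesis by simp
qed

lemma level_below:
  assumes "u \<le> level b x"
  shows "\<exists>y\<le>x. b y = b x \<and> level b y = u"
proof (cases "u = level b x")
  case False
  let ?S = "{y. y < x \<and> b y = b x}"
  have "bij_betw (\<lambda>y. card {z \<in> ?S. z < y}) ?S {..<card ?S}"
    by (rule bij_betw_rank) auto
  moreover have "u < card ?S" using False assms by (simp add: level_def)
  ultimately obtain y where y: "y \<in> ?S" "card {z \<in> ?S. z < y} = u"
    unfolding bij_betw_def by (metis (no_types, lifting) imageE lessThan_iff)
  moreover have "{z \<in> ?S. z < y} = {z. z < y \<and> b z = b y}" using y by auto
  ultimately show ?thesis by (intro exI[of _ y]) (auto simp: level_def)
qed auto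

lemma level_inj:
  assumes "b x = b y" "level b x = level b y"
  shows "x = y"
proof -
  have "level b x < level b y" if "x < y" "b x = b y" for x y
    unfolding level_def by (rule psubset_card_mono) (use that in auto)
  thus ?thesis using assms by (metis less_irrefl linorder_neqE_nat)
qed

subsection \<open>Tableaux\<close>

text \<open>Rows are counted from 0 here, as levels are, whereas \<open>row_set\<close> and
  \<open>row_length\<close> count from 1.\<close>

definition row_of :: "nat list list \<Rightarrow> nat \<Rightarrow> nat" where
  "row_of T y = (THE i. i < length T \<and> y \<in> set (T ! i))"

lemma distinct_concat_nth:
  "distinct (concat T) \<Longrightarrow> i < length T \<Longrightarrow> j < length T \<Longrightarrow> y \<in> set (T ! i) \<Longrightarrow> y \<in> set (T ! j) \<Longrightarrow> i = j"
proof (induction T arbitrary: i j)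
  case (Cons r T)
  show ?case
  proof (cases i; cases j)
    fix j' assume "i = 0" "j = Suc j'"
    hence "y \<in> set r" "y \<in> set (concat T)" using Cons.prems by (auto intro: nth_mem)
    thus ?thesis using Cons.prems by auto
  next
    fix i' assume "i = Suc i'" "j = 0"
    hence "y \<in> set r" "y \<in> set (concat T)" using Cons.prems by (auto intro: nth_mem)
    thus ?thesis using Cons.prems by auto
  next
    fix i' j' assume "i = Suc i'" "j = Suc j'"
    thus ?thesis using Cons.IH[of i' j'] Cons.prems by auto
  qed simp
qed simp

text \<open>In a weakly decreasing list the zeros come last, so removing them does not shift the
  entries skipped by \<open>drop\<close>.\<close>

lemma sum_list_drop_filter_nonzero:
  "sorted_wrt (\<ge>) ns \<Longrightarrow> sum_list (drop q (filter (\<lambda>l. l \<noteq> 0) ns)) = sum_list (drop q (ns :: nat list))"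
proof (induction ns arbitrary: q)
  case (Cons n ns)
  show ?case
  proof (cases "n = 0")
    case True
    hence z: "\<forall>l\<in>set ns. l = 0" using Cons.prems by auto
    hence "filter (\<lambda>l. l \<noteq> 0) (n # ns) = []" using True by (auto simp: filter_empty_conv)
    moreover have "\<forall>l\<in>set (drop q (n # ns)). l = 0"
      using z True in_set_dropD[of _ q "n # ns"] by auto
    ultimately show ?thesis by (simp add: sum_list_eq_0_iff del: filter.simps)
  next
    case False
    show ?thesis using Cons.prems Cons.IH[of 0] Cons.IH[of "q - 1"] False by (cases q) auto
  qed
qed simp

lemma length_le_sum_list: "0 \<notin> set \<mu> \<Longrightarrow> length \<mu> \<le> sum_list (\<mu> :: nat list)"
proof (induction \<mu>)
  case (Cons l \<mu>)
  thus ?case by (cases l) auto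
qed simp

locale tableau =
  fixes N :: nat and T :: "nat list list"
  assumes T: "standard_tableau N T"
begin

lemma distinct_entries: "distinct (concat T)"
proof (rule card_distinct)
  have "length (concat T) = N"
    using T by (simp add: standard_tableau_def partition_of_def length_concat)
  thus "card (set (concat T)) = length (concat T)"
    using T by (simp add: standard_tableau_def del: set_concat)
qed

lemma row_of_eq: "i < length T \<Longrightarrow> y \<in> set (T ! i) \<Longrightarrow> row_of T y = i"
  unfolding row_of_def using distinct_concat_nth[OF distinct_entries] by (intro the_equality) auto

lemma row_of:
  assumes "1 \<le> y" "y \<le> N"
  shows "row_of T y < length T" "y \<in> set (T ! row_of T y)"
proof -
  have "y \<in> set (concat T)" using assms T by (simp add: standard_tableau_def del: set_concat)
  then obtain r where "r \<in> set T" "y \<in> set r" by auto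
  then obtain i where "i < length T" "y \<in> set (T ! i)" by (metis in_set_conv_nth)
  with row_of_eq[OF this] show "row_of T y < length T" "y \<in> set (T ! row_of T y)" by auto
qed

lemma entry_bounds: "i < length T \<Longrightarrow> y \<in> set (T ! i) \<Longrightarrow> 1 \<le> y \<and> y \<le> N"
proof -
  assume "i < length T" "y \<in> set (T ! i)"
  hence "y \<in> set (concat T)" by (auto intro: nth_mem)
  thus ?thesis using T by (simp add: standard_tableau_def del: set_concat)
qed

lemma set_row: "i < length T \<Longrightarrow> set (T ! i) = {y. 1 \<le> y \<and> y \<le> N \<and> row_of T y = i}"
  using row_of row_of_eq entry_bounds by blast

lemma distinct_row: "i < length T \<Longrightarrow> distinct (T ! i)"
  using distinct_entries nth_mem[of i T] by (auto simp: distinct_concat_iff)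

lemma length_row: "i < length T \<Longrightarrow> length (T ! i) = card {y. 1 \<le> y \<and> y \<le> N \<and> row_of T y = i}"
  using distinct_card[OF distinct_row[of i]] set_row[of i] by simp

lemma row_set_eq: "1 \<le> m \<Longrightarrow> row_set T m = {y. 1 \<le> y \<and> y \<le> N \<and> row_of T y = m - 1}"
proof -
  assume m: "1 \<le> m"
  show ?thesis
  proof (cases "m \<le> length T")
    case True
    thus ?thesis using m set_row[of "m - 1"] by (simp add: row_set_def)
  next
    case False
    hence "row_of T y \<noteq> m - 1" if "1 \<le> y" "y \<le> N" for y using row_of(1)[OF that] by auto
    thus ?thesis using False by (auto simp: row_set_def)
  qed
qed

lemma row_length_eq: "1 \<le> m \<Longrightarrow> row_length T m = card {y. 1 \<le> y \<and> y \<le> N \<and> row_of T y = m - 1}"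
proof -
  assume m: "1 \<le> m"
  show ?thesis
  proof (cases "m \<le> length T")
    case True
    thus ?thesis using m length_row[of "m - 1"] by (simp add: row_length_def)
  next
    case False
    hence "row_of T y \<noteq> m - 1" if "1 \<le> y" "y \<le> N" for y using row_of(1)[OF that] by auto
    hence "{y. 1 \<le> y \<and> y \<le> N \<and> row_of T y = m - 1} = {}" by auto
    thus ?thesis using False by (simp add: row_length_def del: Collect_empty_eq)
  qed
qed

lemma row_length_antimono: "1 \<le> m \<Longrightarrow> row_length T (Suc m) \<le> row_length T m"
proof (cases "Suc m \<le> length T")
  case True
  assume "1 \<le> m"
  have "sorted_wrt (\<ge>) (map length T)" using T by (simp add: standard_tableau_def partition_of_def)
  from sorted_wrt_nth_less[OF this, of "m - 1" m] show ?thesis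
    using True \<open>1 \<le> m\<close> by (simp add: row_length_def)
qed (simp add: row_length_def)

text \<open>Columns increase downwards: an entry at most \<open>k\<close> has an entry at most
  \<open>k\<close> above it.\<close>

lemma restricted_counts_sorted: "sorted_wrt (\<ge>) (map (\<lambda>r. length (filter (\<lambda>e. e \<le> k) r)) T)"
proof (subst sorted_wrt_iff_nth_Suc_transp)
  show "transp ((\<ge>) :: nat \<Rightarrow> nat \<Rightarrow> bool)" by (auto intro: transpI)
  show "\<forall>i. Suc i < length (map (\<lambda>r. length (filter (\<lambda>e. e \<le> k) r)) T) \<longrightarrow>
      map (\<lambda>r. length (filter (\<lambda>e. e \<le> k) r)) T ! Suc i \<le> map (\<lambda>r. length (filter (\<lambda>e. e \<le> k) r)) T ! i"
  proof (intro allI impI)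
    fix i assume "Suc i < length (map (\<lambda>r. length (filter (\<lambda>e. e \<le> k) r)) T)"
    hence i: "Suc i < length T" by simp
    have "sorted_wrt (\<ge>) (map length T)" using T by (simp add: standard_tableau_def partition_of_def)
    from sorted_wrt_nth_less[OF this, of i "Suc i"] i have len: "length (T ! Suc i) \<le> length (T ! i)" by simp
    have "{j. j < length (T ! Suc i) \<and> T ! Suc i ! j \<le> k} \<subseteq> {j. j < length (T ! i) \<and> T ! i ! j \<le> k}"
    proof
      fix j assume j: "j \<in> {j. j < length (T ! Suc i) \<and> T ! Suc i ! j \<le> k}"
      hence "T ! i ! j < T ! Suc i ! j" using T i unfolding standard_tableau_def by blast
      thus "j \<in> {j. j < length (T ! i) \<and> T ! i ! j \<le> k}" using j len by auto
    qed
    hence "card {j. j < length (T ! Suc i) \<and> T ! Suc i ! j \<le> k} \<le> card {j. j < length (T ! i) \<and> T ! i ! j \<le> k}"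
      by (intro card_mono) auto
    thus "map (\<lambda>r. length (filter (\<lambda>e. e \<le> k) r)) T ! Suc i \<le> map (\<lambda>r. length (filter (\<lambda>e. e \<le> k) r)) T ! i"
      using i by (simp add: length_filter_conv_card)
  qed
qed

lemma restricted_shape_sorted: "sorted_wrt (\<ge>) (restricted_shape T k)" "0 \<notin> set (restricted_shape T k)"
  using restricted_counts_sorted[of k] by (auto simp: restricted_shape_def intro: sorted_wrt_filter)

text \<open>Brings the shape of a corner into the form in which it governs the orders of
  minors.\<close>

lemma sum_list_drop_restricted_shape:
  "sum_list (drop q (restricted_shape T k)) = card {y. 1 \<le> y \<and> y \<le> N \<and> y \<le> k \<and> q \<le> row_of T y}"
proof -
  let ?c = "\<lambda>i. length (filter (\<lambda>e. e \<le> k) (T ! i))"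
  have "sum_list (drop q (restricted_shape T k)) = sum_list (drop q (map (\<lambda>r. length (filter (\<lambda>e. e \<le> k) r)) T))"
    unfolding restricted_shape_def by (rule sum_list_drop_filter_nonzero[OF restricted_counts_sorted])
  also have "\<dots> = (\<Sum>i\<in>{0..<length T - q}. ?c (q + i))"
    by (simp add: sum_list_sum_nth)
  also have "\<dots> = (\<Sum>i\<in>{q..<length T}. ?c i)"
    by (rule sum.reindex_bij_witness[of _ "\<lambda>r. r - q" "\<lambda>r. q + r"]) auto
  also have "\<dots> = (\<Sum>i\<in>{q..<length T}. card {y. 1 \<le> y \<and> y \<le> N \<and> y \<le> k \<and> row_of T y = i})"
  proof (intro sum.cong refl)
    fix i assume i: "i \<in> {q..<length T}"
    have "?c i = card (set (filter (\<lambda>e. e \<le> k) (T ! i)))"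
      using distinct_row[of i] i by (simp add: distinct_card del: set_filter)
    also have "set (filter (\<lambda>e. e \<le> k) (T ! i)) = {y. 1 \<le> y \<and> y \<le> N \<and> y \<le> k \<and> row_of T y = i}"
      using set_row[of i] i by auto
    finally show "?c i = card {y. 1 \<le> y \<and> y \<le> N \<and> y \<le> k \<and> row_of T y = i}" .
  qed
  also have "\<dots> = card (\<Union>i\<in>{q..<length T}. {y. 1 \<le> y \<and> y \<le> N \<and> y \<le> k \<and> row_of T y = i})"
    by (rule card_UN_disjoint[symmetric]) auto
  also have "(\<Union>i\<in>{q..<length T}. {y. 1 \<le> y \<and> y \<le> N \<and> y \<le> k \<and> row_of T y = i}) =
      {y. 1 \<le> y \<and> y \<le> N \<and> y \<le> k \<and> q \<le> row_of T y}"
    using row_of(1) by auto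
  finally show ?thesis .
qed

end

subsection \<open>The tableau of the Richardson orbital variety\<close>

abbreviation truncate :: "complex mat \<Rightarrow> nat \<Rightarrow> complex mat" where
  "truncate A k \<equiv> mat k k (\<lambda>(i, j). A $$ (i, j))"

lemma orbital_variety_irreducible: "orbital_variety N V \<Longrightarrow> irreducible_in (zariski N) V"
  by (auto simp: orbital_variety_def irreducible_component_in_def)

lemma irreducible_subset_closure: "irreducible_in (zariski N) V \<Longrightarrow> V \<subseteq> zariski N closure_of V"
  by (rule closure_of_subset) (simp add: irreducible_in_def)

text \<open>The witness joins each index below \<open>k\<close> to the next one of the same level.
  That index lies in a later chain, so the matrix belongs to \<open>m_space\<close>. The hypothesis
  on \<open>q\<close> makes every level below \<open>q\<close> occur in the corner and hence have a
  last index there.\<close>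

lemma exists_track_minor:
  fixes \<tau> k q
  defines "b \<equiv> blk \<tau>"
  assumes q: "\<And>u. u < q \<Longrightarrow> \<exists>x<k. u \<le> level b x" and k: "k \<le> N"
  shows "\<exists>A f g. A \<in> m_space N \<tau> \<and> (\<forall>i<k - q. f i < k) \<and> (\<forall>i<k - q. g i < k) \<and>
    pencil_minor (\<lambda>r c. A $$ (r, c)) (k - q) f g = monom 1 (card {x \<in> {..<k}. q \<le> level b x})"
proof -
  define L where "L = {x. \<not> (\<exists>y<k. x < y \<and> level b y = level b x)}"
  define nxt where "nxt x = (LEAST y. x < y \<and> level b y = level b x)" for x
  have nxt: "x < nxt x \<and> level b (nxt x) = level b x \<and> nxt x < k" if h: "x \<notin> L" for x
  proof -
    obtain y where y: "y < k" "x < y \<and> level b y = level b x" using h by (auto simp: L_def)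
    from LeastI[of "\<lambda>y. x < y \<and> level b y = level b x", OF y(2)]
      Least_le[of "\<lambda>y. x < y \<and> level b y = level b x", OF y(2)] y(1)
    show ?thesis unfolding nxt_def by auto
  qed
  have least: "nxt x \<le> y" if "x < y" "level b y = level b x" for x y
    unfolding nxt_def by (rule Least_le) (use that in simp)
  have bless: "b x < b (nxt x)" if "x \<notin> L" for x
  proof -
    have "b x \<le> b (nxt x)" unfolding b_def using nxt[OF that] by (intro blk_mono) simp
    moreover have "b x \<noteq> b (nxt x)" using level_inj[of b x "nxt x"] nxt[OF that] by auto
    ultimately show ?thesis by simp
  qed
  have inj: "inj_on nxt ({..<k} - L)"
  proof (rule inj_onI)
    fix x y assume xy: "x \<in> {..<k} - L" "y \<in> {..<k} - L" "nxt x = nxt y"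
    hence l: "level b x = level b y" using nxt[of x] nxt[of y] by simp
    have "\<not> x < y" using least[of x y] nxt[of y] l xy by auto
    moreover have "\<not> y < x" using least[of y x] nxt[of x] l xy by auto
    ultimately show "x = y" by simp
  qed
  let ?S = "{x \<in> L. x < k \<and> level b x < q}"
  have "level b ` ?S = {..<q}"
  proof (intro subset_antisym subsetI)
    fix u assume "u \<in> {..<q}"
    then obtain x where "x < k" "u \<le> level b x" using q by auto
    then obtain y where y: "y < k" "level b y = u"
      using level_below[of u b x] by (metis order_le_less_trans)
    define z where "z = Max {y. y < k \<and> level b y = u}"
    have fin: "finite {y. y < k \<and> level b y = u}" "{y. y < k \<and> level b y = u} \<noteq> {}" using y by auto
    have z: "z < k" "level b z = u" using Max_in[OF fin] by (auto simp: z_def)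
    have "y \<le> z" if "y < k" "level b y = u" for y
      unfolding z_def using fin that by (intro Max_ge) auto
    hence "z \<in> L" using z by (force simp: L_def)
    thus "u \<in> level b ` ?S" using z \<open>u \<in> _\<close> by auto
  qed auto
  moreover have injL: "inj_on (level b) ?S"
  proof (rule inj_onI)
    fix x y assume xy: "x \<in> ?S" "y \<in> ?S" "level b x = level b y"
    thus "x = y" by (cases x y rule: linorder_cases) (auto simp: L_def)
  qed
  ultimately have card_L: "card ?S = q" using card_image[OF injL] by simp
  define A :: "complex mat" where "A = mat N N (\<lambda>(r, c). if r < k \<and> r \<notin> L \<and> c = nxt r then 1 else 0)"
  have "\<exists>f g. (\<forall>i<k - q. f i < k) \<and> (\<forall>i<k - q. g i < k) \<and>
    pencil_minor (\<lambda>r c. A $$ (r, c)) (k - q) f g = monom 1 (card {x \<in> {..<k}. q \<le> level b x})"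
    by (rule pencil_minor_tracks[where b = b and nxt = nxt and L = L])
      (use nxt bless inj card_L k in \<open>auto simp: A_def\<close>)
  moreover have "A \<in> m_space N \<tau>"
    unfolding m_space_iff A_def using bless by (auto simp: b_def)
  ultimately show ?thesis by blast
qed

text \<open>Restricting to the positions above the diagonal puts the coefficient into
  \<open>sym_alg\<close> and changes no value on \<open>m_space\<close>.\<close>

lemma peval_coeff_generic_minor:
  fixes \<tau> N f g n d
  defines "Q \<equiv> restrict_vars (positions (pos_roots N)) (coeff (pencil_minor (generic_entry (blk \<tau>)) n f g) d)"
  assumes "A \<in> m_space N \<tau>" "\<And>i. i < n \<Longrightarrow> f i < N" "\<And>i. i < n \<Longrightarrow> g i < N"
  shows "peval Q A = coeff (pencil_minor (\<lambda>r c. A $$ (r, c)) n f g) d" and "Q \<in> sym_alg N"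
proof -
  show "Q \<in> sym_alg N"
    unfolding Q_def sym_alg_def polys_in_iff by (rule mvars_restrict_vars)
  let ?P = "positions (pos_roots N)"
  have "peval Q A = coeff (pencil_minor (\<lambda>r c. if blk \<tau> r < blk \<tau> c then
      (if (Suc r, Suc c) \<in> ?P then entries A (Suc r, Suc c) else 0) else 0) n f g) d"
    unfolding Q_def peval_meval meval_restrict_vars meval_coeff_pencil_minor ..
  also have "\<dots> = coeff (pencil_minor (\<lambda>r c. A $$ (r, c)) n f g) d"
  proof (intro arg_cong2[of _ _ _ _ coeff] refl pencil_minor_cong)
    fix i j assume ij: "i < n" "j < n"
    show "(if blk \<tau> (f i) < blk \<tau> (g j) then
      (if (Suc (f i), Suc (g j)) \<in> ?P then entries A (Suc (f i), Suc (g j)) else 0) else 0) = A $$ (f i, g j)"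
      unfolding entries_Suc
      using assms(2) assms(3)[OF ij(1)] assms(4)[OF ij(2)]
      by (auto simp: m_space_iff positions_pos_roots blk_less_iff)
  qed
  finally show "peval Q A = coeff (pencil_minor (\<lambda>r c. A $$ (r, c)) n f g) d" .
qed

lemma pencil_minor_truncate:
  assumes "\<And>i. i < n \<Longrightarrow> f i < k" "\<And>i. i < n \<Longrightarrow> g i < k"
  shows "pencil_minor (\<lambda>r c. truncate A k $$ (r, c)) n f g = pencil_minor (\<lambda>r c. A $$ (r, c)) n f g"
  by (rule pencil_minor_cong) (use assms in auto)

text \<open>Both numbers are sharp orders of minors of the corner. One inequality holds for all of
  \<open>m_space\<close>. For the other, a coefficient that is nonzero at an explicit matrix is
  nonzero at some point of the open set where the Jordan types are those of \<open>T\<close>,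
  because \<open>V\<close> is dense in \<open>m_space\<close>.\<close>

theorem richardson_restricted_shape:
  assumes R: "richardson N \<tau> V" and assoc: "associated_tableau N V T" and k: "1 \<le> k" "k \<le> N"
  shows "sum_list (drop q (restricted_shape T k)) = card {x \<in> {..<k}. q \<le> level (blk \<tau>) x}"
proof -
  define b where "b = blk \<tau>"
  interpret tableau N T by unfold_locales (use assoc in \<open>simp add: associated_tableau_def\<close>)
  obtain U where U: "openin (subtopology (zariski N) V) U" "U \<noteq> {}"
    "\<And>A. A \<in> U \<Longrightarrow> nilpotent_jordan_type (truncate A k) (restricted_shape T k)"
    using assoc k unfolding associated_tableau_def by (metis atLeastAtMost_iff)
  have irr: "irreducible_in (zariski N) V"
    using R by (simp add: richardson_def orbital_variety_irreducible)
  have closure: "zariski N closure_of V = m_space N \<tau>" using R by (simp add: richardson_def)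
  have V: "V \<subseteq> m_space N \<tau>" using irreducible_subset_closure[OF irr] closure by simp
  have UV: "U \<subseteq> V" using openin_subset[OF U(1)] by auto
  let ?\<mu> = "restricted_shape T k"
  define S where "S q = sum_list (drop q ?\<mu>)" for q
  define E where "E q = card {x \<in> {..<k}. q \<le> level b x}" for q
  have E_mono: "E q' \<le> E q" if "q \<le> q'" for q q'
    unfolding E_def by (rule card_mono) (use that in auto)
  have S_mono: "S q' \<le> S q" if "q \<le> q'" for q q'
    unfolding S_def sum_list_drop_restricted_shape by (rule card_mono) (use that in auto)
  have ES: "E q \<le> S q" if q: "q \<le> length ?\<mu>" for q
  proof -
    obtain A where A: "A \<in> U" using U(2) by auto
    hence Am: "A \<in> m_space N \<tau>" using UV V by auto
    have "length ?\<mu> \<le> k"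
    proof -
      have "length ?\<mu> \<le> sum_list ?\<mu>" if "0 \<notin> set ?\<mu>"
        using that by (rule length_le_sum_list)
      moreover have "sum_list ?\<mu> = card {y. 1 \<le> y \<and> y \<le> N \<and> y \<le> k}"
        using sum_list_drop_restricted_shape[of 0 k] by simp
      moreover have "{y. 1 \<le> y \<and> y \<le> N \<and> y \<le> k} = {1..k}" using k by auto
      ultimately show ?thesis using restricted_shape_sorted(2)[of k] by simp
    qed
    hence n: "k = k - q + q" using q by simp
    obtain f g where fg: "\<forall>i<k - q. f i < k" "\<forall>i<k - q. g i < k"
      and nz: "coeff (pencil_minor (\<lambda>r c. truncate A k $$ (r, c)) (k - q) f g) (S q) \<noteq> 0"
      unfolding S_def using pencil_minor_jordan_type_coeff[OF restricted_shape_sorted U(3)[OF A] mat_carrier q] by blast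
    have "monom 1 (E q) dvd pencil_minor (\<lambda>r c. truncate A k $$ (r, c)) (k - q) f g"
      unfolding E_def b_def
    proof (rule pencil_minor_dvd[OF _ _ _ n level_function_blk])
      show "blk \<tau> r < blk \<tau> c" if "r < k" "c < k" "truncate A k $$ (r, c) \<noteq> 0" for r c
        using that Am k by (auto simp: m_space_iff)
    qed (use fg in auto)
    thus ?thesis using nz by (metis monom_1_dvd_iff' not_le)
  qed
  have SE: "S q \<le> E q" if q: "\<And>u. u < q \<Longrightarrow> E u \<noteq> 0" for q
  proof -
    have "\<exists>x<k. u \<le> level b x" if "u < q" for u
      using q[OF that] unfolding E_def by (metis (no_types, lifting) Collect_empty_eq card.empty lessThan_iff)
    from exists_track_minor[OF this[unfolded b_def] k(2)]
    obtain A f g where Afg: "A \<in> m_space N \<tau>" "\<forall>i<k - q. f i < k" "\<forall>i<k - q. g i < k"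
      "pencil_minor (\<lambda>r c. A $$ (r, c)) (k - q) f g = monom 1 (E q)"
      unfolding E_def b_def by blast
    define Q where "Q = restrict_vars (positions (pos_roots N)) (coeff (pencil_minor (generic_entry (blk \<tau>)) (k - q) f g) (E q))"
    have fgN: "\<And>i. i < k - q \<Longrightarrow> f i < N" "\<And>i. i < k - q \<Longrightarrow> g i < N" using Afg k by force+
    note Q = peval_coeff_generic_minor[where f = f and g = g and n = "k - q" and N = N and d = "E q" and \<tau> = \<tau>,
        folded Q_def, OF _ fgN]
    have "peval Q A \<noteq> 0" using Q(1)[OF Afg(1)] Afg(4) by simp
    hence "\<not> (\<forall>B\<in>V. peval Q B = 0)"
      using peval_closure_of[OF Q(2)[OF Afg(1)], of V A] closure Afg(1) irr by (auto simp: irreducible_in_def)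
    then obtain B where B: "B \<in> U" "peval Q B \<noteq> 0"
      using irreducible_in_dense[OF irr U(1,2) Q(2)[OF Afg(1)]] by blast
    have "B \<in> m_space N \<tau>" using B UV V by auto
    hence nz: "coeff (pencil_minor (\<lambda>r c. truncate B k $$ (r, c)) (k - q) f g) (E q) \<noteq> 0"
    proof -
      have "pencil_minor (\<lambda>r c. truncate B k $$ (r, c)) (k - q) f g = pencil_minor (\<lambda>r c. B $$ (r, c)) (k - q) f g"
        by (rule pencil_minor_truncate) (use Afg in auto)
      moreover have "peval Q B = coeff (pencil_minor (\<lambda>r c. B $$ (r, c)) (k - q) f g) (E q)"
        by (rule Q(1)[OF \<open>B \<in> m_space N \<tau>\<close>])
      ultimately show ?thesis using B(2) by metis
    qed
    have "q \<le> k"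
    proof (rule ccontr)
      assume "\<not> q \<le> k"
      then obtain x where "x < k" "k \<le> level b x" using \<open>\<And>u. u < q \<Longrightarrow> \<exists>x<k. u \<le> level b x\<close>[of k] by auto
      thus False using level_le[of b x] by simp
    qed
    hence "monom 1 (S q) dvd pencil_minor (\<lambda>r c. truncate B k $$ (r, c)) (k - q) f g"
      unfolding S_def using Afg
      by (intro pencil_minor_jordan_type_dvd[OF restricted_shape_sorted U(3)[OF B(1)]]) auto
    thus ?thesis using nz by (metis monom_1_dvd_iff' not_le)
  qed
  \<comment> \<open>\<open>S q <= E q\<close> is available only while all smaller levels occur. At
    the first missing level \<open>E\<close> is zero, hence so is \<open>S\<close>, and monotonicity
    covers all larger \<open>q\<close>.\<close>
  define c where "c = (LEAST q. E q = 0)"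
  have "E k = 0" unfolding E_def using level_le[of b] by (auto simp: not_le intro: le_less_trans)
  hence Ec: "E c = 0" unfolding c_def by (rule LeastI)
  have "E u \<noteq> 0" if "u < c" for u using not_less_Least[of u] that unfolding c_def by blast
  hence "S q \<le> E q" if "q \<le> c" for q using SE that by auto
  moreover have "S q \<le> E q" if "\<not> q \<le> c" for q
    using S_mono[of c q] calculation[of c] Ec that by simp
  moreover have "E q \<le> S q" if "\<not> q \<le> length ?\<mu>" for q
    using E_mono[of "length ?\<mu>" q] ES[of "length ?\<mu>"] that by (simp add: S_def)
  ultimately have "S q = E q" using ES by (meson antisym)
  thus ?thesis by (simp add: S_def E_def b_def)
qed

text \<open>Comparing the counts for the corners of sizes \<open>x\<close> and \<open>x + 1\<close>
  isolates the entry \<open>Suc x\<close>.\<close>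

theorem richardson_row_of:
  assumes R: "richardson N \<tau> V" and assoc: "associated_tableau N V T" and x: "x < N"
  shows "row_of T (Suc x) = level (blk \<tau>) x"
proof -
  interpret tableau N T by unfold_locales (use assoc in \<open>simp add: associated_tableau_def\<close>)
  have eq: "card {y. 1 \<le> y \<and> y \<le> N \<and> y \<le> k \<and> q \<le> row_of T y} = card {x \<in> {..<k}. q \<le> level (blk \<tau>) x}"
    if "k \<le> N" for k q
  proof (cases "k = 0")
    case True
    hence "{y. 1 \<le> y \<and> y \<le> N \<and> y \<le> k \<and> q \<le> row_of T y} = {}" by auto
    thus ?thesis using True by (simp del: Collect_empty_eq)
  next
    case False
    thus ?thesis using richardson_restricted_shape[OF R assoc, of k q] that
      by (simp add: sum_list_drop_restricted_shape)
  qed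
  have "q \<le> row_of T (Suc x) \<longleftrightarrow> q \<le> level (blk \<tau>) x" for q
  proof -
    let ?A = "{y. 1 \<le> y \<and> y \<le> N \<and> y \<le> x \<and> q \<le> row_of T y}"
    let ?B = "{y \<in> {..<x}. q \<le> level (blk \<tau>) y}"
    have "{y. 1 \<le> y \<and> y \<le> N \<and> y \<le> Suc x \<and> q \<le> row_of T y} = ?A \<union> (if q \<le> row_of T (Suc x) then {Suc x} else {})"
      using x by (auto simp: le_Suc_eq)
    moreover have "{y \<in> {..<Suc x}. q \<le> level (blk \<tau>) y} = ?B \<union> (if q \<le> level (blk \<tau>) x then {x} else {})"
      by (auto simp: less_Suc_eq)
    moreover have "card (?A \<union> (if q \<le> row_of T (Suc x) then {Suc x} else {})) = card ?A + (if q \<le> row_of T (Suc x) then 1 else 0)"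
      by (subst card_Un_disjoint) auto
    moreover have "card (?B \<union> (if q \<le> level (blk \<tau>) x then {x} else {})) = card ?B + (if q \<le> level (blk \<tau>) x then 1 else 0)"
      by (subst card_Un_disjoint) auto
    ultimately show ?thesis using eq[of x q] eq[of "Suc x" q] x by (auto split: if_splits)
  qed
  from this[of "row_of T (Suc x)"] this[of "level (blk \<tau>) x"] show ?thesis by simp
qed

subsection \<open>The subalgebra generated by simple root vectors\<close>

text \<open>Multiplying entries at (r, k) and (k, c) concatenates the supports of the two roots, so
  brackets stay within the roots supported in \<sigma>.\<close>

lemma subalgebra_gen_support:
  assumes "A \<in> subalgebra_gen N \<sigma>"
  shows "A \<in> carrier_mat N N \<and> (\<forall>r<N. \<forall>c<N. A $$ (r, c) \<noteq> 0 \<longrightarrow> r < c \<and> {Suc r..c} \<subseteq> \<sigma>)"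
  using assms
proof induction
  case (gen i)
  then show ?case by (auto simp: root_vec_def split: if_splits)
next
  case (add A B)
  show ?case
  proof (intro conjI allI impI)
    show "A + B \<in> carrier_mat N N" using add.IH by (meson add_carrier_mat)
    fix r c assume rc: "r < N" "c < N" "(A + B) $$ (r, c) \<noteq> 0"
    have c: "A \<in> carrier_mat N N" "B \<in> carrier_mat N N" using add.IH by blast+
    hence "(A + B) $$ (r, c) = A $$ (r, c) + B $$ (r, c)" using rc by simp
    hence "A $$ (r, c) \<noteq> 0 \<or> B $$ (r, c) \<noteq> 0" using rc(3) by force
    thus "r < c" "{Suc r..c} \<subseteq> \<sigma>" using add.IH rc by blast+
  qed
next
  case (smult A c)
  show ?case
  proof (intro conjI allI impI)
    show "c \<cdot>\<^sub>m A \<in> carrier_mat N N" using smult.IH by simp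
    fix r s assume rs: "r < N" "s < N" "(c \<cdot>\<^sub>m A) $$ (r, s) \<noteq> 0"
    have "A \<in> carrier_mat N N" using smult.IH by blast
    hence "A $$ (r, s) \<noteq> 0" using rs by auto
    thus "r < s" "{Suc r..s} \<subseteq> \<sigma>" using smult.IH rs(1,2) by blast+
  qed
next
  case (bracket A B)
  have mult: "r < c \<and> {Suc r..c} \<subseteq> \<sigma>"
    if "A \<in> carrier_mat N N" "B \<in> carrier_mat N N" "r < N" "c < N" "(A * B) $$ (r, c) \<noteq> 0"
      "\<forall>r<N. \<forall>c<N. A $$ (r, c) \<noteq> 0 \<longrightarrow> r < c \<and> {Suc r..c} \<subseteq> \<sigma>"
      "\<forall>r<N. \<forall>c<N. B $$ (r, c) \<noteq> 0 \<longrightarrow> r < c \<and> {Suc r..c} \<subseteq> \<sigma>" for A B :: "complex mat" and r c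
  proof -
    have "(\<Sum>k = 0..<N. A $$ (r, k) * B $$ (k, c)) \<noteq> 0"
      using that(1-5) by (simp add: scalar_prod_def)
    then obtain k where "k \<in> {0..<N}" "A $$ (r, k) * B $$ (k, c) \<noteq> 0"
      by (rule sum.not_neutral_contains_not_neutral)
    hence "k < N" "A $$ (r, k) \<noteq> 0" "B $$ (k, c) \<noteq> 0" by auto
    hence k: "r < k \<and> {Suc r..k} \<subseteq> \<sigma>" "k < c \<and> {Suc k..c} \<subseteq> \<sigma>"
      using that(3,4,6,7) by blast+
    moreover have "{Suc r..c} = {Suc r..k} \<union> {Suc k..c}" using k by auto
    ultimately show ?thesis by auto
  qed
  show ?case
  proof (intro conjI allI impI)
    show "A * B - B * A \<in> carrier_mat N N" using bracket.IH by (meson minus_carrier_mat mult_carrier_mat)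
    fix r c assume rc: "r < N" "c < N" "(A * B - B * A) $$ (r, c) \<noteq> 0"
    have c: "A \<in> carrier_mat N N" "B \<in> carrier_mat N N" using bracket.IH by blast+
    hence "(A * B - B * A) $$ (r, c) = (A * B) $$ (r, c) - (B * A) $$ (r, c)" using rc by simp
    hence "(A * B) $$ (r, c) \<noteq> 0 \<or> (B * A) $$ (r, c) \<noteq> 0" using rc(3) by force
    thus "r < c" "{Suc r..c} \<subseteq> \<sigma>" using mult[of A B r c] mult[of B A r c] bracket.IH rc by blast+
  qed
qed auto

lemma root_vec_in_subalgebra_gen:
  assumes "1 \<le> i" "i \<le> j" "j < N" "{i..j} \<subseteq> \<sigma>"
  shows "root_vec N i j \<in> subalgebra_gen N \<sigma>"
  using assms(2-4)
proof (induction j rule: dec_induct)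
  case base
  then show ?case by (auto intro: subalgebra_gen.gen)
next
  case (step n)
  have "{i..n} \<subseteq> \<sigma>" "Suc n \<in> \<sigma>" using step.prems step.hyps by auto
  let ?A = "root_vec N i n" and ?B = "root_vec N (Suc n) (Suc n)"
  have "?A \<in> subalgebra_gen N \<sigma>" "?B \<in> subalgebra_gen N \<sigma>"
    using step \<open>{i..n} \<subseteq> \<sigma>\<close> \<open>Suc n \<in> \<sigma>\<close> by (auto intro: subalgebra_gen.gen)
  hence "?A * ?B - ?B * ?A \<in> subalgebra_gen N \<sigma>" by (rule subalgebra_gen.bracket)
  also have "?A * ?B - ?B * ?A = root_vec N i (Suc n)"
  proof (rule eq_matI)
    fix r c assume "r < dim_row (root_vec N i (Suc n))" "c < dim_col (root_vec N i (Suc n))"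
    hence rc: "r < N" "c < N" by (simp_all add: root_vec_def)
    have mult: "(A * B) $$ (r, c) = (\<Sum>k = 0..<N. A $$ (r, k) * B $$ (k, c))"
      if "A \<in> carrier_mat N N" "B \<in> carrier_mat N N" for A B :: "complex mat"
      using that rc by (simp add: scalar_prod_def)
    have carrier: "root_vec N i' j' \<in> carrier_mat N N" for i' j' by (simp add: root_vec_def)
    have "(?A * ?B) $$ (r, c) = (\<Sum>k = 0..<N. if k = n then (if Suc r = i \<and> c = Suc n then 1 else 0) else 0)"
      unfolding mult[OF carrier carrier] using rc by (intro sum.cong refl) (auto simp: root_vec_def)
    moreover have "(?B * ?A) $$ (r, c) = (\<Sum>k = 0..<N. 0)"
      unfolding mult[OF carrier carrier] using rc step.hyps by (intro sum.cong refl) (auto simp: root_vec_def)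
    ultimately show "(?A * ?B - ?B * ?A) $$ (r, c) = root_vec N i (Suc n) $$ (r, c)"
      using rc step.prems by (simp add: root_vec_def)
  qed (simp_all add: root_vec_def)
  finally show ?case .
qed

lemma sym_alg_of_iff:
  "p \<in> sym_alg_of N \<sigma> \<longleftrightarrow> (\<forall>(s, t)\<in>mvars p. 1 \<le> s \<and> s < t \<and> t \<le> N \<and> {s..t - 1} \<subseteq> \<sigma>)"
proof -
  have "(s, t) \<in> positions {(i, j) \<in> pos_roots N. root_vec N i j \<in> subalgebra_gen N \<sigma>} \<longleftrightarrow>
      1 \<le> s \<and> s < t \<and> t \<le> N \<and> {s..t - 1} \<subseteq> \<sigma>" for s t
  proof
    assume "(s, t) \<in> positions {(i, j) \<in> pos_roots N. root_vec N i j \<in> subalgebra_gen N \<sigma>}"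
    then obtain j where j: "t = Suc j" "1 \<le> s" "s \<le> j" "j < N" "root_vec N s j \<in> subalgebra_gen N \<sigma>"
      by (auto simp: positions_def pos_roots_def)
    have "root_vec N s j $$ (s - 1, j) \<noteq> 0" using j by (simp add: root_vec_def)
    hence "{Suc (s - 1)..j} \<subseteq> \<sigma>"
      using conjunct2[OF subalgebra_gen_support[OF j(5)], rule_format, of "s - 1" j] j by simp
    thus "1 \<le> s \<and> s < t \<and> t \<le> N \<and> {s..t - 1} \<subseteq> \<sigma>" using j by simp
  next
    assume st: "1 \<le> s \<and> s < t \<and> t \<le> N \<and> {s..t - 1} \<subseteq> \<sigma>"
    hence "root_vec N s (t - 1) \<in> subalgebra_gen N \<sigma>" by (intro root_vec_in_subalgebra_gen) auto
    moreover have "(s, t) = (\<lambda>(i, j). (i, Suc j)) (s, t - 1)" "(s, t - 1) \<in> pos_roots N"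
      using st by (auto simp: pos_roots_def)
    ultimately show "(s, t) \<in> positions {(i, j) \<in> pos_roots N. root_vec N i j \<in> subalgebra_gen N \<sigma>}"
      unfolding positions_def by (intro image_eqI) auto
  qed
  thus ?thesis unfolding sym_alg_of_def polys_in_iff by auto
qed

text \<open>Any other nonlinear generator vanishes on the hypersurface, so \<open>F\<close> divides
  it; both being irreducible, they differ by a unit and have the same variables. A variable in row
  \<open>a\<close> and one in column \<open>N\<close> then force both ends of the interval.\<close>

lemma sigma_eq:
  assumes hs: "hypersurface N (pos_roots N - pos_roots_of N (tau N V)) F"
    and H: "zariski N closure_of V = {A \<in> m_space N (tau N V). peval F A = 0}"
    and hom: "homogeneous_poly d F" "2 \<le> d"
    and vars: "(a, c) \<in> mvars F" "(r, N) \<in> mvars F" "\<And>s t. (s, t) \<in> mvars F \<Longrightarrow> a \<le> s"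
  shows "sigma N V = {a..N - 1}"
proof -
  let ?R = "pos_roots N - pos_roots_of N (tau N V)"
  interpret hypersurface N ?R F by (rule hs)
  have pos: "positions (pos_roots N) - positions ?R = positions (pos_roots_of N (tau N V))"
    unfolding positions_Diff by (auto simp: positions_def pos_roots_of_def)
  have I: "vanishing_ideal N (zariski N closure_of V) =
      ideal_gen N (insert F (coordinate ` positions (pos_roots_of N (tau N V))))"
    unfolding H m_space_def using vanishing_ideal_H unfolding pos .
  have gen: "nonlinear_generator N V F"
    unfolding nonlinear_generator_def using F hom I by (auto simp: polys_in_iff)
  have st: "1 \<le> s \<and> s < t \<and> t \<le> N" if "(s, t) \<in> mvars F" for s t
    using F(2) that by (auto simp: positions_def pos_roots_def)
  have vars_eq: "mvars f = mvars F" if f: "nonlinear_generator N V f" for f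
  proof -
    from f have f': "mvars f \<subseteq> positions ?R" "irreducible f"
      "vanishing_ideal N (zariski N closure_of V) =
        ideal_gen N (insert f (coordinate ` positions (pos_roots_of N (tau N V))))"
      by (auto simp: nonlinear_generator_def polys_in_iff)
    have fs: "f \<in> sym_alg N" using f'(1) positions_R by (auto simp: sym_alg_def polys_in_iff)
    have "1 * f \<in> vanishing_ideal N (zariski N closure_of V)"
      unfolding f'(3) by (rule ideal_gen_mult) (auto simp: one_in_sym_alg)
    hence "\<forall>A\<in>H. peval f A = 0" unfolding H m_space_def by (simp add: vanishing_ideal_def)
    hence "F dvd restrict_vars (positions ?R) f" using dvd_restrict_vars_iff[OF fs] by simp
    then obtain h where h: "f = F * h" by (auto simp: restrict_vars_id[OF f'(1)])
    hence "h dvd 1" using f'(2) F(1) by (auto simp: irreducible_def)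
    thus ?thesis using h F(1) mvars_mult_eq[of F h] by (auto simp: mpoly_unit_iff)
  qed
  show ?thesis unfolding sigma_def
  proof (rule Least_equality)
    have "1 \<le> a \<and> a < c \<and> c \<le> N" using st[OF vars(1)] .
    hence "connected_roots N {a..N - 1}"
      unfolding connected_roots_def by (intro exI[of _ a] exI[of _ "N - 1"]) auto
    moreover have "F \<in> sym_alg_of N {a..N - 1}"
      unfolding sym_alg_of_iff using st vars(3) by fastforce
    ultimately show "connected_roots N {a..N - 1} \<and> (\<exists>f. nonlinear_generator N V f \<and> f \<in> sym_alg_of N {a..N - 1})"
      using gen by blast
  next
    fix \<sigma> assume "connected_roots N \<sigma> \<and> (\<exists>f. nonlinear_generator N V f \<and> f \<in> sym_alg_of N \<sigma>)"
    then obtain a' b' f where \<sigma>: "\<sigma> = {a'..b'}" and f: "nonlinear_generator N V f" "f \<in> sym_alg_of N \<sigma>"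
      by (auto simp: connected_roots_def)
    have "a \<in> \<sigma>" using f(2) vars(1) st[OF vars(1)] vars_eq[OF f(1)] unfolding sym_alg_of_iff by fastforce
    moreover have "N - 1 \<in> \<sigma>" using f(2) vars(2) st[OF vars(2)] vars_eq[OF f(1)] unfolding sym_alg_of_iff by fastforce
    ultimately show "{a..N - 1} \<le> \<sigma>" by (auto simp: \<sigma>)
  qed
qed

subsection \<open>Stability under root subgroups\<close>

definition unit_mat_at :: "nat \<Rightarrow> nat \<Rightarrow> nat \<Rightarrow> complex mat" where
  "unit_mat_at N p q = mat N N (\<lambda>(r, c). if r = p \<and> c = q then 1 else 0)"

lemma unit_mat_at_carrier [simp]: "unit_mat_at N p q \<in> carrier_mat N N"
  by (simp add: unit_mat_at_def)

lemma unit_mat_at_mult: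
  assumes "A \<in> carrier_mat N N" "q < N"
  shows "unit_mat_at N p q * A = mat N N (\<lambda>(r, s). if r = p then A $$ (q, s) else 0)"
proof (rule eq_matI)
  fix r s assume "r < dim_row (mat N N (\<lambda>(r, s). if r = p then A $$ (q, s) else 0))"
    "s < dim_col (mat N N (\<lambda>(r, s). if r = p then A $$ (q, s) else 0))"
  hence rs: "r < N" "s < N" by simp_all
  have "(unit_mat_at N p q * A) $$ (r, s) = (\<Sum>k = 0..<N. unit_mat_at N p q $$ (r, k) * A $$ (k, s))"
    using rs assms by (simp add: unit_mat_at_def scalar_prod_def)
  also have "\<dots> = (\<Sum>k = 0..<N. if k = q then (if r = p then A $$ (q, s) else 0) else 0)"
    using rs by (intro sum.cong refl) (auto simp: unit_mat_at_def)
  finally have "(unit_mat_at N p q * A) $$ (r, s) = (\<Sum>k = 0..<N. if k = q then (if r = p then A $$ (q, s) else 0) else 0)" .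
  thus "(unit_mat_at N p q * A) $$ (r, s) = mat N N (\<lambda>(r, s). if r = p then A $$ (q, s) else 0) $$ (r, s)"
    using rs assms by simp
qed (use assms in \<open>simp_all add: unit_mat_at_def\<close>)

lemma mult_unit_mat_at:
  assumes "A \<in> carrier_mat N N" "p < N"
  shows "A * unit_mat_at N p q = mat N N (\<lambda>(r, s). if s = q then A $$ (r, p) else 0)"
proof (rule eq_matI)
  fix r s assume "r < dim_row (mat N N (\<lambda>(r, s). if s = q then A $$ (r, p) else 0))"
    "s < dim_col (mat N N (\<lambda>(r, s). if s = q then A $$ (r, p) else 0))"
  hence rs: "r < N" "s < N" by simp_all
  have "(A * unit_mat_at N p q) $$ (r, s) = (\<Sum>k = 0..<N. A $$ (r, k) * unit_mat_at N p q $$ (k, s))"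
    using rs assms by (simp add: unit_mat_at_def scalar_prod_def)
  also have "\<dots> = (\<Sum>k = 0..<N. if k = p then (if s = q then A $$ (r, p) else 0) else 0)"
    using rs by (intro sum.cong refl) (auto simp: unit_mat_at_def)
  finally have "(A * unit_mat_at N p q) $$ (r, s) = (\<Sum>k = 0..<N. if k = p then (if s = q then A $$ (r, p) else 0) else 0)" .
  thus "(A * unit_mat_at N p q) $$ (r, s) = mat N N (\<lambda>(r, s). if s = q then A $$ (r, p) else 0) $$ (r, s)"
    using rs assms by simp
qed (use assms in \<open>simp_all add: unit_mat_at_def\<close>)

abbreviation transvection :: "nat \<Rightarrow> nat \<Rightarrow> nat \<Rightarrow> complex \<Rightarrow> complex mat" where
  "transvection N p q c \<equiv> 1\<^sub>m N + c \<cdot>\<^sub>m unit_mat_at N p q"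

lemma transvection_mult:
  assumes "A \<in> carrier_mat N N" "q < N"
  shows "transvection N p q c * A = mat N N (\<lambda>(r, s). A $$ (r, s) + (if r = p then c * A $$ (q, s) else 0))"
proof -
  have "transvection N p q c * A = 1\<^sub>m N * A + (c \<cdot>\<^sub>m unit_mat_at N p q) * A"
    by (rule add_mult_distrib_mat) (use assms in auto)
  also have "(c \<cdot>\<^sub>m unit_mat_at N p q) * A = c \<cdot>\<^sub>m (unit_mat_at N p q * A)"
    by (rule mult_smult_assoc_mat[OF unit_mat_at_carrier assms(1)])
  finally show ?thesis
    using assms by (intro eq_matI) (auto simp: unit_mat_at_mult)
qed

lemma mult_transvection:
  assumes "A \<in> carrier_mat N N" "p < N"
  shows "A * transvection N p q c = mat N N (\<lambda>(r, s). A $$ (r, s) + (if s = q then c * A $$ (r, p) else 0))"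
proof -
  have "A * transvection N p q c = A * 1\<^sub>m N + A * (c \<cdot>\<^sub>m unit_mat_at N p q)"
    by (rule mult_add_distrib_mat) (use assms in auto)
  also have "A * (c \<cdot>\<^sub>m unit_mat_at N p q) = c \<cdot>\<^sub>m (A * unit_mat_at N p q)"
    by (rule mult_smult_distrib[OF assms(1) unit_mat_at_carrier])
  finally show ?thesis
    using assms by (intro eq_matI) (auto simp: mult_unit_mat_at)
qed

lemma transvection_inverse:
  assumes "p < N" "q < N" "p \<noteq> q"
  shows "transvection N p q c * transvection N p q (- c) = 1\<^sub>m N"
  by (subst transvection_mult) (use assms in \<open>auto simp: unit_mat_at_def intro!: eq_matI\<close>)

text \<open>Stability passes from the generators to products. Conjugation by the inverse is carried
  along, since invariance of \<open>V\<close> as a set needs both inclusions.\<close>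

lemma root_subgroup_conj:
  assumes V: "V \<subseteq> carrier_mat N N"
    and i: "1 \<le> i" "i < N"
    and up: "\<And>c A. A \<in> V \<Longrightarrow> transvection N (i - 1) i c * A * transvection N (i - 1) i (- c) \<in> V"
    and down: "\<And>c A. A \<in> V \<Longrightarrow> transvection N i (i - 1) c * A * transvection N i (i - 1) (- c) \<in> V"
    and g: "g \<in> root_subgroup N i"
  shows "\<exists>h\<in>carrier_mat N N. g \<in> carrier_mat N N \<and> g * h = 1\<^sub>m N \<and> h * g = 1\<^sub>m N \<and>
    (\<forall>A\<in>V. g * A * h \<in> V \<and> h * A * g \<in> V)"
proof -
  have X: "root_vec N i i = unit_mat_at N (i - 1) i" "transpose_mat (root_vec N i i) = unit_mat_at N i (i - 1)"
    using i by (auto simp: root_vec_def unit_mat_at_def intro!: eq_matI)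
  have step: "\<exists>h'\<in>carrier_mat N N. u * g \<in> carrier_mat N N \<and> (u * g) * h' = 1\<^sub>m N \<and> h' * (u * g) = 1\<^sub>m N \<and>
      (\<forall>A\<in>V. (u * g) * A * h' \<in> V \<and> h' * A * (u * g) \<in> V)"
    if h: "\<exists>h\<in>carrier_mat N N. g \<in> carrier_mat N N \<and> g * h = 1\<^sub>m N \<and> h * g = 1\<^sub>m N \<and>
        (\<forall>A\<in>V. g * A * h \<in> V \<and> h * A * g \<in> V)"
      and u: "u \<in> carrier_mat N N" "u' \<in> carrier_mat N N" "u * u' = 1\<^sub>m N" "u' * u = 1\<^sub>m N"
        "\<And>A. A \<in> V \<Longrightarrow> u * A * u' \<in> V" "\<And>A. A \<in> V \<Longrightarrow> u' * A * u \<in> V" for u u' g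
  proof -
    from h obtain h where h: "h \<in> carrier_mat N N" "g \<in> carrier_mat N N" "g * h = 1\<^sub>m N" "h * g = 1\<^sub>m N"
      "\<And>A. A \<in> V \<Longrightarrow> g * A * h \<in> V" "\<And>A. A \<in> V \<Longrightarrow> h * A * g \<in> V" by blast
    note c = h(1,2) u(1,2)
    have assoc: "(A * B) * C = A * (B * C)" if "A \<in> carrier_mat N N" "B \<in> carrier_mat N N" "C \<in> carrier_mat N N"
      for A B C :: "complex mat"
      using that by (rule assoc_mult_mat)
    have cm: "A * B \<in> carrier_mat N N" if "A \<in> carrier_mat N N" "B \<in> carrier_mat N N" for A B :: "complex mat"
      using that by (rule mult_carrier_mat)
    have "(u * g) * (h * u') = u * ((g * h) * u')" using c by (simp add: assoc cm)
    hence 1: "(u * g) * (h * u') = 1\<^sub>m N" using h(3) u(2,3) by simp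
    have "(h * u') * (u * g) = h * ((u' * u) * g)" using c by (simp add: assoc cm)
    hence 2: "(h * u') * (u * g) = 1\<^sub>m N" using h(2,4) u(4) by simp
    have 3: "(u * g) * A * (h * u') \<in> V \<and> (h * u') * A * (u * g) \<in> V" if "A \<in> V" for A
    proof -
      have A: "A \<in> carrier_mat N N" using that V by auto
      have "(u * g) * A * (h * u') = u * (g * A * h) * u'" "(h * u') * A * (u * g) = h * (u' * A * u) * g"
        using c A by (simp_all add: assoc cm)
      thus ?thesis using u(5)[OF h(5)[OF that]] h(6)[OF u(6)[OF that]] by simp
    qed
    show ?thesis using 1 2 3 cm c by (intro bexI[of _ "h * u'"]) auto
  qed
  have inv: "transvection N p q c * transvection N p q (- c) = 1\<^sub>m N"
    "transvection N p q (- c) * transvection N p q c = 1\<^sub>m N" if "p < N" "q < N" "p \<noteq> q" for p q c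
    using transvection_inverse[OF that, of c] transvection_inverse[OF that, of "- c"] by simp_all
  show ?thesis using g
  proof induction
    case one
    show ?case using V by (intro bexI[of _ "1\<^sub>m N"]) auto
  next
    case (pos g c)
    show ?case unfolding X(1)
      by (rule step[OF pos.IH, of _ "transvection N (i - 1) i (- c)"])
        (use inv[of "i - 1" i c] i up[of _ c] up[of _ "- c"] in auto)
  next
    case (neg g c)
    show ?case unfolding X(2)
      by (rule step[OF neg.IH, of _ "transvection N i (i - 1) (- c)"])
        (use inv[of i "i - 1" c] i down[of _ c] down[of _ "- c"] in auto)
  qed
qed

lemma mem_tau_if_transvections:
  assumes V: "V \<subseteq> carrier_mat N N" and i: "1 \<le> i" "i < N"
    and up: "\<And>c A. A \<in> V \<Longrightarrow> transvection N (i - 1) i c * A * transvection N (i - 1) i (- c) \<in> V"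
    and down: "\<And>c A. A \<in> V \<Longrightarrow> transvection N i (i - 1) c * A * transvection N i (i - 1) (- c) \<in> V"
  shows "i \<in> tau N V"
  unfolding tau_def
proof (intro CollectI conjI ballI impI)
  show "i \<in> simple_roots N" using i by (simp add: simple_roots_def)
  fix g h assume g: "g \<in> root_subgroup N i" and hc: "h \<in> carrier_mat N N" and gh: "inverts_mat g h"
  obtain h0 where h0: "h0 \<in> carrier_mat N N" "g \<in> carrier_mat N N" "g * h0 = 1\<^sub>m N" "h0 * g = 1\<^sub>m N"
    "\<And>A. A \<in> V \<Longrightarrow> g * A * h0 \<in> V" "\<And>A. A \<in> V \<Longrightarrow> h0 * A * g \<in> V"
    using root_subgroup_conj[OF V i up down g] by blast
  have "h = (h0 * g) * h" using hc h0(4) by simp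
  also have "\<dots> = h0 * (g * h)" using h0 hc by (intro assoc_mult_mat) auto
  also have "\<dots> = h0" using gh h0(1,2) by (simp add: inverts_mat_def)
  finally have h: "h = h0" .
  show "(\<lambda>A. g * A * h) ` V = V"
  proof (intro subset_antisym subsetI)
    fix A assume A: "A \<in> V"
    hence Ac: "A \<in> carrier_mat N N" using V by auto
    have assoc: "(A * B) * C = A * (B * C)" if "A \<in> carrier_mat N N" "B \<in> carrier_mat N N" "C \<in> carrier_mat N N"
      for A B C :: "complex mat"
      using that by (rule assoc_mult_mat)
    have cm: "A * B \<in> carrier_mat N N" if "A \<in> carrier_mat N N" "B \<in> carrier_mat N N" for A B :: "complex mat"
      using that by (rule mult_carrier_mat)
    have "g * (h0 * A * g) * h0 = (g * h0) * (A * (g * h0))" using h0(1,2) Ac by (simp add: assoc cm)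
    also have "\<dots> = A" using h0(3) Ac by simp
    finally show "A \<in> (\<lambda>A. g * A * h) ` V" using h0(6)[OF A] h by (auto intro!: image_eqI[of _ _ "h0 * A * g"])
  qed (use h0 h in auto)
qed

text \<open>On this hyperplane the last two rows of a matrix are zero, so conjugation by a
  transvection in the last two indices changes only the last two columns. Above those rows the
  entries there are unconstrained, hence the conjugate stays in the closure, and of course in the
  orbit.\<close>

lemma last_root_in_tau:
  assumes V: "orbital_variety N V" and N: "2 \<le> N"
    and closure: "zariski N closure_of V = {A \<in> m_space N \<tau>. A $$ (N - 2, N - 1) = 0}"
    and less: "\<And>x. x < N - 2 \<Longrightarrow> blk \<tau> x < blk \<tau> (N - 2)" "blk \<tau> (N - 2) < blk \<tau> (N - 1)"
  shows "N - 1 \<in> tau N V"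
proof -
  obtain \<mu> where \<mu>: "irreducible_component_in (zariski N) (nilpotent_orbit N \<mu> \<inter> nilradical N) V"
    using V by (auto simp: orbital_variety_def)
  let ?Y = "zariski N closure_of V" and ?O = "nilpotent_orbit N \<mu>"
  have irr: "irreducible_in (zariski N) V" by (rule orbital_variety_irreducible[OF V])
  have VY: "V \<subseteq> ?Y" by (rule irreducible_subset_closure[OF irr])
  \<comment> \<open>The closure of \<open>V\<close> meets the orbit in an irreducible set containing
    \<open>V\<close>; by maximality of the component it is \<open>V\<close>.\<close>
  have V_eq: "V = ?Y \<inter> ?O"
  proof -
    have "?Y \<subseteq> nilradical N" using m_space_subset_nilradical closure by auto
    hence "V \<subseteq> ?Y \<inter> ?O" "?Y \<inter> ?O \<subseteq> nilpotent_orbit N \<mu> \<inter> nilradical N"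
      using VY \<mu> by (auto simp: irreducible_component_in_def)
    moreover have "irreducible_in (zariski N) (?Y \<inter> ?O)"
      by (rule irreducible_in_between_closure[OF irr]) (use calculation in auto)
    ultimately show ?thesis using \<mu> unfolding irreducible_component_in_def by metis
  qed
  have conj: "transvection N p q c * A * transvection N p q (- c) \<in> V"
    if A: "A \<in> V" and pq: "p = N - 2 \<and> q = N - 1 \<or> p = N - 1 \<and> q = N - 2" for p q c A
  proof -
    have AY: "A \<in> m_space N \<tau>" "A $$ (N - 2, N - 1) = 0" using A VY closure by auto
    have Ac: "A \<in> carrier_mat N N" using AY by (simp add: m_space_iff)
    have pqN: "p < N" "q < N" "p \<noteq> q" using pq N by auto
    have le: "blk \<tau> s \<le> blk \<tau> (N - 1)" if "s < N" for s using that by (intro blk_mono) simp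
    have rows: "A $$ (r, s) = 0" if "r = N - 2 \<or> r = N - 1" "s < N" for r s
    proof (rule ccontr)
      assume nz: "A $$ (r, s) \<noteq> 0"
      hence *: "blk \<tau> r < blk \<tau> s" using AY(1) that N unfolding m_space_iff by auto
      with le[OF that(2)] that(1) have r: "r = N - 2" by auto
      have "s = N - 1" using * r blk_mono[of s "N - 2" \<tau>] that(2) by (cases "s \<le> N - 2") auto
      thus False using nz r AY(2) by simp
    qed
    have 1: "transvection N p q c * A = A"
      by (subst transvection_mult[OF Ac pqN(2)]) (use rows pq Ac in \<open>auto intro!: eq_matI\<close>)
    have 2: "A * transvection N p q (- c) = mat N N (\<lambda>(r, s). A $$ (r, s) + (if s = q then - c * A $$ (r, p) else 0))"
      by (rule mult_transvection[OF Ac pqN(1)])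
    have "A * transvection N p q (- c) \<in> m_space N \<tau>"
      unfolding m_space_iff
    proof (intro conjI allI impI)
      show "A * transvection N p q (- c) \<in> carrier_mat N N" unfolding 2 by simp
      fix r s assume rs: "r < N" "s < N" "(A * transvection N p q (- c)) $$ (r, s) \<noteq> 0"
      show "blk \<tau> r < blk \<tau> s"
      proof (cases "A $$ (r, s) = 0")
        case True
        hence s: "s = q" "A $$ (r, p) \<noteq> 0" using rs unfolding 2 by (auto split: if_splits)
        hence "r < N - 2" using rows[of r p] pqN(1) rs(1) by linarith
        hence "blk \<tau> r < blk \<tau> (N - 2)" by (rule less(1))
        thus ?thesis using s pq less(2) by auto
      qed (use AY rs in \<open>auto simp: m_space_iff\<close>)
    qed
    moreover have "(A * transvection N p q (- c)) $$ (N - 2, N - 1) = 0"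
      unfolding 2 using rows N pqN by simp
    moreover have "A * transvection N p q (- c) \<in> ?O"
    proof -
      have AO: "A \<in> ?O" using A V_eq by auto
      let ?u = "transvection N p q c" and ?u' = "transvection N p q (- c)"
      have "similar_mat_wit (?u * A * ?u') A ?u ?u'"
        by (rule similar_mat_witI[of _ _ N])
          (use transvection_inverse[OF pqN, of c] transvection_inverse[OF pqN, of "- c"] Ac in \<open>auto intro!: mult_carrier_mat\<close>)
      hence "similar_mat (A * ?u') A" unfolding 1 similar_mat_def by blast
      thus ?thesis using AO unfolding nilpotent_orbit_def nilpotent_jordan_type_def jordan_nf_def 2
        by (auto intro: similar_mat_trans)
    qed
    ultimately show ?thesis using V_eq closure 1 by auto
  qed
  have N1: "N - 1 - 1 = N - 2" by simp
  have "\<And>c A. A \<in> V \<Longrightarrow> transvection N (N - 1 - 1) (N - 1) c * A * transvection N (N - 1 - 1) (N - 1) (- c) \<in> V"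
    "\<And>c A. A \<in> V \<Longrightarrow> transvection N (N - 1) (N - 1 - 1) c * A * transvection N (N - 1) (N - 1 - 1) (- c) \<in> V"
    unfolding N1 by (rule conj; simp)+
  note st = this
  show ?thesis
  proof (rule mem_tau_if_transvections)
    show "V \<subseteq> carrier_mat N N" using V_eq by (auto simp: nilpotent_orbit_def)
  qed (use N st in simp_all)
qed

subsection \<open>Chains\<close>

text \<open>A transposition from \<tau> exchanges neighbours of one chain; conversely the simple
  roots between two members of a chain all lie in \<tau> and connect them step by step.\<close>

lemma transposition_group_orbit:
  assumes \<tau>: "\<tau> \<subseteq> {1..<N}" and x: "1 \<le> x" "x \<le> N"
  shows "(\<lambda>p. p x) ` transposition_group \<tau> = {y. 1 \<le> y \<and> y \<le> N \<and> blk \<tau> (y - 1) = blk \<tau> (x - 1)}"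
proof (intro subset_antisym subsetI)
  fix y assume "y \<in> (\<lambda>p. p x) ` transposition_group \<tau>"
  then obtain p where p: "p \<in> transposition_group \<tau>" "y = p x" by auto
  have "1 \<le> p x \<and> p x \<le> N \<and> blk \<tau> (p x - 1) = blk \<tau> (x - 1)"
    using p(1)
  proof induction
    case (comp p i)
    have i: "1 \<le> i" "i < N" using comp \<tau> by auto
    have "blk \<tau> i = blk \<tau> (i - 1)" using blk_Suc[of \<tau> "i - 1"] comp.hyps i by simp
    thus ?case using comp.IH i by (auto simp: Transposition.transpose_def)
  qed (use x in auto)
  thus "y \<in> {y. 1 \<le> y \<and> y \<le> N \<and> blk \<tau> (y - 1) = blk \<tau> (x - 1)}" using p by simp
next
  let ?O = "(\<lambda>p. p x) ` transposition_group \<tau>"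
  fix y assume "y \<in> {y. 1 \<le> y \<and> y \<le> N \<and> blk \<tau> (y - 1) = blk \<tau> (x - 1)}"
  hence y: "1 \<le> y" "y \<le> N" "blk \<tau> (y - 1) = blk \<tau> (x - 1)" by auto
  have self: "x \<in> ?O" by (intro image_eqI[of _ _ id]) (auto intro: transposition_group.id)
  have up: "Suc z \<in> ?O" if "z \<in> ?O" "z \<in> \<tau>" for z
  proof -
    from that obtain p where "p \<in> transposition_group \<tau>" "z = p x" by auto
    thus ?thesis using that(2)
      by (intro image_eqI[of _ _ "transpose z (Suc z) \<circ> p"]) (auto intro: transposition_group.comp)
  qed
  have down: "z \<in> ?O" if "Suc z \<in> ?O" "z \<in> \<tau>" for z
  proof -
    from that obtain p where "p \<in> transposition_group \<tau>" "p x = Suc z" by auto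
    thus ?thesis using that(2)
      by (intro image_eqI[of _ _ "transpose z (Suc z) \<circ> p"]) (auto intro: transposition_group.comp)
  qed
  show "y \<in> ?O"
  proof (cases "x \<le> y")
    case True
    have "{x..<y} \<subseteq> \<tau>"
    proof (cases "x = y")
      case False
      hence "{Suc (x - 1)..y - 1} \<subseteq> \<tau>" using blk_less_iff[of \<tau> "x - 1" "y - 1"] y x True by auto
      moreover have "{x..<y} \<subseteq> {Suc (x - 1)..y - 1}" using x by auto
      ultimately show ?thesis by blast
    qed simp
    with True show ?thesis
    proof (induction y rule: dec_induct)
      case (step n)
      have "{x..<n} \<subseteq> \<tau>" "n \<in> \<tau>" using step.prems step.hyps by auto
      thus ?case using up[OF step.IH] by blast
    qed (rule self)
  next
    case False
    hence "{Suc (y - 1)..x - 1} \<subseteq> \<tau>" using blk_less_iff[of \<tau> "y - 1" "x - 1"] y x by auto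
    moreover have "{y..<x} \<subseteq> {Suc (y - 1)..x - 1}" using y by auto
    ultimately have "{y..<x} \<subseteq> \<tau>" "y \<le> x" using False by auto
    from this(2,1) show ?thesis
    proof (induction y rule: inc_induct)
      case (step n)
      have "{Suc n..<x} \<subseteq> \<tau>" "n \<in> \<tau>" using step.prems step.hyps by auto
      thus ?case using down[OF step.IH] by blast
    qed (rule self)
  qed
qed

lemma blk_surj: "i \<le> blk \<tau> m \<Longrightarrow> \<exists>x\<le>m. blk \<tau> x = i"
proof (induction m)
  case (Suc m)
  show ?case
  proof (cases "i \<le> blk \<tau> m")
    case True
    then obtain x where "x \<le> m" "blk \<tau> x = i" using Suc.IH by auto
    thus ?thesis by (intro exI[of _ x]) auto
  next
    case False
    hence "i = blk \<tau> (Suc m)" using Suc.prems by (auto simp: blk_Suc split: if_splits)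
    thus ?thesis by auto
  qed
qed auto

lemma linorder_insort_key: "linorder.insort_key (\<le>) f x ys = insort_key (f :: 'a \<Rightarrow> nat) x ys"
  by (induction ys) (simp_all add: linorder.insort_key.simps[OF linorder_class.linorder_axioms])

lemma linorder_sorted_key_list_of_set:
  "linorder.sorted_key_list_of_set (\<le>) f S = sorted_key_list_of_set (f :: 'a \<Rightarrow> nat) S"
proof -
  have "linorder.insort_key (\<le>) f = insort_key f"
    by (intro ext) (rule linorder_insort_key)
  thus ?thesis
    by (simp add: linorder.sorted_key_list_of_set_def[OF linorder_class.linorder_axioms] sorted_key_list_of_set_def)
qed

text \<open>The minima of the chains increase with the block number, so sorting by
  \<open>Min\<close> lists the chains in that order; the shift by one is between counting from 1 and
  from 0.\<close>

lemma card_chain: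
  assumes \<tau>: "\<tau> \<subseteq> {1..<N}" and i: "i \<le> blk \<tau> (N - 1)" and N: "1 \<le> N"
  shows "card (chain N \<tau> (Suc i)) = card {x. x < N \<and> blk \<tau> x = i}"
proof -
  let ?b = "blk \<tau>"
  define n where "n = Suc (?b (N - 1))"
  define B where "B i = Suc ` {x. x < N \<and> ?b x = i}" for i
  have orbits: "chain_orbits N \<tau> = B ` {..<n}"
  proof -
    have O: "(\<lambda>p. p x) ` transposition_group \<tau> = B (?b (x - 1))" if "x \<in> {1..N}" for x
    proof -
      have "{y. 1 \<le> y \<and> y \<le> N \<and> ?b (y - 1) = ?b (x - 1)} = B (?b (x - 1))"
        unfolding B_def
      proof (intro subset_antisym subsetI)
        fix y assume "y \<in> {y. 1 \<le> y \<and> y \<le> N \<and> ?b (y - 1) = ?b (x - 1)}"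
        thus "y \<in> Suc ` {z. z < N \<and> ?b z = ?b (x - 1)}" by (intro image_eqI[of _ _ "y - 1"]) auto
      qed auto
      thus ?thesis using transposition_group_orbit[OF \<tau>, of x] that by auto
    qed
    show ?thesis
    proof (intro subset_antisym subsetI)
      fix S assume "S \<in> chain_orbits N \<tau>"
      then obtain x where "x \<in> {1..N}" "S = (\<lambda>p. p x) ` transposition_group \<tau>" by (auto simp: chain_orbits_def)
      moreover from this have "?b (x - 1) \<le> ?b (N - 1)" by (intro blk_mono) auto
      ultimately show "S \<in> B ` {..<n}" using O by (auto simp: n_def)
    next
      fix S assume "S \<in> B ` {..<n}"
      then obtain i where "i \<le> ?b (N - 1)" "S = B i" by (auto simp: n_def less_Suc_eq_le)
      moreover from this obtain x where "x \<le> N - 1" "?b x = i" using blk_surj by metis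
      ultimately have "S = (\<lambda>p. p (Suc x)) ` transposition_group \<tau>" "Suc x \<in> {1..N}"
        using O[of "Suc x"] N by auto
      thus "S \<in> chain_orbits N \<tau>" by (auto simp: chain_orbits_def)
    qed
  qed
  have ne: "B i \<noteq> {}" "finite (B i)" if "i < n" for i
  proof -
    obtain x where "x \<le> N - 1" "?b x = i" using blk_surj[of i \<tau> "N - 1"] \<open>i < n\<close> by (auto simp: n_def)
    hence "x < N \<and> ?b x = i" using N by simp
    thus "B i \<noteq> {}" by (auto simp: B_def)
  qed (simp add: B_def)
  have less: "Min (B i) < Min (B j)" if "i < j" "j < n" for i j
  proof -
    have "Min (B i) \<in> B i" "Min (B j) \<in> B j" using ne that by auto
    then obtain x y where xy: "Min (B i) = Suc x" "Min (B j) = Suc y" "?b x = i" "?b y = j"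
      by (auto simp: B_def)
    have "x < y" using blk_mono[of y x \<tau>] xy that by (cases "x < y") auto
    thus ?thesis using xy by simp
  qed
  have inj: "inj_on Min (B ` {..<n})"
  proof (rule inj_onI)
    fix S S' assume "S \<in> B ` {..<n}" "S' \<in> B ` {..<n}" "Min S = Min S'"
    then obtain i j where "S = B i" "S' = B j" "i < n" "j < n" "Min (B i) = Min (B j)" by auto
    thus "S = S'" using less[of i j] less[of j i] by (cases i j rule: linorder_cases) auto
  qed
  interpret folding_insort_key "(\<le>)" "(<)" "B ` {..<n}" Min
    by unfold_locales (rule inj)
  have "sorted_wrt (<) (map Min (map B [0..<n]))"
    using less by (auto simp: sorted_wrt_iff_nth_less)
  hence srt: "sorted (map Min (map B [0..<n]))" "distinct (map Min (map B [0..<n]))"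
    unfolding strict_sorted_iff by auto
  have "sorted_key_list_of_set Min (B ` {..<n}) = map B [0..<n]"
  proof (rule map_sorted_distinct_set_unique[where f = Min])
    have set_l: "set (sorted_key_list_of_set Min (B ` {..<n})) = B ` {..<n}"
      by (rule set_sorted_key_list_of_set[unfolded linorder_sorted_key_list_of_set]) simp_all
    thus "set (sorted_key_list_of_set Min (B ` {..<n})) = set (map B [0..<n])"
      by (simp add: lessThan_atLeast0)
    show "inj_on Min (set (sorted_key_list_of_set Min (B ` {..<n})) \<union> set (map B [0..<n]))"
      using inj unfolding set_l by (simp add: lessThan_atLeast0)
  qed (rule srt order_refl sorted_sorted_key_list_of_set[unfolded linorder_sorted_key_list_of_set]
      distinct_sorted_key_list_of_set[unfolded linorder_sorted_key_list_of_set])+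
  hence "chain N \<tau> (Suc i) = B i" using i by (simp add: chain_def orbits n_def del: upt_Suc)
  thus ?thesis by (simp add: B_def card_image)
qed

subsection \<open>The chains determine the shape\<close>

lemma convex_nat_set:
  fixes S :: "nat set"
  assumes S: "finite S" "S \<noteq> {}" and convex: "\<And>x y z. x \<in> S \<Longrightarrow> y \<in> S \<Longrightarrow> x \<le> z \<Longrightarrow> z \<le> y \<Longrightarrow> z \<in> S"
  shows "S = {Min S..<Min S + card S}"
proof -
  have mm: "Min S \<in> S" "Max S \<in> S" using S by auto
  have eq: "S = {Min S..Max S}"
  proof (intro subset_antisym subsetI)
    fix x assume "x \<in> {Min S..Max S}"
    thus "x \<in> S" using convex[OF mm, of x] by simp
  qed (use S in simp)
  hence "card S = card {Min S..Max S}" by simp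
  hence "card S = Suc (Max S) - Min S" by simp
  moreover have "Min S \<le> Max S" using S by simp
  ultimately have "Min S + card S = Suc (Max S)" by simp
  thus ?thesis using eq by (simp only: atLeastLessThanSuc_atLeastAtMost)
qed

lemma blk_block_interval:
  assumes "i \<le> blk \<tau> (N - 1)" "1 \<le> N"
  defines "S \<equiv> {x. x < N \<and> blk \<tau> x = i}"
  shows "S \<noteq> {}" "S = {Min S..<Min S + card S}"
proof -
  obtain x where "x \<le> N - 1" "blk \<tau> x = i" using blk_surj[OF assms(1)] by auto
  thus ne: "S \<noteq> {}" using assms(2) by (auto simp: S_def intro!: exI[of _ x])
  have fin: "finite S" by (simp add: S_def)
  show "S = {Min S..<Min S + card S}"
  proof (rule convex_nat_set[OF fin ne])
    fix x y z assume "x \<in> S" "y \<in> S" "x \<le> z" "z \<le> y"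
    thus "z \<in> S" using blk_mono[of x z \<tau>] blk_mono[of z y \<tau>] by (auto simp: S_def)
  qed
qed

text \<open>A chain has exactly one index of level \<open>u\<close> if it is longer than
  \<open>u\<close>, and none otherwise: row lengths and chain lengths are conjugate.\<close>

lemma card_level_blocks:
  fixes \<tau> N
  defines "b \<equiv> blk \<tau>" and "c \<equiv> \<lambda>i. card {x. x < N \<and> blk \<tau> x = i}"
  assumes N: "1 \<le> N"
  shows "card {x. x < N \<and> level b x = u} = card {i. i \<le> b (N - 1) \<and> u < c i}"
proof -
  have bij: "bij_betw (level b) {x \<in> {..<N}. b x = i} {..<card {x \<in> {..<N}. b x = i}}" for i
    using level_function_blk[of N \<tau>] unfolding level_function_def b_def by blast
  have c: "card {x \<in> {..<N}. b x = i} = c i" for i by (simp add: c_def b_def)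
  have "b ` {x. x < N \<and> level b x = u} = {i. i \<le> b (N - 1) \<and> u < c i}"
  proof (intro subset_antisym subsetI)
    fix i assume "i \<in> b ` {x. x < N \<and> level b x = u}"
    then obtain x where x: "x < N" "level b x = u" "i = b x" by auto
    have "x \<in> {y \<in> {..<N}. b y = i}" using x by simp
    hence "level b x \<in> {..<card {x \<in> {..<N}. b x = i}}" using bij_betwE[OF bij[of i]] by blast
    moreover have "i \<le> b (N - 1)" unfolding b_def x(3) using x(1) by (intro blk_mono) simp
    ultimately show "i \<in> {i. i \<le> b (N - 1) \<and> u < c i}" using x(2) c by simp
  next
    fix i assume "i \<in> {i. i \<le> b (N - 1) \<and> u < c i}"
    hence "u \<in> level b ` {x \<in> {..<N}. b x = i}" using bij[of i] c by (simp add: bij_betw_def)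
    thus "i \<in> b ` {x. x < N \<and> level b x = u}" by auto
  qed
  moreover have "inj_on b {x. x < N \<and> level b x = u}"
    by (rule inj_onI) (auto intro: level_inj)
  ultimately show ?thesis using card_image by fastforce
qed

section \<open>Lower bounds for the degree of \<open>F\<close>\<close>

context chain_pair
begin

lemma exists_path_system: "\<exists>\<pi>. path_system \<pi>"
proof -
  obtain k where "k \<in> Poly_Mapping.keys F" using mvars_F_nonempty by (auto simp: mvars_def)
  thus ?thesis using key_path_system by blast
qed

lemma card_moved: "path_system \<pi> \<Longrightarrow> card {r \<in> Rows. \<pi> r \<noteq> r} = card Rows - e"
proof -
  assume "path_system \<pi>"
  moreover have "card Rows = card {r \<in> Rows. \<pi> r \<noteq> r} + card {r \<in> Rows. \<pi> r = r}"
    by (subst card_Un_disjoint[symmetric]) (auto intro: arg_cong[of _ _ card])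
  ultimately show ?thesis by (simp add: path_system_def)
qed

lemma first_block_moved:
  assumes "path_system \<pi>"
  shows "block J \<subseteq> {r \<in> Rows. \<pi> r \<noteq> r}"
proof
  fix x assume x: "x \<in> block J"
  hence "x \<in> Rows" using first_less_last by (simp add: Rows_iff)
  moreover have "\<pi> x \<in> Cols" by (rule path_system_Cols[OF assms \<open>x \<in> Rows\<close>])
  hence "J < b (\<pi> x)" by (simp add: Cols_iff)
  ultimately show "x \<in> {r \<in> Rows. \<pi> r \<noteq> r}" using x by auto
qed

text \<open>The degree is the number of moved rows, and the first block, which contains no column,
  is moved entirely.\<close>

lemma degree_ge_I: "I \<le> card Rows - e"
proof -
  obtain \<pi> where \<pi>: "path_system \<pi>" using exists_path_system by blast
  have "card (block J) \<le> card {r \<in> Rows. \<pi> r \<noteq> r}"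
    by (rule card_mono) (use first_block_moved[OF \<pi>] in auto)
  thus ?thesis by (simp add: card_moved[OF \<pi>] card_first_block)
qed

text \<open>A block fixes only its excess over \<open>I\<close>, so an intermediate block contains a
  moved element; \<open>off\<close> is another one.\<close>

lemma degree_ge_2:
  assumes x: "x \<in> X" "J < b x" "b x < K"
  shows "2 \<le> card Rows - e"
proof -
  obtain \<pi> where \<pi>: "path_system \<pi>" using exists_path_system by blast
  have sub: "block (b x) \<subseteq> Rows" using x by (auto simp: Rows_iff)
  have "card {r \<in> Rows. \<pi> r = r \<and> b r = b x} < card (block (b x))"
  proof -
    have "card (block (b x)) > 0" using x by (auto simp: card_gt_0_iff)
    thus ?thesis using path_system_fixed[OF \<pi>, of "b x"] size(1) by simp
  qed
  moreover have "{r \<in> Rows. \<pi> r = r \<and> b r = b x} = {r \<in> block (b x). \<pi> r = r}"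
    using sub by (auto simp: Rows_iff)
  ultimately have "{r \<in> block (b x). \<pi> r = r} \<noteq> block (b x)" by force
  then obtain r where r: "r \<in> block (b x)" "\<pi> r \<noteq> r" by auto
  have "{off, r} \<subseteq> {r \<in> Rows. \<pi> r \<noteq> r}"
    using first_block_moved[OF \<pi>] r sub off_in by auto
  hence "card {off, r} \<le> card {r \<in> Rows. \<pi> r \<noteq> r}" by (intro card_mono) auto
  moreover have "off \<noteq> r" using r x by auto
  ultimately show ?thesis by (simp add: card_moved[OF \<pi>])
qed

end

section \<open>The sigma-set in terms of the chains of length \<open>I\<close>\<close>

theorem theorem2:
  fixes N :: nat and V V\<^sub>R :: "complex mat set" and T T\<^sub>R :: "nat list list"
  assumes "hypersurface_orbital_variety N V"
    and "associated_tableau N V T"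
    and "richardson N (tau N V) V\<^sub>R"
    and "associated_tableau N V\<^sub>R T\<^sub>R"
    and "dropped_box T\<^sub>R N T"
  shows "sigma N V = simple_roots N \<longleftrightarrow>
    card (chain N (tau N V\<^sub>R) 1) = card (chain N (tau N V\<^sub>R) (row_length T\<^sub>R 1)) \<and>
    (let I = card (chain N (tau N V\<^sub>R) 1)
     in row_length T\<^sub>R I = row_length T\<^sub>R (I + 1) + 2)"
proof -
  define \<tau> where "\<tau> = tau N V"
  define b where "b = blk \<tau>"
  define c where "c i = card {x. x < N \<and> b x = i}" for i
  define K where "K = b (N - 1)"
  \<comment> \<open>\<open>N - 1\<close> is the last index of the last chain, so this is the length
    of that chain. In the statement the letter stands for the length of the first chain; the two
    agree exactly under the first condition.\<close>
  define I where "I = Suc (level b (N - 1))"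
  note hyp = assms(1) and assoc = assms(2) and richardson = assms(3) and assocR = assms(4) and drop = assms(5)
  have ov: "orbital_variety N V" and codim: "codim_in (zariski N) (zariski N closure_of V) (m_space N \<tau>) = 1"
    using hyp by (auto simp: hypersurface_orbital_variety_def \<tau>_def)
  have irr: "irreducible_in (zariski N) V" by (rule orbital_variety_irreducible[OF ov])
  have VY: "V \<subseteq> zariski N closure_of V" by (rule irreducible_subset_closure[OF irr])
  have rich: "richardson N \<tau> V\<^sub>R" using richardson by (simp add: \<tau>_def)
  hence tauR: "tau N V\<^sub>R = \<tau>" by (simp add: richardson_def)
  have \<tau>: "\<tau> \<subseteq> {1..<N}" by (auto simp: \<tau>_def tau_def simple_roots_def)
  interpret TR: tableau N T\<^sub>R by unfold_locales (use assocR in \<open>simp add: associated_tableau_def\<close>)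
  interpret T: tableau N T by unfold_locales (use assoc in \<open>simp add: associated_tableau_def\<close>)
  have rowR: "row_of T\<^sub>R (Suc x) = level b x" if "x < N" for x
    unfolding b_def by (rule richardson_row_of[OF rich assocR that])
  obtain r where r: "1 \<le> r" "N \<in> row_set T\<^sub>R r" "row_set T r = row_set T\<^sub>R r - {N}"
    "row_set T (Suc r) = insert N (row_set T\<^sub>R (Suc r))"
    "\<And>m. m \<noteq> r \<Longrightarrow> m \<noteq> Suc r \<Longrightarrow> row_set T m = row_set T\<^sub>R m"
    using drop unfolding dropped_box_def by blast
  have N: "1 \<le> N" "row_of T\<^sub>R N = r - 1" using r(2) unfolding TR.row_set_eq[OF r(1)] by auto
  have Suc_N: "Suc (N - 1) = N" using N by simp
  have rI: "r = I" using rowR[of "N - 1"] N r(1) by (simp add: I_def Suc_N)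

  have rowT_N: "row_of T N = I"
  proof -
    have "N \<in> row_set T (Suc r)" using r(4) by simp
    thus ?thesis unfolding rI by (subst (asm) T.row_set_eq) auto
  qed
  have rowT: "row_of T y = row_of T\<^sub>R y" if y: "1 \<le> y" "y \<le> N" "y \<noteq> N" for y
  proof -
    have "y \<in> row_set T\<^sub>R (Suc (row_of T\<^sub>R y))" using y by (subst TR.row_set_eq) auto
    hence "y \<in> row_set T (Suc (row_of T\<^sub>R y))"
      using r(3-5) y(3) by (cases "Suc (row_of T\<^sub>R y) = r \<or> Suc (row_of T\<^sub>R y) = Suc r") auto
    thus ?thesis by (subst (asm) T.row_set_eq) auto
  qed
  have rowT': "row_of T (Suc x) = level b x" if "x < N - 1" for x
    using rowT[of "Suc x"] rowR[of x] that by simp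

  have b_le_K: "b x \<le> K" if "x < N" for x
    unfolding b_def K_def using that by (intro blk_mono) simp
  have c_pos: "0 < c i" if "i \<le> K" for i
    using blk_block_interval(1)[of i \<tau> N] that N unfolding c_def K_def b_def by (simp add: card_gt_0_iff)
  have c_K: "c K = I"
  proof -
    have "{x. x < N \<and> b x = K} = insert (N - 1) {y. y < N - 1 \<and> b y = b (N - 1)}"
      using N by (auto simp: K_def)
    thus ?thesis by (simp add: c_def I_def level_def)
  qed
  have I_pos: "0 < I" by (simp add: I_def)
  have level_count: "card {x. x < N \<and> level b x = u} = card {i. i \<le> K \<and> u < c i}" for u
    using card_level_blocks[OF N(1), of \<tau> u] by (simp add: b_def c_def K_def)
  have row_length_R: "row_length T\<^sub>R (Suc u) = card {i. i \<le> K \<and> u < c i}" for u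
  proof -
    have "row_length T\<^sub>R (Suc u) = card {y. 1 \<le> y \<and> y \<le> N \<and> row_of T\<^sub>R y = u}"
      by (subst TR.row_length_eq) auto
    also have "{y. 1 \<le> y \<and> y \<le> N \<and> row_of T\<^sub>R y = u} = Suc ` {x. x < N \<and> level b x = u}"
    proof (intro subset_antisym subsetI)
      fix y assume "y \<in> {y. 1 \<le> y \<and> y \<le> N \<and> row_of T\<^sub>R y = u}"
      thus "y \<in> Suc ` {x. x < N \<and> level b x = u}"
        using rowR[of "y - 1"] by (intro image_eqI[of _ _ "y - 1"]) auto
    qed (use rowR in auto)
    finally show ?thesis by (simp add: card_image level_count)
  qed
  \<comment> \<open>Row \<open>i\<close> has one box for each chain of length at least
    \<open>i\<close>.\<close>
  have length_diff: "row_length T\<^sub>R i = row_length T\<^sub>R (Suc i) + card {l. l \<le> K \<and> c l = i}" if "0 < i" for i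
  proof -
    have "row_length T\<^sub>R i = card {l. l \<le> K \<and> i - 1 < c l}" using row_length_R[of "i - 1"] that by simp
    also have "{l. l \<le> K \<and> i - 1 < c l} = {l. l \<le> K \<and> i < c l} \<union> {l. l \<le> K \<and> c l = i}" using that by auto
    also have "card \<dots> = card {l. l \<le> K \<and> i < c l} + card {l. l \<le> K \<and> c l = i}"
      by (rule card_Un_disjoint) auto
    finally show ?thesis by (simp add: row_length_R)
  qed

  \<comment> \<open>Row \<open>I\<close> loses a box and row \<open>I + 1\<close> gains one; for the
    lengths to remain weakly decreasing, they must have differed by at least two.\<close>
  have "2 \<le> card {l. l \<le> K \<and> c l = I}"
  proof -
    have rs: "row_length S m = card (row_set S m)" if "1 \<le> m" "tableau N S" for S m
      using tableau.row_length_eq[OF that(2,1)] tableau.row_set_eq[OF that(2,1)] by simp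
    have fin: "finite (row_set S m)" for S m by (simp add: row_set_def)
    have "row_length T (Suc I) \<le> row_length T I" using I_pos by (intro T.row_length_antimono) simp
    moreover have "row_length T I = row_length T\<^sub>R I - 1"
      using rs[OF r(1) T.tableau_axioms] rs[OF r(1) TR.tableau_axioms] r(2,3) fin by (simp add: rI)
    moreover have "N \<notin> row_set T\<^sub>R (Suc r)" using N(2) by (subst TR.row_set_eq) (use r(1) in auto)
    hence "row_length T (Suc I) = Suc (row_length T\<^sub>R (Suc I))"
      using rs[of "Suc r", OF _ T.tableau_axioms] rs[of "Suc r", OF _ TR.tableau_axioms] r(4) fin by (simp add: rI)
    ultimately show ?thesis using length_diff[OF I_pos] by linarith
  qed
  hence "{l. l \<le> K \<and> c l = I} - {K} \<noteq> {}"
    using card_mono[of "{K}" "{l. l \<le> K \<and> c l = I}"] by fastforce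
  then obtain l where "l \<le> K" "c l = I" "l \<noteq> K" by blast
  hence "l \<in> {l. l < K \<and> c l = I}" by simp
  hence ex: "finite {l. l < K \<and> c l = I}" "{l. l < K \<and> c l = I} \<noteq> {}" by (simp, blast)
  define J where "J = Max {l. l < K \<and> c l = I}"
  have J: "J < K" "c J = I" using Max_in[OF ex] by (auto simp: J_def)
  have J_max: "l \<le> J" if "l < K" "c l = I" for l
    unfolding J_def by (rule Max_ge[OF ex(1)]) (use that in simp)
  define off where "off = Min {x. x < N \<and> b x = J}"
  have blockJ: "{x. x < N \<and> b x = J} = {off..<off + I}"
    using blk_block_interval(2)[of J \<tau> N] J N(1) unfolding off_def b_def K_def c_def by (simp add: K_def b_def)
  have offJ: "off < N" "b off = J"
  proof -
    have "off \<in> {x. x < N \<and> b x = J}" unfolding blockJ using I_pos by simp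
    thus "off < N" "b off = J" by auto
  qed
  have before: "b x < b off" if "x < off" for x
  proof -
    have "b x \<le> b off" unfolding b_def using that by (intro blk_mono) simp
    moreover have "x \<notin> {x. x < N \<and> b x = J}" unfolding blockJ using that by simp
    ultimately show ?thesis using offJ that by auto
  qed
  have ge_off: "off \<le> x" if "J \<le> b x" for x
    using before[of x] that offJ by (cases "x < off") auto
  have blockK: "{x. x < N \<and> b x = K} = {N - I..<N}"
  proof -
    let ?S = "{x. x < N \<and> b x = K}"
    obtain m where S: "?S = {m..<m + I}"
    proof
      show "?S = {Min ?S..<Min ?S + I}"
        using blk_block_interval(2)[of K \<tau> N] N(1) unfolding c_K[symmetric] b_def K_def c_def by (simp only: order_refl)
    qed
    have "N - 1 \<in> ?S" using N by (simp add: K_def)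
    hence "N - 1 < m + I" unfolding S by simp
    moreover have "m + I - 1 \<in> {m..<m + I}" using I_pos by auto
    hence "m + I - 1 < N" unfolding S[symmetric] by blast
    ultimately have "m + I = N" using I_pos by linarith
    hence "m = N - I" by simp
    thus ?thesis using S \<open>m + I = N\<close> by simp
  qed
  have off_I: "off + I < N"
  proof -
    have "off + I - 1 \<in> {x. x < N \<and> b x = J}" unfolding blockJ using I_pos by auto
    hence *: "off + I - 1 < N" "b (off + I - 1) = J" by auto
    hence "off + I - 1 \<noteq> N - 1" using J(1) by (auto simp: K_def)
    thus ?thesis using * I_pos by linarith
  qed
  interpret P: chain_pair N off I b
  proof
    show "b x \<le> b y" if "x \<le> y" "y < N" for x y unfolding b_def using that by (intro blk_mono)
    show "{x \<in> {off..<N}. b x = b off} = {off..<off + I}"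
    proof -
      have "{x \<in> {off..<N}. b x = J} = {x. x < N \<and> b x = J}" by (auto intro!: ge_off)
      thus ?thesis unfolding blockJ offJ .
    qed
    show "{x \<in> {off..<N}. b x = b (N - 1)} = {N - I..<N}"
    proof -
      have "{x \<in> {off..<N}. b x = K} = {x. x < N \<and> b x = K}" using J(1) by (auto intro!: ge_off)
      thus ?thesis unfolding blockK unfolding K_def .
    qed
    show "b off < b (N - 1)" using offJ J by (simp add: K_def)
    show "card {x \<in> {off..<N}. b x = i} \<noteq> I" if "b off < i" "i < b (N - 1)" for i
    proof -
      have "{x \<in> {off..<N}. b x = i} = {x. x < N \<and> b x = i}" using ge_off that offJ by auto
      thus ?thesis using J_max[of i] that offJ by (auto simp: K_def c_def)
    qed
  qed (use before I_pos off_I in auto)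

  let ?R = "pos_roots N - pos_roots_of N \<tau>"
  have hs: "hypersurface N ?R P.F"
  proof
    show "mvars P.F \<subseteq> positions ?R"
    proof
      fix x assume "x \<in> mvars P.F"
      then obtain s t where st: "x = (Suc s, Suc t)" "s \<in> P.Rows" "t \<in> P.Cols" "b s < b t"
        by (rule P.mvars_F_rising)
      thus "x \<in> positions ?R" by (auto simp: positions_m_space b_def P.Cols_def)
    qed
  qed (use P.irreducible_F in auto)
  interpret hypersurface N ?R P.F by (rule hs)
  have F_V: "peval P.F A = 0" if "A \<in> V" for A
  proof -
    obtain U where U: "openin (subtopology (zariski N) V) U" "U \<noteq> {}"
      "\<And>A k. A \<in> U \<Longrightarrow> k \<in> {1..N} \<Longrightarrow> nilpotent_jordan_type (truncate A k) (restricted_shape T k)"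
      using assoc unfolding associated_tableau_def by blast
    have "peval P.F B = 0" if B: "B \<in> U" for B
    proof -
      let ?M = "off + I"
      have "B \<in> m_space N \<tau>"
        using B openin_subset[OF U(1)] VY codim_in_eq_1D(3)[OF codim] by auto
      hence supp: "\<And>s t. s < N \<Longrightarrow> t < N \<Longrightarrow> B $$ (s, t) \<noteq> 0 \<Longrightarrow> b s < b t"
        by (simp add: m_space_iff b_def)
      \<comment> \<open>This corner ends before \<open>N\<close>, so the drop leaves its shape as in
        the Richardson tableau.\<close>
      have sM: "sum_list (drop q (restricted_shape T ?M)) = card {x \<in> {..<?M}. q \<le> level b x}" for q
      proof -
        have "{y. 1 \<le> y \<and> y \<le> N \<and> y \<le> ?M \<and> q \<le> row_of T y} = Suc ` {x \<in> {..<?M}. q \<le> level b x}"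
        proof (intro subset_antisym subsetI)
          fix y assume "y \<in> {y. 1 \<le> y \<and> y \<le> N \<and> y \<le> ?M \<and> q \<le> row_of T y}"
          thus "y \<in> Suc ` {x \<in> {..<?M}. q \<le> level b x}"
            using rowT'[of "y - 1"] off_I by (intro image_eqI[of _ _ "y - 1"]) auto
        qed (use rowT' off_I in auto)
        thus ?thesis by (simp add: T.sum_list_drop_restricted_shape card_image)
      qed
      \<comment> \<open>One more than for the Richardson tableau: the entry \<open>N\<close> had
        level \<open>I - 1\<close> and now lies in the row that has number \<open>I\<close> when
        counted from 0.\<close>
      have sN: "sum_list (drop I (restricted_shape T N)) = Suc (card {x \<in> {..<N}. I \<le> level b x})"
      proof -
        have "{x \<in> {..<N}. I \<le> level b x} = {x \<in> {..<N - 1}. I \<le> level b x}"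
        proof (intro subset_antisym subsetI)
          fix x assume x: "x \<in> {x \<in> {..<N}. I \<le> level b x}"
          hence "x \<noteq> N - 1" by (auto simp: I_def)
          thus "x \<in> {x \<in> {..<N - 1}. I \<le> level b x}" using x by auto
        qed auto
        moreover have "{y. 1 \<le> y \<and> y \<le> N \<and> y \<le> N \<and> I \<le> row_of T y} =
            insert N (Suc ` {x \<in> {..<N - 1}. I \<le> level b x})"
        proof (intro subset_antisym subsetI)
          fix y assume y: "y \<in> {y. 1 \<le> y \<and> y \<le> N \<and> y \<le> N \<and> I \<le> row_of T y}"
          show "y \<in> insert N (Suc ` {x \<in> {..<N - 1}. I \<le> level b x})"
          proof (cases "y = N")
            case False
            hence "y - 1 < N - 1" "Suc (y - 1) = y" using y by auto
            thus ?thesis using rowT'[of "y - 1"] y by (intro insertI2 image_eqI[of _ _ "y - 1"]) auto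
          qed simp
        qed (use rowT' rowT_N N in auto)
        moreover have "N \<notin> Suc ` {x \<in> {..<N - 1}. I \<le> level b x}" by auto
        ultimately show ?thesis by (simp add: T.sum_list_drop_restricted_shape card_image)
      qed
      \<comment> \<open>The chain numbered \<open>J\<close> reaches level \<open>I - 1\<close>
        inside this corner, so the shape has at least \<open>I\<close> rows.\<close>
      have lenI: "I \<le> length (restricted_shape T ?M)"
      proof (rule ccontr)
        assume "\<not> I \<le> length (restricted_shape T ?M)"
        hence "{x \<in> {..<?M}. I - 1 \<le> level b x} = {}" using sM[of "I - 1"] by simp
        moreover have "I - 1 \<le> level b (off + (I - 1))"
        proof -
          have "{off..<off + (I - 1)} \<subseteq> {y. y < off + (I - 1) \<and> b y = b (off + (I - 1))}"
          proof
            fix y assume y: "y \<in> {off..<off + (I - 1)}"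
            hence "y \<in> {x. x < N \<and> b x = J}" "off + (I - 1) \<in> {x. x < N \<and> b x = J}"
              unfolding blockJ using I_pos by auto
            thus "y \<in> {y. y < off + (I - 1) \<and> b y = b (off + (I - 1))}" using y by auto
          qed
          from card_mono[OF _ this] show ?thesis by (simp add: level_def)
        qed
        ultimately show False using I_pos by auto
      qed
      have M: "?M \<in> {1..N}" "N \<in> {1..N}" using off_I I_pos N by auto
      obtain f g where fg: "\<forall>i<?M - I. f i < ?M" "\<forall>i<?M - I. g i < ?M"
        and nz: "coeff (pencil_minor (\<lambda>r c. truncate B ?M $$ (r, c)) (?M - I) f g)
          (sum_list (drop I (restricted_shape T ?M))) \<noteq> 0"
        using pencil_minor_jordan_type_coeff[OF T.restricted_shape_sorted U(3)[OF B M(1)] mat_carrier lenI] by blast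
      show ?thesis
      proof (rule P.peval_F_eq_0[OF supp])
        show "f i < off + I" "g i < off + I" if "i < off" for i using fg that by auto
        have "pencil_minor (\<lambda>r c. truncate B ?M $$ (r, c)) off f g = pencil_minor (\<lambda>r c. B $$ (r, c)) off f g"
          by (rule pencil_minor_truncate) (use fg in auto)
        thus "coeff (pencil_minor (\<lambda>r c. B $$ (r, c)) off f g) (card {x \<in> {..<off + I}. I \<le> level b x}) \<noteq> 0"
          using nz unfolding sM by (simp only: add_diff_cancel_right') simp
        fix f g assume fg: "\<And>i. i < N - I \<Longrightarrow> f i < N" "\<And>i. i < N - I \<Longrightarrow> g i < N"
        have "N = N - I + I" using off_I by simp
        from pencil_minor_jordan_type_dvd[OF T.restricted_shape_sorted U(3)[OF B M(2)] mat_carrier fg this]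
        have "monom 1 (sum_list (drop I (restricted_shape T N))) dvd
            pencil_minor (\<lambda>r c. truncate B N $$ (r, c)) (N - I) f g" .
        moreover have "pencil_minor (\<lambda>r c. truncate B N $$ (r, c)) (N - I) f g =
            pencil_minor (\<lambda>r c. B $$ (r, c)) (N - I) f g"
          by (rule pencil_minor_truncate[OF fg])
        ultimately show "monom 1 (Suc (card {x \<in> {..<N}. I \<le> level b x})) dvd
            pencil_minor (\<lambda>r c. B $$ (r, c)) (N - I) f g"
          unfolding sN by (simp only:)
      qed
    qed
    thus ?thesis by (rule irreducible_in_dense[OF irr U(1,2) F_sym_alg _ that])
  qed
  have "V \<subseteq> nilradical N" using irr by (simp add: irreducible_in_def)
  hence F_Y: "peval P.F A = 0" if "A \<in> zariski N closure_of V" for A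
    using peval_closure_of[OF F_sym_alg _ F_V that] by simp
  have Y: "zariski N closure_of V = {A \<in> m_space N \<tau>. peval P.F A = 0}"
    using codim_1_eq_H[OF codim[unfolded m_space_def] F_Y] by (simp add: m_space_def)

  \<comment> \<open>Degree one leaves only two adjacent chains of length one at the end, and then
    \<open>F\<close> is the coordinate belonging to the last simple root.\<close>
  have degree: "2 \<le> card P.Rows - P.e"
  proof (cases "\<exists>x\<in>P.X. b off < b x \<and> b x < b (N - 1)")
    case True
    thus ?thesis using P.degree_ge_2 by blast
  next
    case False
    show ?thesis
    proof (rule ccontr)
      assume "\<not> 2 \<le> card P.Rows - P.e"
      hence I1: "I = 1" using P.degree_ge_I I_pos by linarith
      have "P.X = {off, N - 1}"
      proof (intro subset_antisym subsetI)
        fix x assume x: "x \<in> P.X"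
        hence "b x = J \<or> b x = K" using False P.X_bounds[OF x] offJ by (force simp: K_def)
        moreover have "x < N" using x by (simp add: P.X_def)
        ultimately have "x \<in> {off..<off + I} \<or> x \<in> {N - I..<N}" using blockJ blockK by blast
        thus "x \<in> {off, N - 1}" using I1 by auto
      qed (use P.off_in in auto)
      hence "card P.X \<le> 2" by (simp add: card_insert_if)
      hence N2: "N = off + 2" using off_I I1 by (simp add: P.X_def)
      have e0: "P.e = 0"
      proof -
        have "\<not> I \<le> level b x" if "x \<in> P.X" for x
          using P.level_range(1)[OF that] \<open>P.X = _\<close> that I1 P.card_first_block P.card_last_block by auto
        hence "{x \<in> P.X. I \<le> level b x} = {}" by blast
        thus ?thesis by (simp only: P.e_def card.empty)
      qed
      have less: "b (N - 2) < b (N - 1)" using P.first_less_last N2 by simp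
      have F_entry: "peval P.F A = A $$ (N - 2, N - 1)" for A
        unfolding P.peval_F e0 using N2 I1 less
        by (simp add: pencil_minor_def det_mat pencil_def)
      have "N - 1 \<in> tau N V"
      proof (rule last_root_in_tau[OF ov])
        show "zariski N closure_of V = {A \<in> m_space N \<tau>. A $$ (N - 2, N - 1) = 0}"
          using Y unfolding F_entry .
        show "blk \<tau> x < blk \<tau> (N - 2)" if "x < N - 2" for x
          using before[of x] that N2 by (simp add: b_def)
      qed (use N2 less in \<open>auto simp: b_def\<close>)
      moreover have "N - 1 \<notin> \<tau>"
        using less blk_Suc[of \<tau> "N - 2"] N2 by (auto simp: b_def split: if_splits)
      ultimately show False by (simp add: \<tau>_def)
    qed
  qed

  obtain t where t: "P.edge off t" using P.first_row_edge by blast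
  obtain s where s: "P.edge s (N - 1)" using P.last_column_edge by blast
  \<comment> \<open>The matrix row \<open>off\<close>, counted from 0, carries the variables whose
    roots start at the simple root \<open>Suc off\<close>.\<close>
  have sigma: "sigma N V = {Suc off..N - 1}"
  proof (rule sigma_eq[OF _ _ P.homogeneous_F degree])
    show "hypersurface N (pos_roots N - pos_roots_of N (tau N V)) P.F" using hs by (simp add: \<tau>_def)
    show "zariski N closure_of V = {A \<in> m_space N (tau N V). peval P.F A = 0}" using Y by (simp add: \<tau>_def)
    show "(Suc off, Suc t) \<in> mvars P.F" using t by (simp add: P.edge_def)
    show "(Suc s, N) \<in> mvars P.F" using s N by (simp add: P.edge_def Suc_N)
    fix s t assume "(s, t) \<in> mvars P.F"
    then obtain s' t' where "(s, t) = (Suc s', Suc t')" "s' \<in> P.Rows" by (rule P.mvars_F_rising)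
    thus "Suc off \<le> s" by (auto simp: P.Rows_def)
  qed
  have sigma_iff: "sigma N V = simple_roots N \<longleftrightarrow> off = 0"
  proof
    assume "sigma N V = simple_roots N"
    hence "1 \<in> {Suc off..N - 1}" unfolding sigma simple_roots_def using off_I I_pos by auto
    thus "off = 0" by simp
  next
    assume "off = 0"
    thus "sigma N V = simple_roots N" unfolding sigma simple_roots_def using N by auto
  qed
  have off_iff: "off = 0 \<longleftrightarrow> J = 0"
  proof
    assume "J = 0"
    show "off = 0"
    proof (rule ccontr)
      assume "off \<noteq> 0"
      hence "b 0 < b off" using before[of 0] by simp
      thus False using offJ \<open>J = 0\<close> by simp
    qed
  qed (use offJ in \<open>simp add: b_def\<close>)

  have chain_first: "card (chain N \<tau> 1) = c 0"
    using card_chain[OF \<tau>, of 0] N by (simp add: c_def b_def)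
  have "row_length T\<^sub>R 1 = Suc K"
  proof -
    have "{i. i \<le> K \<and> 0 < c i} = {..K}" using c_pos by auto
    thus ?thesis using row_length_R[of 0] by simp
  qed
  hence chain_last: "card (chain N \<tau> (row_length T\<^sub>R 1)) = I"
    using card_chain[OF \<tau>, of K] N c_K by (simp add: c_def b_def K_def)
  have two_iff: "row_length T\<^sub>R i = row_length T\<^sub>R (i + 1) + 2 \<longleftrightarrow> card {l. l \<le> K \<and> c l = i} = 2" if "0 < i" for i
    using length_diff[OF that] by simp
  \<comment> \<open>If the first chain has length \<open>I\<close> but \<open>J\<close> is not the
    first one, then 0, \<open>J\<close> and \<open>K\<close> are three chains of that length; this
    is what the second condition rules out.\<close>
  have "J = 0 \<longleftrightarrow> c 0 = I \<and> card {l. l \<le> K \<and> c l = I} = 2"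
  proof
    assume "J = 0"
    have "{l. l \<le> K \<and> c l = I} = {0, K}"
    proof (intro subset_antisym subsetI)
      fix l assume l: "l \<in> {l. l \<le> K \<and> c l = I}"
      show "l \<in> {0, K}"
      proof (cases "l = K")
        case False
        thus ?thesis using J_max[of l] l \<open>J = 0\<close> by simp
      qed simp
    qed (use J c_K \<open>J = 0\<close> in auto)
    thus "c 0 = I \<and> card {l. l \<le> K \<and> c l = I} = 2" using J \<open>J = 0\<close> by simp
  next
    assume *: "c 0 = I \<and> card {l. l \<le> K \<and> c l = I} = 2"
    show "J = 0"
    proof (rule ccontr)
      assume "J \<noteq> 0"
      have "{0, J, K} \<subseteq> {l. l \<le> K \<and> c l = I}" using * J c_K by auto
      hence "card {0, J, K} \<le> 2" using card_mono[of "{l. l \<le> K \<and> c l = I}" "{0, J, K}"] * by simp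
      thus False using \<open>J \<noteq> 0\<close> J by simp
    qed
  qed
  thus ?thesis
    unfolding sigma_iff off_iff tauR Let_def chain_first chain_last
    using two_iff[of "c 0"] c_pos[of 0] by auto
qed

end
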